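(* The quasicompact algebra $Q\mathcal{A}_p=(\mathcal{A}_p+\mathcal{K})\cap(\mathcal{A}_p^*+\mathcal{K})$ is strictly larger than $\mathcal{A}_p\cap\mathcal{A}_p^*+\mathcal{K}$, and $\mathcal{A}_p\cap\mathcal{A}_p^*+\mathcal{K}=\mathbb{C}I+\mathcal{K}$.
   Context: On $L^2(\mathbb{R})$ let $(M_\lambda f)(x)=e^{i\lambda x}f(x)$, $(D_\mu f)(x)=f(x-\mu)$. The parabolic algebra $\mathcal{A}_p$ is the weak operator topology closed algebra generated by $\{M_\lambda:\lambda\geq0\}\cup\{D_\mu:\mu\geq0\}$. $\mathcal{K}$ denotes the ideal of compact operators on $L^2(\mathbb{R})$ and $\mathcal{A}_p^*=\{A^*:A\in\mathcal{A}_p\}$. *)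

theory Defs
  imports "HOL-Analysis.Analysis"
begin

(* Functions on the real line; L^2(R) elements are represented by Borel
   square-integrable representatives, identified up to a.e. equality. *)
type_synonym fn = "real \<Rightarrow> complex"
type_synonym op = "fn \<Rightarrow> fn"

definition L2 :: "fn set" where
  "L2 = {f. f \<in> borel_measurable borel \<and> integrable lborel (\<lambda>x. (cmod (f x))^2)}"

definition l2inner :: "fn \<Rightarrow> fn \<Rightarrow> complex" where
  "l2inner f g = (LINT x|lborel. cnj (f x) * g x)"

definition l2norm :: "fn \<Rightarrow> real" where
  "l2norm f = sqrt (LINT x|lborel. (cmod (f x))^2)"

definition ae_eq :: "fn \<Rightarrow> fn \<Rightarrow> bool" where
  "ae_eq f g \<longleftrightarrow> (AE x in lborel. f x = g x)"

definition bop :: "op \<Rightarrow> bool" where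
  "bop T \<longleftrightarrow> (\<forall>f\<in>L2. T f \<in> L2)
     \<and> (\<forall>f\<in>L2. \<forall>g\<in>L2. ae_eq f g \<longrightarrow> ae_eq (T f) (T g))
     \<and> (\<forall>f\<in>L2. \<forall>g\<in>L2. \<forall>c. ae_eq (T (\<lambda>x. c * f x + g x)) (\<lambda>x. c * T f x + T g x))
     \<and> (\<exists>C. \<forall>f\<in>L2. l2norm (T f) \<le> C * l2norm f)"

definition op_eq :: "op \<Rightarrow> op \<Rightarrow> bool" where
  "op_eq T S \<longleftrightarrow> (\<forall>f\<in>L2. ae_eq (T f) (S f))"

definition op_add :: "op \<Rightarrow> op \<Rightarrow> op" where
  "op_add T S = (\<lambda>f x. T f x + S f x)"

definition op_scale :: "complex \<Rightarrow> op \<Rightarrow> op" where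
  "op_scale c T = (\<lambda>f x. c * T f x)"

definition Mop :: "real \<Rightarrow> op" where
  "Mop lam = (\<lambda>f x. exp (\<i> * complex_of_real (lam * x)) * f x)"

definition Dop :: "real \<Rightarrow> op" where
  "Dop mu = (\<lambda>f x. f (x - mu))"

inductive_set gen_alg :: "op set" where
  gen_M: "lam \<ge> 0 \<Longrightarrow> Mop lam \<in> gen_alg"
| gen_D: "mu \<ge> 0 \<Longrightarrow> Dop mu \<in> gen_alg"
| gen_add: "T \<in> gen_alg \<Longrightarrow> S \<in> gen_alg \<Longrightarrow> op_add T S \<in> gen_alg"
| gen_scale: "T \<in> gen_alg \<Longrightarrow> op_scale c T \<in> gen_alg"
| gen_mult: "T \<in> gen_alg \<Longrightarrow> S \<in> gen_alg \<Longrightarrow> T \<circ> S \<in> gen_alg"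

definition wot_closure :: "op set \<Rightarrow> op set" where
  "wot_closure S = {T. bop T \<and>
     (\<forall>F. finite F \<and> F \<subseteq> L2 \<times> L2 \<longrightarrow>
        (\<forall>e>0. \<exists>A\<in>S. \<forall>(f,g)\<in>F. cmod (l2inner (T f) g - l2inner (A f) g) < e))}"

definition Ap :: "op set" where
  "Ap = wot_closure gen_alg"

definition is_adjoint :: "op \<Rightarrow> op \<Rightarrow> bool" where
  "is_adjoint S T \<longleftrightarrow> bop T \<and> bop S \<and>
     (\<forall>f\<in>L2. \<forall>g\<in>L2. l2inner (T f) g = l2inner f (S g))"

definition Ap_star :: "op set" where
  "Ap_star = {S. \<exists>A\<in>Ap. is_adjoint S A}"

definition compact_op :: "op \<Rightarrow> bool" where
  "compact_op T \<longleftrightarrow> bop T \<and>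
     (\<forall>u :: nat \<Rightarrow> fn. (\<forall>n. u n \<in> L2) \<and> (\<exists>B. \<forall>n. l2norm (u n) \<le> B) \<longrightarrow>
        (\<exists>r g. strict_mono r \<and> g \<in> L2 \<and>
           (\<lambda>n. l2norm (\<lambda>x. T (u (r n)) x - g x)) \<longlonglongrightarrow> 0))"

definition plus_K :: "op set \<Rightarrow> op set" where
  "plus_K X = {T. \<exists>A\<in>X. \<exists>K. compact_op K \<and> op_eq T (op_add A K)}"

definition scalar_ops :: "op set" where
  "scalar_ops = {op_scale c id | c. True}"

definition QAp :: "op set" where
  "QAp = plus_K Ap \<inter> plus_K Ap_star"

end

theory Submission
  imports Defs "HOL-Complex_Analysis.Complex_Analysis" "HOL-Real_Asymp.Real_Asymp"
    "HOL-Probability.Sinc_Integral"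
begin

text \<open>
  An operator in \<open>Ap\<close> whose adjoint is in \<open>Ap\<close> commutes with all cut-offs to half-lines, so it is
  multiplication by a function \<open>\<psi>\<close>; since it also preserves the Hardy space together with its adjoint,
  the Poisson integral of \<open>\<psi>\<close> is constant, and so is \<open>\<psi>\<close>.

  For the strict inclusion, average the resolvents \<open>1 / (1 - i x / b)\<close> of the modulations and the
  resolvents of the translations over \<open>N\<close> lacunary parameters. The product \<open>B\<close> of the two averages
  is a compact element of \<open>Ap\<close> that is close to the identity on a fixed vector, while \<open>B - B*\<close> has
  norm \<open>O(N\<^sup>-\<^sup>1\<^sup>/\<^sup>2)\<close>. A sum of translates of such operators with rapidly growing \<open>N\<close> is a bounded
  element \<open>X\<close> of \<open>Ap\<close> with \<open>X - X*\<close> compact, and it is not a compact perturbation of a scalar.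
\<close>

section \<open>The Hilbert space of square-integrable functions\<close>

text \<open>Since an element of \<open>Ap\<close> with adjoint in \<open>Ap\<close> is scalar, a
  witness for strictness can only be selfadjoint up to a compact error. The model is a bounded
  analytic function with small imaginary part that still passes from 1 near 0 to 0 at infinity: a
  real one would be constant, but the passage can be spread over many scales. A single 1 / (1 - i x
  / b) has imaginary part 1/2 at x = b; for lacunary b hardly any two of these imaginary parts are
  large at the same point, so averaging shrinks them. Functions of position alone give no compact
  operators, hence the second average over translations; its price is a commutator, small because
  all parameters are large. One such compact operator proves nothing, so infinitely many far-apart
  translates are summed. Conjugation by a translation of either sign is harmless, because it
  multiplies each product of a modulation and a translation by a unimodular scalar. All blocks sit
  on the positive half-line; the negative one is left free to show that a scalar part of
  \<open>X\<close> would vanish.\<close>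

lemma borel_measurable_cnj [measurable]:
  "f \<in> borel_measurable M \<Longrightarrow> (\<lambda>x. cnj (f x)) \<in> borel_measurable M"
  by (rule measurable_compose[OF _ borel_measurable_continuous_onI]) (auto intro: continuous_intros)

lemma L2_measurable [measurable_dest]: "f \<in> L2 \<Longrightarrow> f \<in> borel_measurable borel"
  by (simp add: L2_def)

lemma L2_integrable_square: "f \<in> L2 \<Longrightarrow> integrable lborel (\<lambda>x. (cmod (f x))\<^sup>2)"
  by (simp add: L2_def)

lemma L2_dominated:
  assumes "f \<in> borel_measurable borel" "integrable lborel g" "\<And>x. (cmod (f x))\<^sup>2 \<le> g x"
  shows "f \<in> L2"
proof -
  have "integrable lborel (\<lambda>x. (cmod (f x))\<^sup>2)"
  proof (rule Bochner_Integration.integrable_bound[OF assms(2)])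
    show "AE x in lborel. norm ((cmod (f x))\<^sup>2) \<le> norm (g x)"
      using assms(3) by (intro AE_I2) (simp add: order_trans[OF _ abs_ge_self])
  qed (use assms(1) in measurable)
  then show ?thesis using assms(1) by (simp add: L2_def)
qed

lemma L2_zero: "(\<lambda>_. 0) \<in> L2"
  by (simp add: L2_def)

lemma L2_add:
  assumes "f \<in> L2" "g \<in> L2" shows "(\<lambda>x. f x + g x) \<in> L2"
proof (rule L2_dominated[of _ "\<lambda>x. 2 * (cmod (f x))\<^sup>2 + 2 * (cmod (g x))\<^sup>2"])
  show "(cmod (f x + g x))\<^sup>2 \<le> 2 * (cmod (f x))\<^sup>2 + 2 * (cmod (g x))\<^sup>2" for x
  proof -
    have "(cmod (f x + g x))\<^sup>2 \<le> (cmod (f x) + cmod (g x))\<^sup>2"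
      by (intro power_mono norm_triangle_ineq norm_ge_zero)
    also have "\<dots> \<le> 2 * (cmod (f x))\<^sup>2 + 2 * (cmod (g x))\<^sup>2"
      using sum_squares_bound[of "cmod (f x)" "cmod (g x)"] by (simp add: power2_sum)
    finally show ?thesis .
  qed
qed (use assms in \<open>auto intro!: L2_integrable_square\<close>)

lemma L2_bounded_mult:
  assumes "f \<in> L2" "\<phi> \<in> borel_measurable borel" "\<And>x. cmod (\<phi> x) \<le> B"
  shows "(\<lambda>x. \<phi> x * f x) \<in> L2"
proof (rule L2_dominated[of _ "\<lambda>x. B\<^sup>2 * (cmod (f x))\<^sup>2"])
  show "(cmod (\<phi> x * f x))\<^sup>2 \<le> B\<^sup>2 * (cmod (f x))\<^sup>2" for x
    using assms(3)[of x] by (simp add: norm_mult power_mult_distrib mult_right_mono power_mono)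
qed (use assms in \<open>auto intro!: L2_integrable_square\<close>)

lemma L2_scale: "f \<in> L2 \<Longrightarrow> (\<lambda>x. c * f x) \<in> L2"
  by (rule L2_bounded_mult[where B = "cmod c"]) auto

lemma L2_uminus: "f \<in> L2 \<Longrightarrow> (\<lambda>x. - f x) \<in> L2"
  using L2_scale[of f "-1"] by simp

lemma L2_diff: "f \<in> L2 \<Longrightarrow> g \<in> L2 \<Longrightarrow> (\<lambda>x. f x - g x) \<in> L2"
  using L2_add[of f "\<lambda>x. - g x"] L2_uminus by simp

lemma L2_cnj: "f \<in> L2 \<Longrightarrow> (\<lambda>x. cnj (f x)) \<in> L2"
  unfolding L2_def by auto

lemma L2_shift:
  assumes "f \<in> L2" shows "(\<lambda>x. f (x - t)) \<in> L2"
  using assms lborel_integrable_real_affine[of "\<lambda>x. (cmod (f x))\<^sup>2" 1 "-t"] 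
  by (auto simp: L2_def)

lemma L2_integrable_mult:
  assumes "f \<in> L2" "g \<in> L2" shows "integrable lborel (\<lambda>x. f x * g x)"
proof (rule Bochner_Integration.integrable_bound)
  show "integrable lborel (\<lambda>x. (cmod (f x))\<^sup>2 + (cmod (g x))\<^sup>2)"
    using assms by (auto intro: L2_integrable_square)
  show "AE x in lborel. norm (f x * g x) \<le> norm ((cmod (f x))\<^sup>2 + (cmod (g x))\<^sup>2)"
  proof (rule AE_I2)
    fix x
    have "0 \<le> cmod (f x) * cmod (g x)" by simp
    then have "cmod (f x) * cmod (g x) \<le> (cmod (f x))\<^sup>2 + (cmod (g x))\<^sup>2"
      using sum_squares_bound[of "cmod (f x)" "cmod (g x)"] by linarith
    then show "norm (f x * g x) \<le> norm ((cmod (f x))\<^sup>2 + (cmod (g x))\<^sup>2)"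
      by (simp add: norm_mult)
  qed
qed (use assms in measurable)

lemma L2_integrable_inner:
  "f \<in> L2 \<Longrightarrow> g \<in> L2 \<Longrightarrow> integrable lborel (\<lambda>x. cnj (f x) * g x)"
  by (rule L2_integrable_mult[OF L2_cnj])

section \<open>The quotient by almost everywhere equality\<close>

definition l2rel :: "fn \<Rightarrow> fn \<Rightarrow> bool" where
  "l2rel f g \<longleftrightarrow> f \<in> L2 \<and> g \<in> L2 \<and> ae_eq f g"

\<comment> \<open>A partial quotient, because functions outside \<open>L2\<close> represent no
  element.\<close>
quotient_type l2 = fn / partial: l2rel
proof (rule part_equivpI)
  show "\<exists>x. l2rel x x"
    using L2_zero by (auto simp: l2rel_def ae_eq_def)
  show "symp l2rel"
    by (auto simp: symp_def l2rel_def ae_eq_def elim!: eventually_mono)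
  show "transp l2rel"
    unfolding transp_def l2rel_def ae_eq_def
  proof (intro allI impI, elim conjE, intro conjI)
    fix f g h :: fn
    assume "AE x in lborel. f x = g x" "AE x in lborel. g x = h x"
    then show "AE x in lborel. f x = h x" by eventually_elim simp
  qed
qed

text \<open>Only the real structure is registered, with the real part of \<open>l2inner\<close> as
  inner product; it supplies the norm, Cauchy-Schwarz, Pythagoras and the type of bounded linear
  maps. Complex scalars come back as \<open>cscale\<close> and \<open>cinner\<close>, and complex
  linearity as the predicate \<open>clinear_op\<close>.\<close>

instantiation l2 :: real_inner
begin

lift_definition zero_l2 :: l2 is "\<lambda>_. 0"
  by (auto simp: l2rel_def ae_eq_def L2_zero)

lift_definition plus_l2 :: "l2 \<Rightarrow> l2 \<Rightarrow> l2" is "\<lambda>f g x. f x + g x"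
  by (auto simp: l2rel_def ae_eq_def intro: L2_add)

lift_definition uminus_l2 :: "l2 \<Rightarrow> l2" is "\<lambda>f x. - f x"
  by (auto simp: l2rel_def ae_eq_def intro: L2_uminus)

lift_definition minus_l2 :: "l2 \<Rightarrow> l2 \<Rightarrow> l2" is "\<lambda>f g x. f x - g x"
  by (auto simp: l2rel_def ae_eq_def intro: L2_diff)

lift_definition scaleR_l2 :: "real \<Rightarrow> l2 \<Rightarrow> l2" is "\<lambda>r f x. complex_of_real r * f x"
  by (auto simp: l2rel_def ae_eq_def intro: L2_scale)

lift_definition inner_l2 :: "l2 \<Rightarrow> l2 \<Rightarrow> real" is "\<lambda>f g. Re (l2inner f g)"
  unfolding l2rel_def ae_eq_def l2inner_def
  by (intro arg_cong[of _ _ Re] integral_cong_AE) auto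

definition norm_l2 :: "l2 \<Rightarrow> real" where "norm_l2 x = sqrt (inner x x)"
definition sgn_l2 :: "l2 \<Rightarrow> l2" where "sgn_l2 x = scaleR (inverse (norm x)) x"
definition dist_l2 :: "l2 \<Rightarrow> l2 \<Rightarrow> real" where "dist_l2 x y = norm (x - y)"
definition uniformity_l2 :: "(l2 \<times> l2) filter" where
  "uniformity_l2 = (INF e\<in>{0<..}. principal {(x, y). dist x y < e})"
definition open_l2 :: "l2 set \<Rightarrow> bool" where
  "open_l2 U \<longleftrightarrow> (\<forall>x\<in>U. eventually (\<lambda>(x', y). x' = x \<longrightarrow> y \<in> U) uniformity)"

instance
proof
  fix a b :: real and x y z :: l2
  show "x + y + z = x + (y + z)"
    by transfer (auto simp: l2rel_def ae_eq_def add.assoc intro!: L2_add)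
  show "x + y = y + x"
    by transfer (auto simp: l2rel_def ae_eq_def add.commute intro!: L2_add)
  show "0 + x = x"
    by transfer (auto simp: l2rel_def ae_eq_def)
  show "- x + x = 0"
    by transfer (auto simp: l2rel_def ae_eq_def L2_zero)
  show "x - y = x + - y"
    by transfer (auto simp: l2rel_def ae_eq_def intro!: L2_add L2_uminus L2_diff)
  show "a *\<^sub>R (x + y) = a *\<^sub>R x + a *\<^sub>R y"
    by transfer (auto simp: l2rel_def ae_eq_def distrib_left intro!: L2_add L2_scale)
  show "(a + b) *\<^sub>R x = a *\<^sub>R x + b *\<^sub>R x"
    by transfer (auto simp: l2rel_def ae_eq_def distrib_right intro!: L2_add L2_scale)
  show "a *\<^sub>R b *\<^sub>R x = (a * b) *\<^sub>R x"
    by transfer (auto simp: l2rel_def ae_eq_def mult.assoc intro!: L2_scale)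
  show "1 *\<^sub>R x = x"
    by transfer (auto simp: l2rel_def ae_eq_def)
  show "inner x y = inner y x"
  proof transfer
    fix f g :: fn
    have "l2inner f g = cnj (l2inner g f)"
      unfolding l2inner_def by (subst Bochner_Integration.integral_cnj[symmetric]) (simp add: mult.commute)
    then show "Re (l2inner f g) = Re (l2inner g f)" by simp
  qed
  show "inner (x + y) z = inner x z + inner y z"
    by transfer (simp add: l2rel_def l2inner_def ring_distribs L2_integrable_inner)
  show "inner (a *\<^sub>R x) y = a * inner x y"
    by transfer (simp add: l2rel_def l2inner_def mult.assoc)
  have sq: "Re (l2inner f f) = (LINT x|lborel. (cmod (f x))\<^sup>2)" for f
  proof -
    have "l2inner f f = (LINT x|lborel. complex_of_real ((cmod (f x))\<^sup>2))"
      unfolding l2inner_def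
    by (intro Bochner_Integration.integral_cong refl) (simp only: complex_norm_square mult.commute)
    then show ?thesis by (simp only: integral_complex_of_real Re_complex_of_real)
  qed
  show "0 \<le> inner x x"
    by transfer (simp add: sq)
  show "inner x x = 0 \<longleftrightarrow> x = 0"
    by transfer (auto simp: sq l2rel_def L2_zero ae_eq_def integral_nonneg_eq_0_iff_AE L2_integrable_square)
qed (simp_all add: norm_l2_def sgn_l2_def dist_l2_def uniformity_l2_def open_l2_def)

end

lift_definition cscale :: "complex \<Rightarrow> l2 \<Rightarrow> l2" (infixr "*\<^sub>C" 75) is "\<lambda>c f x. c * f x"
  by (auto simp: l2rel_def ae_eq_def intro: L2_scale)

lift_definition cinner :: "l2 \<Rightarrow> l2 \<Rightarrow> complex" is l2inner
  unfolding l2rel_def ae_eq_def l2inner_def by (intro integral_cong_AE) auto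

definition cls :: "fn \<Rightarrow> l2" where "cls = abs_l2"
definition rep :: "l2 \<Rightarrow> fn" where "rep = rep_l2"

lemma rep_L2: "rep x \<in> L2"
  using Quotient_rep_reflp[OF Quotient_l2, of x] by (simp add: rep_def l2rel_def)

lemma cls_rep [simp]: "cls (rep x) = x"
  using Quotient_abs_rep[OF Quotient_l2, of x] by (simp add: rep_def cls_def)

lemma cls_eq_iff: "f \<in> L2 \<Longrightarrow> g \<in> L2 \<Longrightarrow> cls f = cls g \<longleftrightarrow> ae_eq f g"
  using Quotient_rel[OF Quotient_l2, of f g]
  by (auto simp: cls_def l2rel_def ae_eq_def)

lemma l2_cases: obtains f where "f \<in> L2" "x = cls f"
  using rep_L2 cls_rep by metis

lemma cr_l2I: "f \<in> L2 \<Longrightarrow> l2rel f f" by (simp add: l2rel_def ae_eq_def)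

lemma cls_add: "f \<in> L2 \<Longrightarrow> g \<in> L2 \<Longrightarrow> cls f + cls g = cls (\<lambda>x. f x + g x)"
  unfolding cls_def by (rule plus_l2.abs_eq) (auto intro: cr_l2I)

lemma cls_diff: "f \<in> L2 \<Longrightarrow> g \<in> L2 \<Longrightarrow> cls f - cls g = cls (\<lambda>x. f x - g x)"
  unfolding cls_def by (rule minus_l2.abs_eq) (auto intro: cr_l2I)

lemma cls_cscale: "f \<in> L2 \<Longrightarrow> c *\<^sub>C cls f = cls (\<lambda>x. c * f x)"
  unfolding cls_def by (rule cscale.abs_eq) (auto intro: cr_l2I)

lemma cls_zero: "cls (\<lambda>_. 0) = 0"
  unfolding cls_def zero_l2_def by simp

lemma scaleR_cscale: "r *\<^sub>R x = complex_of_real r *\<^sub>C x"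
  by transfer (auto simp: l2rel_def ae_eq_def intro: L2_scale)

lemma cinner_cls: "f \<in> L2 \<Longrightarrow> g \<in> L2 \<Longrightarrow> cinner (cls f) (cls g) = l2inner f g"
  unfolding cls_def by (rule cinner.abs_eq) (auto intro: cr_l2I)

lemma inner_cinner: "inner x y = Re (cinner x y)"
  by transfer simp

lemma cinner_commute: "cinner x y = cnj (cinner y x)"
proof transfer
  fix f g :: fn
  show "l2inner f g = cnj (l2inner g f)"
    unfolding l2inner_def by (subst Bochner_Integration.integral_cnj[symmetric]) (simp add: mult.commute)
qed

lemma cinner_add_left: "cinner (x + y) z = cinner x z + cinner y z"
  by transfer (simp add: l2rel_def l2inner_def ring_distribs L2_integrable_inner)

lemma cinner_add_right: "cinner x (y + z) = cinner x y + cinner x z"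
  by transfer (simp add: l2rel_def l2inner_def ring_distribs L2_integrable_inner)

lemma cinner_scale_left: "cinner (c *\<^sub>C x) y = cnj c * cinner x y"
  by transfer (simp add: l2rel_def l2inner_def mult.assoc)

lemma cinner_scale_right: "cinner x (c *\<^sub>C y) = c * cinner x y"
  by transfer (simp add: l2rel_def l2inner_def mult.left_commute)

lemma cinner_self: "cinner x x = complex_of_real ((norm x)\<^sup>2)"
proof -
  have "Im (cinner x x) = 0"
    using arg_cong[OF cinner_commute[of x x], of Im] by simp
  then show ?thesis
    by (simp add: complex_eq_iff power2_norm_eq_inner inner_cinner)
qed

lemma norm_cscale: "norm (c *\<^sub>C x) = cmod c * norm x"
proof -
  have "complex_of_real ((norm (c *\<^sub>C x))\<^sup>2) = complex_of_real ((cmod c * norm x)\<^sup>2)"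
    unfolding cinner_self[symmetric] cinner_scale_left cinner_scale_right
    using complex_norm_square[of c] by (simp add: cinner_self power_mult_distrib mult.commute mult.left_commute)
  then have "(norm (c *\<^sub>C x))\<^sup>2 = (cmod c * norm x)\<^sup>2" using of_real_eq_iff by blast
  then show ?thesis by (simp add: power2_eq_iff_nonneg)
qed

text \<open>Multiplying \<open>y\<close> by a unimodular \<open>c\<close> rotates the inner product
  onto the nonnegative axis, which reduces the claim to the real Cauchy-Schwarz inequality.\<close>

lemma norm_cinner_le: "cmod (cinner x y) \<le> norm x * norm y"
proof -
  obtain c where c: "cmod c = 1" "c * cinner x y = complex_of_real (cmod (cinner x y))"
  proof (cases "cinner x y = 0")
    case True then show ?thesis using that[of 1] by simp
  next
    case False
    show ?thesis
    proof (rule that)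
      show "cmod (cnj (sgn (cinner x y))) = 1" using False by (simp add: norm_sgn)
      show "cnj (sgn (cinner x y)) * cinner x y = complex_of_real (cmod (cinner x y))"
        using False complex_norm_square[of "cinner x y"]
        by (simp add: sgn_div_norm scaleR_conv_of_real field_simps power2_eq_square)
    qed
  qed
  have "cmod (cinner x y) = inner x (c *\<^sub>C y)"
    by (simp add: inner_cinner cinner_scale_right c)
  also have "\<dots> \<le> norm x * norm (c *\<^sub>C y)" by (rule norm_cauchy_schwarz)
  finally show ?thesis by (simp add: norm_cscale c)
qed

lemma norm_cls: "f \<in> L2 \<Longrightarrow> norm (cls f) = l2norm f"
proof -
  assume f: "f \<in> L2"
  have "complex_of_real ((norm (cls f))\<^sup>2) = l2inner f f"
    by (simp only: cinner_self[symmetric] cinner_cls f)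
  also have "\<dots> = (LINT x|lborel. complex_of_real ((cmod (f x))\<^sup>2))"
    unfolding l2inner_def
    by (intro Bochner_Integration.integral_cong refl) (simp only: complex_norm_square mult.commute)
  finally have "(norm (cls f))\<^sup>2 = (LINT x|lborel. (cmod (f x))\<^sup>2)"
    by (simp only: integral_complex_of_real of_real_eq_iff)
  then show ?thesis unfolding l2norm_def by (metis norm_ge_zero real_sqrt_unique)
qed

lemma norm_cls_square: "f \<in> L2 \<Longrightarrow> (norm (cls f))\<^sup>2 = (LINT x|lborel. (cmod (f x))\<^sup>2)"
  by (simp add: norm_cls l2norm_def)

lemma nn_integral_L2:
  "f \<in> L2 \<Longrightarrow> (\<integral>\<^sup>+x. ennreal ((cmod (f x))\<^sup>2) \<partial>lborel) = ennreal ((norm (cls f))\<^sup>2)"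
  by (simp add: norm_cls_square nn_integral_eq_integral L2_integrable_square)

lemma cscale_one [simp]: "1 *\<^sub>C x = x"
  by transfer (auto simp: l2rel_def ae_eq_def)

lemma cscale_zero_left [simp]: "0 *\<^sub>C x = 0"
  by (metis norm_cscale norm_zero mult_zero_left norm_eq_zero)

lemma cinner_diff_left: "cinner (x - y) z = cinner x z - cinner y z"
  using cinner_add_left[of "x - y" y z] by simp

lemma cinner_diff_right: "cinner x (y - z) = cinner x y - cinner x z"
  using cinner_add_right[of x "y - z" z] by simp

lemma cinner_zero_left [simp]: "cinner 0 x = 0" using cinner_diff_left[of 0 0 x] by simp
lemma cinner_zero_right [simp]: "cinner x 0 = 0" using cinner_diff_right[of x 0 0] by simp

lemma cinner_ext: "(\<And>z. cinner x z = cinner y z) \<Longrightarrow> x = y"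
  by (metis cinner_diff_left inner_cinner inner_eq_zero_iff eq_iff_diff_eq_0 zero_complex.sel(1))

lemma bounded_bilinear_cinner: "bounded_bilinear cinner"
proof
  show "cinner (r *\<^sub>R x) y = r *\<^sub>R cinner x y" "cinner x (r *\<^sub>R y) = r *\<^sub>R cinner x y" for r x y
    by (simp_all add: scaleR_cscale cinner_scale_left cinner_scale_right scaleR_conv_of_real)
  show "\<exists>K. \<forall>a b. cmod (cinner a b) \<le> norm a * norm b * K"
    using norm_cinner_le by (intro exI[of _ 1]) simp
qed (simp_all add: cinner_add_left cinner_add_right)

lemmas tendsto_cinner [tendsto_intros] = bounded_bilinear.tendsto[OF bounded_bilinear_cinner]

lemma Cauchy_subsequence_fast:
  fixes X :: "nat \<Rightarrow> 'a::metric_space"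
  assumes "Cauchy X" "\<And>k. 0 < e k"
  obtains r where "strict_mono r" "\<And>k. dist (X (r (Suc k))) (X (r k)) < e k"
proof -
  have "\<exists>N. \<forall>m\<ge>N. \<forall>n\<ge>N. dist (X m) (X n) < e k" for k
    using assms by (auto simp: Cauchy_def)
  then obtain N where N: "\<And>k m n. m \<ge> N k \<Longrightarrow> n \<ge> N k \<Longrightarrow> dist (X m) (X n) < e k"
    by metis
  \<comment> \<open>The sum lies above the threshold \<open>N k\<close>; the summand
    \<open>k\<close> makes the sequence strictly increasing.\<close>
  define r where "r k = k + (\<Sum>j\<le>k. N j)" for k
  have ge: "N k \<le> r k" for k
    unfolding r_def using member_le_sum[of k "{..k}" N] by simp
  have mono: "strict_mono r"
    by (auto simp: strict_mono_Suc_iff r_def)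
  show ?thesis
  proof (rule that[OF mono])
    fix k
    have "r k \<le> r (Suc k)" using mono by (simp add: strict_mono_less_eq)
    then show "dist (X (r (Suc k))) (X (r k)) < e k"
      using ge[of k] by (intro N) auto
  qed
qed

text \<open>The weights \<open>4 ^ n\<close> make the series of squared increments dominate a geometric one, so that one monotone convergence argument gives convergence almost everywhere.\<close>

lemma AE_convergent_of_fast_L2:
  fixes f :: "nat \<Rightarrow> fn"
  assumes f: "\<And>n. f n \<in> L2"
    and fast: "\<And>n. (norm (cls (f (Suc n)) - cls (f n)))\<^sup>2 \<le> (1/8) ^ n"
  shows "AE x in lborel. convergent (\<lambda>n. f n x)"
proof -
  define d where "d n x = f (Suc n) x - f n x" for n x
  have d: "d n \<in> L2" for n unfolding d_def using f by (intro L2_diff)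
  note [measurable] = L2_measurable[OF d]
  have nd: "(norm (cls (d n)))\<^sup>2 \<le> (1/8) ^ n" for n
    using fast[of n] f by (simp add: d_def[abs_def] cls_diff)
  have "(\<integral>\<^sup>+x. (\<Sum>n. ennreal (4 ^ n * (cmod (d n x))\<^sup>2)) \<partial>lborel)
      = (\<Sum>n. \<integral>\<^sup>+x. ennreal (4 ^ n * (cmod (d n x))\<^sup>2) \<partial>lborel)"
    by (rule nn_integral_suminf) auto
  also have "\<dots> \<le> (\<Sum>n. ennreal ((1/2) ^ n))"
  proof (rule suminf_le)
    fix n
    have "(\<integral>\<^sup>+x. ennreal (4 ^ n * (cmod (d n x))\<^sup>2) \<partial>lborel)
        = ennreal (4 ^ n) * (\<integral>\<^sup>+x. ennreal ((cmod (d n x))\<^sup>2) \<partial>lborel)"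
      by (subst nn_integral_cmult[symmetric]) (auto simp: ennreal_mult)
    also have "\<dots> = ennreal (4 ^ n * (norm (cls (d n)))\<^sup>2)"
      by (simp add: nn_integral_L2 d ennreal_mult)
    also have "\<dots> \<le> ennreal (4 ^ n * (1/8) ^ n)"
      by (intro ennreal_leI mult_left_mono nd) auto
    also have "4 ^ n * (1/8) ^ n = ((1/2) ^ n :: real)"
      by (simp flip: power_mult_distrib)
    finally show "(\<integral>\<^sup>+x. ennreal (4 ^ n * (cmod (d n x))\<^sup>2) \<partial>lborel) \<le> ennreal ((1/2) ^ n)" .
  qed auto
  also have "\<dots> < \<infinity>"
    by (subst suminf_ennreal2) auto
  finally have "AE x in lborel. (\<Sum>n. ennreal (4 ^ n * (cmod (d n x))\<^sup>2)) \<noteq> \<infinity>"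
    by (intro nn_integral_PInf_AE) auto
  then show ?thesis
  proof eventually_elim
    case (elim x)
    define S where "S = enn2real (\<Sum>n. ennreal (4 ^ n * (cmod (d n x))\<^sup>2))"
    have le: "4 ^ n * (cmod (d n x))\<^sup>2 \<le> S" for n
    proof -
      have "(\<Sum>k\<in>{n}. ennreal (4 ^ k * (cmod (d k x))\<^sup>2)) \<le> (\<Sum>n. ennreal (4 ^ n * (cmod (d n x))\<^sup>2))"
        by (rule sum_le_suminf) auto
      then have "ennreal (4 ^ n * (cmod (d n x))\<^sup>2) \<le> ennreal S"
        using elim by (simp add: S_def less_top)
      then show ?thesis by (subst (asm) ennreal_le_iff) (auto simp: S_def)
    qed
    have "cmod (d n x) \<le> sqrt S * (1/2) ^ n" for n
    proof -
      have "(cmod (d n x) * 2 ^ n)\<^sup>2 \<le> S"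
      proof -
        have "((2::real) ^ n)\<^sup>2 = 4 ^ n" by (subst power_mult[symmetric], subst mult.commute, subst power_mult) simp
        then show ?thesis using le[of n] by (simp add: power_mult_distrib mult.commute)
      qed
      then have "cmod (d n x) * 2 ^ n \<le> sqrt S" by (rule real_le_rsqrt)
      then show ?thesis by (simp add: field_simps power_divide)
    qed
    moreover have "summable (\<lambda>n. sqrt S * (1/2) ^ n)"
      by (intro summable_mult summable_geometric) simp
    ultimately have "summable (\<lambda>n. d n x)"
      by (metis summable_comparison_test')
    then have "convergent (\<lambda>n. \<Sum>k<n. f (Suc k) x - f k x)"
      by (simp add: summable_iff_convergent d_def)
    then have "convergent (\<lambda>n. f n x - f 0 x)"
      by (simp only: sum_lessThan_telescope[of "\<lambda>n. f n x"])
    then show ?case by (metis convergent_diff_const_right_iff)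
  qed
qed

text \<open>Riesz-Fischer: a fast subsequence converges almost everywhere, Fatou's lemma turns the
  pointwise limit into a limit in norm, and a Cauchy sequence follows its subsequence. The rate 1/3
  is chosen because its square 1/9 is below the 1/8 of
  \<open>AE_convergent_of_fast_L2\<close>.\<close>

instance l2 :: banach
proof
  fix X :: "nat \<Rightarrow> l2" assume X: "Cauchy X"
  obtain r where r: "strict_mono r" "\<And>k. dist (X (r (Suc k))) (X (r k)) < (1/3) ^ k"
    using Cauchy_subsequence_fast[OF X, of "\<lambda>k. (1/3) ^ k"] by auto
  define f where "f k = rep (X (r k))" for k
  have f: "f k \<in> L2" and cf: "cls (f k) = X (r k)" for k
    by (simp_all add: f_def rep_L2)
  have ae: "AE x in lborel. convergent (\<lambda>n. f n x)"
  proof (rule AE_convergent_of_fast_L2[OF f])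
    fix n
    have "(norm (cls (f (Suc n)) - cls (f n)))\<^sup>2 \<le> ((1/3) ^ n)\<^sup>2"
      using r(2)[of n] by (intro power_mono) (auto simp: cf dist_norm)
    also have "\<dots> = (1/9) ^ n" by (simp add: power2_eq_square flip: power_mult_distrib)
    also have "\<dots> \<le> (1/8) ^ n" by (intro power_mono) auto
    finally show "(norm (cls (f (Suc n)) - cls (f n)))\<^sup>2 \<le> (1/8) ^ n" .
  qed
  note [measurable] = L2_measurable[OF f]
  \<comment> \<open>On the null set of divergence \<open>lim\<close> has some default value;
    measurability of \<open>g\<close> holds all the same.\<close>
  define g where "g x = lim (\<lambda>n. f n x)" for x
  have [measurable]: "g \<in> borel_measurable borel"
    unfolding g_def by (rule borel_measurable_lim_metric) auto
  have lim: "AE x in lborel. (\<lambda>n. f n x) \<longlonglongrightarrow> g x"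
    using ae by eventually_elim (simp add: g_def convergent_LIMSEQ_iff)
  have fatou: "(\<integral>\<^sup>+x. ennreal ((cmod (g x - f n x))\<^sup>2) \<partial>lborel) \<le> ennreal (e\<^sup>2)"
    if e: "\<And>m. m \<ge> n \<Longrightarrow> norm (X (r m) - X (r n)) \<le> e" and "0 \<le> e" for n e
  proof -
    have "(\<integral>\<^sup>+x. ennreal ((cmod (g x - f n x))\<^sup>2) \<partial>lborel)
        = (\<integral>\<^sup>+x. liminf (\<lambda>m. ennreal ((cmod (f m x - f n x))\<^sup>2)) \<partial>lborel)"
    proof (rule nn_integral_cong_AE, use lim in eventually_elim)
      case (elim x)
      have "(\<lambda>m. ennreal ((cmod (f m x - f n x))\<^sup>2)) \<longlonglongrightarrow> ennreal ((cmod (g x - f n x))\<^sup>2)"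
        by (intro tendsto_intros elim)
      then show ?case by (metis lim_imp_Liminf trivial_limit_sequentially)
    qed
    also have "\<dots> \<le> liminf (\<lambda>m. \<integral>\<^sup>+x. ennreal ((cmod (f m x - f n x))\<^sup>2) \<partial>lborel)"
      by (rule nn_integral_liminf) auto
    also have "\<dots> \<le> ennreal (e\<^sup>2)"
    proof (rule Liminf_le)
      have "(\<integral>\<^sup>+x. ennreal ((cmod (f m x - f n x))\<^sup>2) \<partial>lborel) \<le> ennreal (e\<^sup>2)" if "m \<ge> n" for m
        using e[OF that] \<open>0 \<le> e\<close> nn_integral_L2[OF L2_diff[OF f[of m] f[of n]]]
        by (simp add: f cf power_mono ennreal_leI flip: cls_diff)
      then show "\<forall>\<^sub>F m in sequentially. (\<integral>\<^sup>+x. ennreal ((cmod (f m x - f n x))\<^sup>2) \<partial>lborel) \<le> ennreal (e\<^sup>2)"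
        by (auto simp: eventually_sequentially)
    qed simp
    finally show ?thesis .
  qed
  have CX: "Cauchy (\<lambda>n. X (r n))"
    using Cauchy_subseq_Cauchy[OF X r(1)] by (simp add: comp_def)
  have gL2: "g \<in> L2"
  proof -
    obtain n where n: "\<And>m. m \<ge> n \<Longrightarrow> norm (X (r m) - X (r n)) < 1"
      using CX unfolding Cauchy_def dist_norm by (metis zero_less_one order_refl)
    have "(\<integral>\<^sup>+x. ennreal ((cmod (g x - f n x))\<^sup>2) \<partial>lborel) < \<infinity>"
      using fatou[of n 1] n by (auto simp: less_imp_le intro: le_less_trans)
    then have "integrable lborel (\<lambda>x. (cmod (g x - f n x))\<^sup>2)"
      by (intro integrableI_bounded) auto
    then have "(\<lambda>x. g x - f n x) \<in> L2" by (simp add: L2_def)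
    from L2_add[OF this f[of n]] show ?thesis by simp
  qed
  have "(\<lambda>n. X (r n)) \<longlonglongrightarrow> cls g"
  proof (rule metric_LIMSEQ_I)
    fix e :: real assume "e > 0"
    then obtain N where N: "\<And>m n. m \<ge> N \<Longrightarrow> n \<ge> N \<Longrightarrow> norm (X (r m) - X (r n)) < e / 2"
      using CX unfolding Cauchy_def dist_norm by (metis half_gt_zero)
    have "dist (X (r n)) (cls g) < e" if "n \<ge> N" for n
    proof -
      have "(\<integral>\<^sup>+x. ennreal ((cmod (g x - f n x))\<^sup>2) \<partial>lborel) \<le> ennreal ((e/2)\<^sup>2)"
        using N that \<open>e > 0\<close> by (intro fatou) (auto intro: less_imp_le)
      then have "(norm (cls g - X (r n)))\<^sup>2 \<le> (e/2)\<^sup>2"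
        using nn_integral_L2[OF L2_diff[OF gL2 f[of n]]] \<open>e > 0\<close>
        by (simp add: gL2 f cf ennreal_le_iff flip: cls_diff)
      then have "norm (cls g - X (r n)) \<le> e / 2" using \<open>e > 0\<close> by (simp add: abs_le_square_iff[symmetric])
      then show ?thesis using \<open>e > 0\<close> by (simp add: dist_norm norm_minus_commute)
    qed
    then show "\<exists>N. \<forall>n\<ge>N. dist (X (r n)) (cls g) < e" by blast
  qed
  then have "X \<longlonglongrightarrow> cls g"
    using Cauchy_converges_subseq[OF X r(1)] by (simp add: comp_def)
  then show "convergent X" by (auto simp: convergent_def)
qed

section \<open>Bounded and compact operators\<close>

text \<open>Meaningful only for \<open>bop T\<close>: otherwise \<open>Blinfun\<close> is applied to a map that need not be bounded linear.\<close>

definition hat :: "op \<Rightarrow> l2 \<Rightarrow>\<^sub>L l2" where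
  "hat T = Blinfun (\<lambda>x. cls (T (rep x)))"

lemma bop_L2: "bop T \<Longrightarrow> f \<in> L2 \<Longrightarrow> T f \<in> L2"
  unfolding bop_def by blast

lemma bop_cls_cong: "bop T \<Longrightarrow> f \<in> L2 \<Longrightarrow> g \<in> L2 \<Longrightarrow> cls f = cls g \<Longrightarrow> cls (T f) = cls (T g)"
  unfolding bop_def by (metis cls_eq_iff)

lemma bop_cls_rep: "bop T \<Longrightarrow> f \<in> L2 \<Longrightarrow> cls (T (rep (cls f))) = cls (T f)"
  by (rule bop_cls_cong) (auto simp: rep_L2)

lemma bop_linear:
  assumes "bop T" shows "cls (T (rep (c *\<^sub>C x + y))) = c *\<^sub>C cls (T (rep x)) + cls (T (rep y))"
proof -
  define f g where "f = rep x" and "g = rep y"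
  have fg: "f \<in> L2" "g \<in> L2" "x = cls f" "y = cls g" by (auto simp: f_def g_def rep_L2)
  have "ae_eq (T (\<lambda>x. c * f x + g x)) (\<lambda>x. c * T f x + T g x)"
    using assms fg(1,2) unfolding bop_def by blast
  then have "cls (T (\<lambda>x. c * f x + g x)) = cls (\<lambda>x. c * T f x + T g x)"
    by (subst cls_eq_iff) (auto intro!: L2_add L2_scale bop_L2[OF assms] fg)
  then show ?thesis
    by (simp add: fg cls_cscale cls_add L2_scale L2_add bop_L2[OF assms] bop_cls_rep[OF assms])
qed

lemma blinfun_hat:
  assumes "bop T" shows "blinfun_apply (hat T) = (\<lambda>x. cls (T (rep x)))"
  unfolding hat_def
proof (rule bounded_linear_Blinfun_apply)
  obtain C where C: "\<And>f. f \<in> L2 \<Longrightarrow> l2norm (T f) \<le> C * l2norm f"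
    using assms unfolding bop_def by blast
  have add: "cls (T (rep (x + y))) = cls (T (rep x)) + cls (T (rep y))" for x y
    using bop_linear[OF assms, of 1 x y] by simp
  have z: "cls (T (rep 0)) = 0" using add[of 0 0] by simp
  show "bounded_linear (\<lambda>x. cls (T (rep x)))"
  proof (rule bounded_linear_intro[of _ C])
    show "cls (T (rep (r *\<^sub>R x))) = r *\<^sub>R cls (T (rep x))" for r x
      using bop_linear[OF assms, of "of_real r" x 0] z by (simp add: scaleR_cscale)
    show "norm (cls (T (rep x))) \<le> norm x * C" for x
      using C[OF rep_L2, of x] norm_cls[OF bop_L2[OF assms rep_L2], of x] norm_cls[OF rep_L2, of x]
      by (simp add: mult.commute)
  qed (rule add)
qed

lemma hat_cls: "bop T \<Longrightarrow> f \<in> L2 \<Longrightarrow> hat T (cls f) = cls (T f)"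
  by (simp add: blinfun_hat bop_cls_rep)

lemma norm_hat_le:
  assumes "bop T" "0 \<le> C" "\<And>f. f \<in> L2 \<Longrightarrow> l2norm (T f) \<le> C * l2norm f"
  shows "norm (hat T) \<le> C"
proof (rule norm_blinfun_bound[OF assms(2)])
  fix x
  show "norm (hat T x) \<le> C * norm x"
    using assms(3)[OF rep_L2, of x] norm_cls[OF bop_L2[OF assms(1) rep_L2], of x] norm_cls[OF rep_L2, of x]
    by (simp add: blinfun_hat assms(1))
qed

section \<open>Complex linear operators and adjoints\<close>

definition clinear_op :: "(l2 \<Rightarrow>\<^sub>L l2) \<Rightarrow> bool" where
  "clinear_op A \<longleftrightarrow> (\<forall>c x. A (c *\<^sub>C x) = c *\<^sub>C A x)"

definition op_of :: "(l2 \<Rightarrow>\<^sub>L l2) \<Rightarrow> op" where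
  "op_of A = (\<lambda>f. rep (A (cls f)))"

lemma cls_op_of [simp]: "cls (op_of A f) = A (cls f)"
  by (simp add: op_of_def)

lemma op_of_L2: "op_of A f \<in> L2"
  by (simp add: op_of_def rep_L2)

lemma bop_op_of:
  assumes "clinear_op A" shows "bop (op_of A)"
  unfolding bop_def
proof (intro conjI ballI allI impI)
  fix f g c assume fg: "f \<in> L2" "g \<in> L2"
  show "ae_eq (op_of A f) (op_of A g)" if "ae_eq f g"
    using that fg by (simp add: op_of_L2 flip: cls_eq_iff)
  have "cls (op_of A (\<lambda>x. c * f x + g x)) = cls (\<lambda>x. c * op_of A f x + op_of A g x)"
    using assms fg unfolding clinear_op_def
    by (simp add: op_of_L2 L2_add L2_scale blinfun.add_right flip: cls_add cls_cscale)
  then show "ae_eq (op_of A (\<lambda>x. c * f x + g x)) (\<lambda>x. c * op_of A f x + op_of A g x)"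
    by (subst (asm) cls_eq_iff) (auto intro!: L2_add L2_scale op_of_L2)
next
  show "\<exists>C. \<forall>f\<in>L2. l2norm (op_of A f) \<le> C * l2norm f"
    by (intro exI[of _ "norm A"] ballI) (simp add: op_of_L2 norm_blinfun flip: norm_cls)
qed (rule op_of_L2)

text \<open>A relation instead of a function: every adjoint that occurs is given explicitly, so the
  existence of adjoints never has to be derived from the Riesz representation theorem.\<close>

definition adjoint_pair :: "(l2 \<Rightarrow>\<^sub>L l2) \<Rightarrow> (l2 \<Rightarrow>\<^sub>L l2) \<Rightarrow> bool" where
  "adjoint_pair A B \<longleftrightarrow> (\<forall>x y. cinner (A x) y = cinner x (B y))"

lemma adjoint_pairD: "adjoint_pair A B \<Longrightarrow> cinner (A x) y = cinner x (B y)"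
  by (simp add: adjoint_pair_def)

lemma adjoint_pair_sym: "adjoint_pair A B \<Longrightarrow> adjoint_pair B A"
  unfolding adjoint_pair_def by (metis cinner_commute)

lemma adjoint_pair_add: "adjoint_pair A B \<Longrightarrow> adjoint_pair A' B' \<Longrightarrow> adjoint_pair (A + A') (B + B')"
  by (simp add: adjoint_pair_def blinfun.add_left cinner_add_left cinner_add_right)

lemma adjoint_pair_zero: "adjoint_pair 0 0"
  by (simp add: adjoint_pair_def)

lemma adjoint_pair_diff: "adjoint_pair A B \<Longrightarrow> adjoint_pair A' B' \<Longrightarrow> adjoint_pair (A - A') (B - B')"
  by (simp add: adjoint_pair_def blinfun.diff_left cinner_diff_left cinner_diff_right)

lemma adjoint_pair_scaleR: "adjoint_pair A B \<Longrightarrow> adjoint_pair (r *\<^sub>R A) (r *\<^sub>R B)"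
  by (simp add: adjoint_pair_def blinfun.scaleR_left scaleR_cscale cinner_scale_left cinner_scale_right)

lemma adjoint_pair_sum:
  "(\<And>i. i \<in> I \<Longrightarrow> adjoint_pair (A i) (B i)) \<Longrightarrow> adjoint_pair (sum A I) (sum B I)"
  by (induction I rule: infinite_finite_induct) (auto intro: adjoint_pair_zero adjoint_pair_add)

lemma adjoint_pair_compose:
  "adjoint_pair A B \<Longrightarrow> adjoint_pair A' B' \<Longrightarrow> adjoint_pair (A o\<^sub>L A') (B' o\<^sub>L B)"
  by (simp add: adjoint_pair_def)

text \<open>Complex linearity comes for free from an adjoint, by sesquilinearity of the inner
  product; it need not be carried through sums and limits.\<close>

lemma adjoint_pair_clinear: "adjoint_pair A B \<Longrightarrow> clinear_op A"
  unfolding clinear_op_def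
  by (intro allI cinner_ext) (simp add: adjoint_pairD cinner_scale_left)

lemma norm_blinfun_cinner_bound:
  fixes A :: "l2 \<Rightarrow>\<^sub>L l2"
  assumes "0 \<le> c" "\<And>x y. cmod (cinner (A x) y) \<le> c * norm x * norm y"
  shows "norm A \<le> c"
proof (rule norm_blinfun_bound[OF assms(1)])
  fix x
  have "norm (A x) * norm (A x) \<le> (c * norm x) * norm (A x)"
    using assms(2)[of x "A x"] by (simp add: cinner_self power2_eq_square norm_mult)
  then show "norm (A x) \<le> c * norm x"
    using assms(1) by (metis mult_right_le_imp_le norm_ge_zero order_le_less zero_le_mult_iff)
qed

lemma norm_adjoint_le: "adjoint_pair A B \<Longrightarrow> norm B \<le> norm A"
proof (rule norm_blinfun_cinner_bound)
  fix x y assume "adjoint_pair A B"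
  then have "cinner (B x) y = cinner x (A y)" by (metis adjoint_pair_sym adjoint_pairD)
  then have "cmod (cinner (B x) y) \<le> norm x * norm (A y)" by (simp add: norm_cinner_le)
  also have "\<dots> \<le> norm x * (norm A * norm y)" by (intro mult_left_mono norm_blinfun) auto
  finally show "cmod (cinner (B x) y) \<le> norm A * norm x * norm y" by (simp add: algebra_simps)
qed simp

lemma norm_adjoint: "adjoint_pair A B \<Longrightarrow> norm A = norm B"
  using norm_adjoint_le adjoint_pair_sym by (metis order_antisym)

section \<open>Compact operators\<close>

definition compact_bl :: "(l2 \<Rightarrow>\<^sub>L l2) \<Rightarrow> bool" where
  "compact_bl A \<longleftrightarrow> (\<forall>u. bounded (range u) \<longrightarrow>
     (\<exists>r::nat \<Rightarrow> nat. strict_mono r \<and> convergent (\<lambda>n. A (u (r n)))))"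

lemma compact_blE:
  assumes "compact_bl A" "bounded (range u)"
  obtains r :: "nat \<Rightarrow> nat" where "strict_mono r" "convergent (\<lambda>n. A (u (r n)))"
  using assms unfolding compact_bl_def by blast

lemma bounded_range_subseq: "bounded (range u) \<Longrightarrow> bounded (range (\<lambda>n. u (r n)))"
  by (rule bounded_subset) auto

lemma compact_bl_zero: "compact_bl 0"
  by (auto simp: compact_bl_def convergent_const intro: strict_mono_id)

lemma compact_bl_add:
  assumes "compact_bl A" "compact_bl B" shows "compact_bl (A + B)"
  unfolding compact_bl_def
proof (intro allI impI)
  fix u :: "nat \<Rightarrow> l2" assume u: "bounded (range u)"
  obtain r :: "nat \<Rightarrow> nat" where r: "strict_mono r" "convergent (\<lambda>n. A (u (r n)))"
    using compact_blE[OF assms(1) u] .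
  obtain s :: "nat \<Rightarrow> nat" where s: "strict_mono s" "convergent (\<lambda>n. B (u (r (s n))))"
    using compact_blE[OF assms(2) bounded_range_subseq[OF u, of r]] .
  have "convergent (\<lambda>n. A (u (r (s n))))"
    using convergent_subseq_convergent[OF r(2) s(1)] by (simp add: comp_def)
  from convergent_add[OF this s(2)]
  show "\<exists>r::nat \<Rightarrow> nat. strict_mono r \<and> convergent (\<lambda>n. (A + B) (u (r n)))"
    using strict_mono_o[OF r(1) s(1)] by (intro exI[of _ "r \<circ> s"]) (simp add: blinfun.add_left)
qed

lemma compact_bl_compose_left:
  assumes "compact_bl A" shows "compact_bl (B o\<^sub>L A)"
  unfolding compact_bl_def
proof (intro allI impI)
  fix u :: "nat \<Rightarrow> l2" assume u: "bounded (range u)"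
  obtain r :: "nat \<Rightarrow> nat" where r: "strict_mono r" "convergent (\<lambda>n. A (u (r n)))"
    using compact_blE[OF assms(1) u] .
  then obtain l where "(\<lambda>n. A (u (r n))) \<longlonglongrightarrow> l" by (auto simp: convergent_def)
  then have "(\<lambda>n. B (A (u (r n)))) \<longlonglongrightarrow> B l"
    by (rule bounded_linear.tendsto[OF blinfun.bounded_linear_right])
  then have "convergent (\<lambda>n. B (A (u (r n))))" by (auto simp: convergent_def)
  with r(1) show "\<exists>r::nat \<Rightarrow> nat. strict_mono r \<and> convergent (\<lambda>n. (B o\<^sub>L A) (u (r n)))" by auto
qed

lemma bounded_range_blinfun:
  assumes "bounded (range u)" shows "bounded (range (\<lambda>n. blinfun_apply B (u n)))"
  using bounded_linear_image[OF assms blinfun.bounded_linear_right[of B]] by (simp add: image_image)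

lemma compact_bl_compose_right:
  assumes "compact_bl A" shows "compact_bl (A o\<^sub>L B)"
  unfolding compact_bl_def
proof (intro allI impI)
  fix u :: "nat \<Rightarrow> l2" assume "bounded (range u)"
  from compact_blE[OF assms bounded_range_blinfun[OF this, of B]]
  show "\<exists>r::nat \<Rightarrow> nat. strict_mono r \<and> convergent (\<lambda>n. (A o\<^sub>L B) (u (r n)))" by auto
qed

lemma compact_bl_scaleR: "compact_bl A \<Longrightarrow> compact_bl (r *\<^sub>R A)"
proof -
  assume "compact_bl A"
  moreover have "r *\<^sub>R A = (r *\<^sub>R id_blinfun) o\<^sub>L A"
    by (rule blinfun_eqI) (simp add: blinfun.scaleR_left)
  ultimately show ?thesis by (simp add: compact_bl_compose_left)
qed

lemma compact_bl_diff: "compact_bl A \<Longrightarrow> compact_bl B \<Longrightarrow> compact_bl (A - B)"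
  using compact_bl_add[of A "-1 *\<^sub>R B"] compact_bl_scaleR[of B "-1"] by simp

lemma compact_bl_sum: "(\<And>i. i \<in> I \<Longrightarrow> compact_bl (A i)) \<Longrightarrow> compact_bl (sum A I)"
  by (induction I rule: infinite_finite_induct) (auto intro: compact_bl_zero compact_bl_add)

text \<open>A diagonal subsequence along which every \<open>A i\<close> converges, followed by an
  epsilon/3 argument with an \<open>A i\<close> close to \<open>L\<close>.\<close>

lemma compact_bl_limit:
  assumes A: "\<And>i. compact_bl (A i)" and lim: "A \<longlonglongrightarrow> L"
  shows "compact_bl L"
  unfolding compact_bl_def
proof (intro allI impI)
  fix u :: "nat \<Rightarrow> l2" assume u: "bounded (range u)"
  obtain k :: "nat \<Rightarrow> nat" where k: "strict_mono k" "\<And>i. convergent (\<lambda>n. A i (u ((id \<circ> k) n)))"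
  proof (rule subsequence_diagonalization_lemma[of "\<lambda>i s. convergent (\<lambda>n. A i (u (s n)))" id])
    fix i and r :: "nat \<Rightarrow> nat"
    show "\<exists>k::nat \<Rightarrow> nat. strict_mono k \<and> convergent (\<lambda>n. A i (u ((r \<circ> k) n)))"
      using A[of i] bounded_range_subseq[OF u, of r] unfolding compact_bl_def by fastforce
  next
    fix i N and r k1 k2 :: "nat \<Rightarrow> nat"
    \<comment> \<open>The diagonal sequence is only eventually a selection from the i-th one.
      Convergence survives because the selected indices \<open>j'\<close> are at least
      \<open>j\<close>.\<close>
    assume c: "convergent (\<lambda>n. A i (u ((r \<circ> k1) n)))" and sub: "\<And>j. N \<le> j \<Longrightarrow> \<exists>j'\<ge>j. k2 j = k1 j'"
    then obtain l where l: "(\<lambda>n. A i (u (r (k1 n)))) \<longlonglongrightarrow> l" by (auto simp: convergent_def)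
    have "(\<lambda>n. A i (u (r (k2 n)))) \<longlonglongrightarrow> l"
    proof (rule metric_LIMSEQ_I)
      fix e :: real assume "e > 0"
      from metric_LIMSEQ_D[OF l this] obtain M where M: "\<And>n. n \<ge> M \<Longrightarrow> dist (A i (u (r (k1 n)))) l < e" by blast
      have "dist (A i (u (r (k2 n)))) l < e" if "n \<ge> max M N" for n
        using sub[of n] that M by force
      then show "\<exists>no. \<forall>n\<ge>no. dist (A i (u (r (k2 n)))) l < e" by blast
    qed
    then show "convergent (\<lambda>n. A i (u ((r \<circ> k2) n)))" by (auto simp: convergent_def)
  qed auto
  obtain M where M: "\<And>n. norm (u n) \<le> M" "0 < M"
    using u unfolding bounded_pos by auto
  have "Cauchy (\<lambda>n. L (u (k n)))"
  proof (rule metric_CauchyI)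
    fix e :: real assume e: "e > 0"
    have "\<forall>\<^sub>F i in sequentially. dist (A i) L < e / (3 * M)"
      using lim e M(2) by (intro tendstoD) auto
    then obtain i where i: "norm (L - A i) < e / (3 * M)"
      by (auto simp: eventually_sequentially dist_norm norm_minus_commute)
    have near: "norm (L (u n) - A i (u n)) < e / 3" for n
    proof -
      have "norm (L (u n) - A i (u n)) \<le> norm (L - A i) * norm (u n)"
        unfolding blinfun.diff_left[symmetric] by (rule norm_blinfun)
      also have "\<dots> \<le> norm (L - A i) * M" by (intro mult_left_mono M) auto
      also have "\<dots> < e / (3 * M) * M" using i M(2) by (intro mult_strict_right_mono)
      finally show ?thesis using M(2) by simp
    qed
    have "Cauchy (\<lambda>n. A i (u (k n)))" using k(2)[of i] by (simp add: convergent_Cauchy)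
    then obtain N where N: "\<And>m n. m \<ge> N \<Longrightarrow> n \<ge> N \<Longrightarrow> dist (A i (u (k m))) (A i (u (k n))) < e / 3"
      using e unfolding Cauchy_def by (metis divide_pos_pos zero_less_numeral)
    have "dist (L (u (k m))) (L (u (k n))) < e" if "m \<ge> N" "n \<ge> N" for m n
    proof -
      have "dist (L (u (k m))) (L (u (k n))) \<le> dist (L (u (k m))) (A i (u (k m)))
          + (dist (A i (u (k m))) (A i (u (k n))) + dist (A i (u (k n))) (L (u (k n))))"
        by (meson add_left_mono dist_triangle order_trans)
      then show ?thesis
        using N[OF that] near[of "k m"] near[of "k n"]
        by (simp add: dist_norm norm_minus_commute)
    qed
    then show "\<exists>N. \<forall>m\<ge>N. \<forall>n\<ge>N. dist (L (u (k m))) (L (u (k n))) < e" by blast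
  qed
  then show "\<exists>r::nat \<Rightarrow> nat. strict_mono r \<and> convergent (\<lambda>n. L (u (r n)))"
    using k(1) by (auto simp: Cauchy_convergent_iff)
qed

text \<open>Schauder's theorem: the square of \<open>norm (B x)\<close> is at most
  \<open>norm (A (B x)) * norm x\<close>, so on a bounded sequence \<open>B\<close> is controlled by
  the compact operator \<open>A o\<^sub>L B\<close>.\<close>

lemma compact_bl_adjoint:
  assumes "compact_bl A" "adjoint_pair A B" shows "compact_bl B"
  unfolding compact_bl_def
proof (intro allI impI)
  fix u :: "nat \<Rightarrow> l2" assume u: "bounded (range u)"
  obtain M where M: "\<And>n. norm (u n) \<le> M" "0 < M"
    using u unfolding bounded_pos by auto
  obtain r :: "nat \<Rightarrow> nat" where r: "strict_mono r" "convergent (\<lambda>n. A (B (u (r n))))"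
    using compact_blE[OF assms(1) bounded_range_blinfun[OF u, of B]] by blast
  have key: "(dist (B x) (B y))\<^sup>2 \<le> dist (A (B x)) (A (B y)) * norm (x - y)" for x y
  proof -
    have "(norm (B (x - y)))\<^sup>2 = Re (cinner (A (B (x - y))) (x - y))"
      by (simp add: adjoint_pairD[OF assms(2)] cinner_self)
    also have "\<dots> \<le> norm (A (B (x - y))) * norm (x - y)"
      using norm_cinner_le complex_Re_le_cmod order_trans by blast
    finally show ?thesis by (simp add: dist_norm blinfun.diff_right)
  qed
  have "Cauchy (\<lambda>n. B (u (r n)))"
  proof (rule metric_CauchyI)
    fix e :: real assume e: "e > 0"
    have "Cauchy (\<lambda>n. A (B (u (r n))))" using r(2) by (simp add: convergent_Cauchy)
    then obtain N where N: "\<And>m n. m \<ge> N \<Longrightarrow> n \<ge> N \<Longrightarrow> dist (A (B (u (r m)))) (A (B (u (r n)))) < e\<^sup>2 / (2 * M)"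
      using e M(2) unfolding Cauchy_def by (metis divide_pos_pos zero_less_numeral zero_less_power mult_pos_pos)
    have "dist (B (u (r m))) (B (u (r n))) < e" if "m \<ge> N" "n \<ge> N" for m n
    proof -
      have "norm (u (r m) - u (r n)) \<le> 2 * M"
        using norm_triangle_ineq4[of "u (r m)" "u (r n)"] M(1)[of "r m"] M(1)[of "r n"] by linarith
      then have "(dist (B (u (r m))) (B (u (r n))))\<^sup>2 \<le> dist (A (B (u (r m)))) (A (B (u (r n)))) * (2 * M)"
        using key[of "u (r m)" "u (r n)"] by (meson mult_left_mono order_trans zero_le_dist)
      also have "\<dots> < e\<^sup>2 / (2 * M) * (2 * M)"
        using N[OF that] M(2) by (intro mult_strict_right_mono) auto
      finally have "(dist (B (u (r m))) (B (u (r n))))\<^sup>2 < e\<^sup>2" using M(2) by simp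
      then show ?thesis using e by (simp add: power_less_imp_less_base)
    qed
    then show "\<exists>N. \<forall>m\<ge>N. \<forall>n\<ge>N. dist (B (u (r m))) (B (u (r n))) < e" by blast
  qed
  then show "\<exists>r::nat \<Rightarrow> nat. strict_mono r \<and> convergent (\<lambda>n. B (u (r n)))"
    using r(1) by (auto simp: Cauchy_convergent_iff)
qed

lemma compact_op_op_of:
  assumes "clinear_op A" "compact_bl A" shows "compact_op (op_of A)"
  unfolding compact_op_def
proof (intro conjI bop_op_of assms allI impI, elim conjE exE)
  fix u :: "nat \<Rightarrow> fn" and M assume u: "\<forall>n. u n \<in> L2" "\<forall>n. l2norm (u n) \<le> M"
  have "bounded (range (\<lambda>n. cls (u n)))"
    using u by (auto simp: bounded_iff norm_cls intro!: exI[of _ M])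
  from compact_blE[OF assms(2) this] obtain r :: "nat \<Rightarrow> nat" and l
    where r: "strict_mono r" "(\<lambda>n. A (cls (u (r n)))) \<longlonglongrightarrow> l"
    unfolding convergent_def by metis
  have "(\<lambda>n. norm (cls (\<lambda>x. op_of A (u (r n)) x - rep l x))) \<longlonglongrightarrow> 0"
    using r(2) by (simp add: op_of_L2 rep_L2 LIM_zero_iff tendsto_norm_zero_iff flip: cls_diff)
  then show "\<exists>r g. strict_mono r \<and> g \<in> L2 \<and> (\<lambda>n. l2norm (\<lambda>x. op_of A (u (r n)) x - g x)) \<longlonglongrightarrow> 0"
    using r(1) by (intro exI[of _ r] exI[of _ "rep l"]) (simp add: rep_L2 norm_cls L2_diff op_of_L2)
qed

lemma compact_bl_hat:
  assumes "compact_op K" shows "compact_bl (hat K)"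
  unfolding compact_bl_def
proof (intro allI impI)
  have K: "bop K" using assms by (simp add: compact_op_def)
  fix u :: "nat \<Rightarrow> l2" assume "bounded (range u)"
  then obtain M where M: "\<And>n. norm (u n) \<le> M" by (auto simp: bounded_iff)
  have "\<forall>n. rep (u n) \<in> L2" "\<exists>B. \<forall>n. l2norm (rep (u n)) \<le> B"
    using M by (auto simp: rep_L2 simp flip: norm_cls)
  then obtain r :: "nat \<Rightarrow> nat" and g where r: "strict_mono r" "g \<in> L2"
    "(\<lambda>n. l2norm (\<lambda>x. K (rep (u (r n))) x - g x)) \<longlonglongrightarrow> 0"
    using assms unfolding compact_op_def by meson
  have "(\<lambda>n. norm (hat K (u (r n)) - cls g)) \<longlonglongrightarrow> 0"
    using r(2,3) by (simp add: blinfun_hat K cls_diff bop_L2 rep_L2 norm_cls L2_diff)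
  then have "(\<lambda>n. hat K (u (r n))) \<longlonglongrightarrow> cls g"
    by (simp add: LIM_zero_iff tendsto_norm_zero_iff)
  then show "\<exists>r::nat \<Rightarrow> nat. strict_mono r \<and> convergent (\<lambda>n. hat K (u (r n)))"
    using r(1) by (auto simp: convergent_def)
qed

section \<open>Multiplications, translations and convolutions\<close>

definition bm :: "fn \<Rightarrow> bool" where
  "bm \<phi> \<longleftrightarrow> \<phi> \<in> borel_measurable borel \<and> (\<exists>B. \<forall>x. cmod (\<phi> x) \<le> B)"

lemma bmI: "\<phi> \<in> borel_measurable borel \<Longrightarrow> (\<And>x. cmod (\<phi> x) \<le> B) \<Longrightarrow> bm \<phi>"
  by (auto simp: bm_def)

lemma bm_measurable [measurable_dest]: "bm \<phi> \<Longrightarrow> \<phi> \<in> borel_measurable borel"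
  by (simp add: bm_def)

lemma L2_bm_mult: "bm \<phi> \<Longrightarrow> f \<in> L2 \<Longrightarrow> (\<lambda>x. \<phi> x * f x) \<in> L2"
  unfolding bm_def using L2_bounded_mult by blast

lemma bm_mult: "bm \<phi> \<Longrightarrow> bm \<psi> \<Longrightarrow> bm (\<lambda>x. \<phi> x * \<psi> x)"
proof -
  assume "bm \<phi>" "bm \<psi>"
  then obtain B C where "\<And>x. cmod (\<phi> x) \<le> B" "\<And>x. cmod (\<psi> x) \<le> C"
    and [measurable]: "\<phi> \<in> borel_measurable borel" "\<psi> \<in> borel_measurable borel"
    by (auto simp: bm_def)
  then show ?thesis
    by (intro bmI[of _ "B * C"])
      (auto simp: norm_mult intro!: mult_mono order_trans[OF norm_ge_zero])
qed

lemma bm_diff: "bm \<phi> \<Longrightarrow> bm \<psi> \<Longrightarrow> bm (\<lambda>x. \<phi> x - \<psi> x)"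
proof -
  assume "bm \<phi>" "bm \<psi>"
  then obtain B C where "\<And>x. cmod (\<phi> x) \<le> B" "\<And>x. cmod (\<psi> x) \<le> C"
    and [measurable]: "\<phi> \<in> borel_measurable borel" "\<psi> \<in> borel_measurable borel"
    by (auto simp: bm_def)
  then show ?thesis
    by (intro bmI[of _ "B + C"]) (auto intro!: order_trans[OF norm_triangle_ineq4] add_mono)
qed

lemma bm_cnj: "bm \<phi> \<Longrightarrow> bm (\<lambda>x. cnj (\<phi> x))"
  by (auto simp: bm_def)

lemma bm_scale: "bm \<phi> \<Longrightarrow> bm (\<lambda>x. c * \<phi> x)"
  by (rule bm_mult[OF bmI[of _ "cmod c"]]) auto

lemma bm_shift: "bm \<phi> \<Longrightarrow> bm (\<lambda>x. \<phi> (x - t))"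
  by (auto simp: bm_def)

lemma bm_indicator: "A \<in> sets borel \<Longrightarrow> bm (indicator A)"
  by (intro bmI[of _ 1]) (auto simp: indicator_def)

lemma norm_cls_mult_le:
  assumes "bm \<phi>" "f \<in> L2" "\<And>x. cmod (\<phi> x) \<le> B"
  shows "l2norm (\<lambda>x. \<phi> x * f x) \<le> B * l2norm f"
proof -
  have B: "0 \<le> B" using assms(3)[of 0] norm_ge_zero order_trans by blast
  have "(LINT x|lborel. (cmod (\<phi> x * f x))\<^sup>2) \<le> (LINT x|lborel. B\<^sup>2 * (cmod (f x))\<^sup>2)"
    using assms B by (intro integral_mono L2_integrable_square L2_bm_mult integrable_mult_right)
      (auto simp: norm_mult power_mult_distrib intro!: mult_right_mono power_mono)
  also have "\<dots> = B\<^sup>2 * (LINT x|lborel. (cmod (f x))\<^sup>2)" by simp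
  finally have "l2norm (\<lambda>x. \<phi> x * f x) \<le> sqrt (B\<^sup>2 * (LINT x|lborel. (cmod (f x))\<^sup>2))"
    unfolding l2norm_def by (rule real_sqrt_le_mono)
  then show ?thesis using B by (simp add: l2norm_def real_sqrt_mult)
qed

lemma bop_mult: "bm \<phi> \<Longrightarrow> bop (\<lambda>f x. \<phi> x * f x)"
  unfolding bop_def
proof (intro conjI ballI allI impI)
  assume \<phi>: "bm \<phi>"
  show "\<exists>C. \<forall>f\<in>L2. l2norm (\<lambda>x. \<phi> x * f x) \<le> C * l2norm f"
    using \<phi> norm_cls_mult_le unfolding bm_def by blast
qed (auto simp: ae_eq_def distrib_left mult.left_commute intro: L2_bm_mult)

definition bmult :: "fn \<Rightarrow> l2 \<Rightarrow>\<^sub>L l2" where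
  "bmult \<phi> = hat (\<lambda>f x. \<phi> x * f x)"

lemma bmult_cls: "bm \<phi> \<Longrightarrow> f \<in> L2 \<Longrightarrow> bmult \<phi> (cls f) = cls (\<lambda>x. \<phi> x * f x)"
  unfolding bmult_def by (simp add: hat_cls bop_mult)

lemma norm_bmult_le:
  assumes "bm \<phi>" "\<And>x. cmod (\<phi> x) \<le> B" shows "norm (bmult \<phi>) \<le> B"
  unfolding bmult_def
proof (rule norm_hat_le)
  show "0 \<le> B" using assms(2)[of 0] norm_ge_zero order_trans by blast
qed (use assms in \<open>auto intro: bop_mult norm_cls_mult_le\<close>)

lemma blinfun_eq_cls:
  assumes "\<And>f. f \<in> L2 \<Longrightarrow> blinfun_apply A (cls f) = blinfun_apply B (cls f)" shows "A = B"
  by (rule blinfun_eqI) (metis assms l2_cases)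

lemma bmult_compose:
  assumes "bm \<phi>" "bm \<psi>" shows "bmult \<phi> o\<^sub>L bmult \<psi> = bmult (\<lambda>x. \<phi> x * \<psi> x)"
  using assms by (intro blinfun_eq_cls) (simp add: bmult_cls bm_mult L2_bm_mult mult.assoc)

lemma bmult_diff:
  assumes "bm \<phi>" "bm \<psi>" shows "bmult (\<lambda>x. \<phi> x - \<psi> x) = bmult \<phi> - bmult \<psi>"
  using assms by (intro blinfun_eq_cls) (simp add: bmult_cls bm_diff L2_bm_mult blinfun.diff_left cls_diff left_diff_distrib)

lemma bmult_adjoint: "bm \<phi> \<Longrightarrow> adjoint_pair (bmult \<phi>) (bmult (\<lambda>x. cnj (\<phi> x)))"
  unfolding adjoint_pair_def
proof (intro allI)
  fix x y assume \<phi>: "bm \<phi>"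
  obtain f g where fg: "f \<in> L2" "x = cls f" "g \<in> L2" "y = cls g" by (metis l2_cases)
  show "cinner (bmult \<phi> x) y = cinner x (bmult (\<lambda>x. cnj (\<phi> x)) y)"
    using \<phi> fg by (simp add: bmult_cls bm_cnj cinner_cls L2_bm_mult)
      (simp add: l2inner_def mult.commute mult.left_commute)
qed

text \<open>Dominated convergence. It serves twice: for cut-offs tending strongly to the identity,
  and in the compactness proof for \<open>Mr b o\<^sub>L Gr a\<close>, where the symbols vary and
  the vector is the fixed function \<open>mphi b\<close>.\<close>

lemma bmult_tendsto:
  assumes \<phi>: "\<And>n. bm (\<phi> n)" "bm \<psi>" and B: "\<And>n x. cmod (\<phi> n x) \<le> B"
    and lim: "\<And>x. (\<lambda>n. \<phi> n x) \<longlonglongrightarrow> \<psi> x"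
  shows "(\<lambda>n. bmult (\<phi> n) v) \<longlonglongrightarrow> bmult \<psi> v"
proof -
  obtain f where f: "f \<in> L2" "v = cls f" by (rule l2_cases)
  have \<psi>B: "cmod (\<psi> x) \<le> B" for x
    using Lim_bounded[OF tendsto_norm[OF lim[of x]]] B by blast
  note [measurable] = L2_measurable[OF f(1)] \<phi>[THEN bm_measurable]
  have "(\<lambda>n. LINT x|lborel. (cmod ((\<phi> n x - \<psi> x) * f x))\<^sup>2) \<longlonglongrightarrow> (LINT (x::real)|lborel. 0)"
  proof (rule integral_dominated_convergence[where w = "\<lambda>x. (2 * B)\<^sup>2 * (cmod (f x))\<^sup>2"])
    show "integrable lborel (\<lambda>x. (2 * B)\<^sup>2 * (cmod (f x))\<^sup>2)"
      using f by (intro integrable_mult_right L2_integrable_square)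
    show "AE x in lborel. (\<lambda>n. (cmod ((\<phi> n x - \<psi> x) * f x))\<^sup>2) \<longlonglongrightarrow> 0"
    proof (rule AE_I2)
      fix x
      have "(\<lambda>n. (cmod ((\<phi> n x - \<psi> x) * f x))\<^sup>2) \<longlonglongrightarrow> (cmod ((\<psi> x - \<psi> x) * f x))\<^sup>2"
        by (intro tendsto_intros lim)
      then show "(\<lambda>n. (cmod ((\<phi> n x - \<psi> x) * f x))\<^sup>2) \<longlonglongrightarrow> 0" by simp
    qed
    show "AE x in lborel. norm ((cmod ((\<phi> n x - \<psi> x) * f x))\<^sup>2) \<le> (2 * B)\<^sup>2 * (cmod (f x))\<^sup>2" for n
    proof (rule AE_I2)
      fix x
      have "cmod (\<phi> n x - \<psi> x) \<le> 2 * B"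
        using norm_triangle_ineq4[of "\<phi> n x" "\<psi> x"] B[of n x] \<psi>B[of x] by linarith
      then have "(cmod (\<phi> n x - \<psi> x))\<^sup>2 * (cmod (f x))\<^sup>2 \<le> (2 * B)\<^sup>2 * (cmod (f x))\<^sup>2"
        by (intro mult_right_mono power_mono) auto
      then show "norm ((cmod ((\<phi> n x - \<psi> x) * f x))\<^sup>2) \<le> (2 * B)\<^sup>2 * (cmod (f x))\<^sup>2"
        by (simp add: norm_mult power_mult_distrib[of "cmod _"])
    qed
  qed auto
  moreover have "(LINT x|lborel. (cmod ((\<phi> n x - \<psi> x) * f x))\<^sup>2) = (norm (bmult (\<phi> n) v - bmult \<psi> v))\<^sup>2" for n
    using \<phi> f L2_bm_mult[OF bm_diff[OF \<phi>(1)[of n] \<phi>(2)] f(1)]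
    by (simp add: bmult_cls L2_bm_mult cls_diff norm_cls_square flip: left_diff_distrib)
  ultimately have "(\<lambda>n. (norm (bmult (\<phi> n) v - bmult \<psi> v))\<^sup>2) \<longlonglongrightarrow> 0" by simp
  then have "(\<lambda>n. norm (bmult (\<phi> n) v - bmult \<psi> v)) \<longlonglongrightarrow> 0"
    using tendsto_real_sqrt by fastforce
  then show ?thesis by (simp add: LIM_zero_iff tendsto_norm_zero_iff)
qed

lemma integral_shift:
  fixes f :: "real \<Rightarrow> 'a::{banach, second_countable_topology}"
  shows "(LINT x|lborel. f (x - t)) = (LINT x|lborel. f x)"
  using lborel_integral_real_affine[of 1 f "- t"] by simp

lemma bop_Dop: "bop (Dop t)"
  unfolding bop_def Dop_def
proof (intro conjI ballI allI impI)
  fix f g :: fn assume [measurable]: "f \<in> L2" "g \<in> L2" and "ae_eq f g"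
  then have "AE x in lborel. f (- t + 1 * x) = g (- t + 1 * x)"
    unfolding ae_eq_def by (intro AE_borel_affine) auto
  then show "ae_eq (\<lambda>x. f (x - t)) (\<lambda>x. g (x - t))"
    by (simp add: ae_eq_def)
next
  show "\<exists>C. \<forall>f\<in>L2. l2norm (\<lambda>x. f (x - t)) \<le> C * l2norm f"
  proof (intro exI[of _ 1] ballI)
    fix f :: fn
    show "l2norm (\<lambda>x. f (x - t)) \<le> 1 * l2norm f"
      by (simp add: l2norm_def integral_shift[of "\<lambda>x. (cmod (f x))\<^sup>2"])
  qed
qed (auto simp: ae_eq_def intro: L2_shift)

definition transl :: "real \<Rightarrow> l2 \<Rightarrow>\<^sub>L l2" where "transl t = hat (Dop t)"

lemma transl_cls: "f \<in> L2 \<Longrightarrow> transl t (cls f) = cls (\<lambda>x. f (x - t))"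
  unfolding transl_def by (simp add: hat_cls bop_Dop) (simp add: Dop_def)

lemma norm_transl [simp]: "norm (transl t x) = norm x"
proof -
  obtain f where f: "f \<in> L2" "x = cls f" by (rule l2_cases)
  then show ?thesis
    by (simp add: transl_cls norm_cls L2_shift l2norm_def integral_shift[of "\<lambda>x. (cmod (f x))\<^sup>2"])
qed

lemma transl_transl: "transl s (transl t x) = transl (s + t) x"
proof -
  obtain f where f: "f \<in> L2" "x = cls f" by (rule l2_cases)
  then show ?thesis by (simp add: transl_cls L2_shift diff_diff_eq)
qed

lemma transl_zero [simp]: "transl 0 x = x"
proof -
  obtain f where f: "f \<in> L2" "x = cls f" by (rule l2_cases)
  then show ?thesis by (simp add: transl_cls)
qed

lemma transl_adjoint: "adjoint_pair (transl t) (transl (- t))"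
  unfolding adjoint_pair_def
proof (intro allI)
  fix x y
  obtain f g where fg: "f \<in> L2" "x = cls f" "g \<in> L2" "y = cls g" by (metis l2_cases)
  have "l2inner (\<lambda>x. f (x - t)) g = l2inner f (\<lambda>x. g (x + t))"
    unfolding l2inner_def using integral_shift[of "\<lambda>x. cnj (f x) * g (x + t)" t] by simp
  then show "cinner (transl t x) y = cinner x (transl (- t) y)"
    using fg L2_shift[of g "-t"] by (simp add: transl_cls cinner_cls L2_shift)
qed

lemma transl_bmult: "bm \<phi> \<Longrightarrow> transl t (bmult \<phi> x) = bmult (\<lambda>x. \<phi> (x - t)) (transl t x)"
proof -
  assume "bm \<phi>"
  moreover obtain f where f: "f \<in> L2" "x = cls f" by (rule l2_cases)
  ultimately show ?thesis by (simp add: transl_cls L2_shift bmult_cls bm_shift L2_bm_mult)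
qed

section \<open>Convolution operators\<close>

definition conv :: "(real \<Rightarrow> real) \<Rightarrow> op" where
  "conv k = (\<lambda>f x. LINT t|lborel. complex_of_real (k t) * f (x - t))"

definition kern :: "(real \<Rightarrow> real) \<Rightarrow> bool" where
  "kern k \<longleftrightarrow> k \<in> borel_measurable borel \<and> integrable lborel k \<and> (\<forall>t. 0 \<le> k t)"

lemma kern_measurable [measurable_dest]: "kern k \<Longrightarrow> k \<in> borel_measurable borel"
  by (simp add: kern_def)

lemma norm_cls_shift: "f \<in> L2 \<Longrightarrow> norm (cls (\<lambda>x. f (x - t))) = norm (cls f)"
  by (metis norm_transl transl_cls)

text \<open>Young's inequality: write \<open>k\<close> as the product of its square root with
  itself, apply Cauchy-Schwarz, then Tonelli. It is stated for nonnegative integrals because the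
  finiteness of the inner integral for almost every \<open>x\<close> is a consequence of it.\<close>

lemma nn_conv_bound:
  assumes k: "kern k" and f: "f \<in> L2"
  shows "(\<integral>\<^sup>+x. (\<integral>\<^sup>+t. ennreal (k t * cmod (f (x - t))) \<partial>lborel)\<^sup>2 \<partial>lborel)
    \<le> ennreal (((LINT t|lborel. k t) * norm (cls f))\<^sup>2)"
proof -
  define K where "K = (LINT t|lborel. k t)"
  have k0: "0 \<le> k t" for t using k by (simp add: kern_def)
  note [measurable] = kern_measurable[OF k] L2_measurable[OF f]
  have K: "(\<integral>\<^sup>+t. ennreal (k t) \<partial>lborel) = ennreal K" "0 \<le> K"
    using k by (auto simp: K_def kern_def nn_integral_eq_integral)
  have "(\<integral>\<^sup>+t. ennreal (k t * cmod (f (x - t))) \<partial>lborel)\<^sup>2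
      \<le> ennreal K * (\<integral>\<^sup>+t. ennreal (k t * (cmod (f (x - t)))\<^sup>2) \<partial>lborel)" for x
  proof -
    have "(\<integral>\<^sup>+t. ennreal (k t * cmod (f (x - t))) \<partial>lborel)\<^sup>2
       = (\<integral>\<^sup>+t. ennreal (sqrt (k t)) * ennreal (sqrt (k t) * cmod (f (x - t))) \<partial>lborel)\<^sup>2"
      using k0 by (simp flip: ennreal_mult mult.assoc)
    also have "\<dots> \<le> (\<integral>\<^sup>+t. (ennreal (sqrt (k t)))\<^sup>2 \<partial>lborel) * (\<integral>\<^sup>+t. (ennreal (sqrt (k t) * cmod (f (x - t))))\<^sup>2 \<partial>lborel)"
      by (rule Cauchy_Schwarz_nn_integral) auto
    also have "\<dots> = ennreal K * (\<integral>\<^sup>+t. ennreal (k t * (cmod (f (x - t)))\<^sup>2) \<partial>lborel)"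
      using k0 by (simp add: ennreal_power power_mult_distrib K)
    finally show ?thesis .
  qed
  then have "(\<integral>\<^sup>+x. (\<integral>\<^sup>+t. ennreal (k t * cmod (f (x - t))) \<partial>lborel)\<^sup>2 \<partial>lborel)
     \<le> (\<integral>\<^sup>+x. ennreal K * (\<integral>\<^sup>+t. ennreal (k t * (cmod (f (x - t)))\<^sup>2) \<partial>lborel) \<partial>lborel)"
    by (intro nn_integral_mono) auto
  also have "\<dots> = ennreal K * (\<integral>\<^sup>+x. (\<integral>\<^sup>+t. ennreal (k t * (cmod (f (x - t)))\<^sup>2) \<partial>lborel) \<partial>lborel)"
    by (rule nn_integral_cmult) auto
  also have "(\<integral>\<^sup>+x. (\<integral>\<^sup>+t. ennreal (k t * (cmod (f (x - t)))\<^sup>2) \<partial>lborel) \<partial>lborel)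
      = (\<integral>\<^sup>+t. (\<integral>\<^sup>+x. ennreal (k t * (cmod (f (x - t)))\<^sup>2) \<partial>lborel) \<partial>lborel)"
    by (rule lborel_pair.Fubini'[symmetric]) auto
  also have "\<dots> = (\<integral>\<^sup>+t. ennreal (k t) * ennreal ((norm (cls f))\<^sup>2) \<partial>lborel)"
  proof (rule nn_integral_cong)
    fix t
    have "(\<integral>\<^sup>+x. ennreal (k t * (cmod (f (x - t)))\<^sup>2) \<partial>lborel)
        = ennreal (k t) * (\<integral>\<^sup>+x. ennreal ((cmod (f (x - t)))\<^sup>2) \<partial>lborel)"
      using k0 by (subst nn_integral_cmult[symmetric]) (auto simp: ennreal_mult)
    then show "(\<integral>\<^sup>+x. ennreal (k t * (cmod (f (x - t)))\<^sup>2) \<partial>lborel) = ennreal (k t) * ennreal ((norm (cls f))\<^sup>2)"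
      using f by (simp add: nn_integral_L2 L2_shift norm_cls_shift)
  qed
  also have "\<dots> = ennreal K * ennreal ((norm (cls f))\<^sup>2)"
    by (subst nn_integral_multc) (auto simp: K)
  also have "ennreal K * (ennreal K * ennreal ((norm (cls f))\<^sup>2)) = ennreal ((K * norm (cls f))\<^sup>2)"
    using K by (simp add: power2_eq_square ennreal_mult ac_simps)
  finally show ?thesis by (simp add: K_def)
qed

text \<open>True without integrability, since the integral then has the default value 0. This lets
  \<open>conv k f x\<close> be bounded at every \<open>x\<close>, including the exceptional null
  set.\<close>

lemma norm_integral_le_nn:
  fixes g :: "'a \<Rightarrow> complex"
  assumes [measurable]: "g \<in> borel_measurable M"
  shows "ennreal (cmod (integral\<^sup>L M g)) \<le> (\<integral>\<^sup>+x. ennreal (cmod (g x)) \<partial>M)"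
  by (cases "integrable M g") (auto simp: integral_norm_bound_ennreal not_integrable_integral_eq)

lemma conv_bound:
  assumes k: "kern k" and f: "f \<in> L2"
  shows "conv k f \<in> L2" "l2norm (conv k f) \<le> (LINT t|lborel. k t) * l2norm f"
    and "AE x in lborel. integrable lborel (\<lambda>t. complex_of_real (k t) * f (x - t))"
proof -
  define K where "K = (LINT t|lborel. k t)"
  have k0: "0 \<le> k t" for t using k by (simp add: kern_def)
  have K0: "0 \<le> K" unfolding K_def using k0 by simp
  note [measurable] = kern_measurable[OF k] L2_measurable[OF f]
  define J where "J x = (\<integral>\<^sup>+t. ennreal (k t * cmod (f (x - t))) \<partial>lborel)" for x
  have J: "(\<integral>\<^sup>+x. (J x)\<^sup>2 \<partial>lborel) \<le> ennreal ((K * norm (cls f))\<^sup>2)"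
    unfolding J_def K_def by (rule nn_conv_bound[OF k f])
  have [measurable]: "J \<in> borel_measurable borel" unfolding J_def by measurable
  have meas [measurable]: "conv k f \<in> borel_measurable borel" unfolding conv_def by measurable
  have "ennreal (cmod (conv k f x)) \<le> J x" for x
    unfolding conv_def J_def using k0
    by (intro order_trans[OF norm_integral_le_nn]) (auto simp: norm_mult)
  then have "(\<integral>\<^sup>+x. ennreal ((cmod (conv k f x))\<^sup>2) \<partial>lborel) \<le> (\<integral>\<^sup>+x. (J x)\<^sup>2 \<partial>lborel)"
    by (intro nn_integral_mono) (auto simp: ennreal_power[symmetric] intro!: power_mono)
  also note J
  finally have le: "(\<integral>\<^sup>+x. ennreal ((cmod (conv k f x))\<^sup>2) \<partial>lborel) \<le> ennreal ((K * norm (cls f))\<^sup>2)" .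
  then have "integrable lborel (\<lambda>x. (cmod (conv k f x))\<^sup>2)"
    by (intro integrableI_bounded) (auto simp: le_less_trans)
  then show L: "conv k f \<in> L2" by (simp add: L2_def meas)
  have "(norm (cls (conv k f)))\<^sup>2 \<le> (K * norm (cls f))\<^sup>2"
    using le nn_integral_L2[OF L] by (simp add: ennreal_le_iff)
  then have "norm (cls (conv k f)) \<le> K * norm (cls f)"
    by (rule power2_le_imp_le) (simp add: K0)
  then show "l2norm (conv k f) \<le> (LINT t|lborel. k t) * l2norm f"
    using L f by (simp add: norm_cls K_def)
  have "AE x in lborel. (J x)\<^sup>2 \<noteq> \<infinity>"
    using J by (intro nn_integral_PInf_AE) (auto simp: top_unique)
  then show "AE x in lborel. integrable lborel (\<lambda>t. complex_of_real (k t) * f (x - t))"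
  proof eventually_elim
    case (elim x)
    then have "J x < \<infinity>" by (auto simp: power2_eq_square less_top ennreal_mult_eq_top_iff)
    then show ?case using k0
      by (intro integrableI_bounded) (auto simp: norm_mult J_def)
  qed
qed

lemma bop_conv:
  assumes k: "kern k" shows "bop (conv k)"
  unfolding bop_def
proof (intro conjI ballI allI impI)
  fix f g :: fn assume f: "f \<in> L2" and g: "g \<in> L2"
  note [measurable] = kern_measurable[OF k] L2_measurable[OF f] L2_measurable[OF g]
  { assume "ae_eq f g"
    have "conv k f x = conv k g x" for x
      unfolding conv_def
    proof (rule integral_cong_AE)
      have "AE t in lborel. f (x + (-1) * t) = g (x + (-1) * t)"
        using \<open>ae_eq f g\<close> unfolding ae_eq_def by (intro AE_borel_affine) auto
      then show "AE t in lborel. complex_of_real (k t) * f (x - t) = complex_of_real (k t) * g (x - t)"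
        by eventually_elim simp
    qed auto
    then show "ae_eq (conv k f) (conv k g)" by (simp add: ae_eq_def) }
  fix c
  show "ae_eq (conv k (\<lambda>x. c * f x + g x)) (\<lambda>x. c * conv k f x + conv k g x)"
    unfolding ae_eq_def using conv_bound(3)[OF k f] conv_bound(3)[OF k g]
  proof eventually_elim
    case (elim x)
    have "(LINT t|lborel. complex_of_real (k t) * (c * f (x - t) + g (x - t)))
        = (LINT t|lborel. c * (complex_of_real (k t) * f (x - t)) + complex_of_real (k t) * g (x - t))"
      by (simp add: algebra_simps)
    also have "\<dots> = c * conv k f x + conv k g x"
      using elim by (subst Bochner_Integration.integral_add) (auto simp: conv_def)
    finally show ?case by (simp add: conv_def)
  qed
qed (use conv_bound[OF k] in blast)+

definition convl :: "(real \<Rightarrow> real) \<Rightarrow> l2 \<Rightarrow>\<^sub>L l2" where "convl k = hat (conv k)"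

lemma convl_cls: "kern k \<Longrightarrow> f \<in> L2 \<Longrightarrow> convl k (cls f) = cls (conv k f)"
  unfolding convl_def by (simp add: hat_cls bop_conv)

lemma norm_convl_le: "kern k \<Longrightarrow> norm (convl k) \<le> (LINT t|lborel. k t)"
  unfolding convl_def by (rule norm_hat_le) (auto simp: bop_conv conv_bound kern_def)

lemma cinner_transl_measurable [measurable]: "(\<lambda>t. cinner (transl t x) y) \<in> borel_measurable borel"
proof -
  obtain f g where fg: "f \<in> L2" "x = cls f" "g \<in> L2" "y = cls g" by (metis l2_cases)
  note [measurable] = L2_measurable[OF fg(1)] L2_measurable[OF fg(3)]
  have "(\<lambda>t. LINT u|lborel. cnj (f (u - t)) * g u) \<in> borel_measurable borel" by measurable
  then show ?thesis using fg by (simp add: transl_cls cinner_cls L2_shift l2inner_def)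
qed

lemma cinner_transl_le: "cmod (cinner (transl t x) y) \<le> norm x * norm y"
  using norm_cinner_le[of "transl t x" y] by simp

lemma kern_integrable_cinner:
  assumes "kern k" shows "integrable lborel (\<lambda>t. complex_of_real (k t) * cinner (transl t x) y)"
proof (rule Bochner_Integration.integrable_bound[of _ "\<lambda>t. k t * (norm x * norm y)"])
  show "integrable lborel (\<lambda>t. k t * (norm x * norm y))" using assms by (simp add: kern_def)
  show "AE t in lborel. norm (complex_of_real (k t) * cinner (transl t x) y) \<le> norm (k t * (norm x * norm y))"
    using assms by (intro AE_I2) (auto simp: kern_def norm_mult intro!: mult_left_mono cinner_transl_le)
qed (use assms in measurable)

text \<open>The operator as a weak integral of translations. Adjoints, products, commutators and
  membership in the parabolic algebra are all read off from this form.\<close>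

lemma cinner_convl:
  assumes k: "kern k"
  shows "cinner (convl k x) y = (LINT t|lborel. complex_of_real (k t) * cinner (transl t x) y)"
proof -
  obtain f g where fg: "f \<in> L2" "x = cls f" "g \<in> L2" "y = cls g" by (metis l2_cases)
  note [measurable] = L2_measurable[OF fg(1)] L2_measurable[OF fg(3)] kern_measurable[OF k]
  have k0: "0 \<le> k t" for t using k by (simp add: kern_def)
  let ?F = "\<lambda>t x. complex_of_real (k t) * (cnj (f (x - t)) * g x)"
  \<comment> \<open>For the absolute values, the matrix coefficient of a translation is the integral
    of the absolute value of the integrand, so the hypothesis of Fubini reduces to
    \<open>kern_integrable_cinner\<close>.\<close>
  define f' g' where "f' = (\<lambda>x. complex_of_real (cmod (f x)))" and "g' = (\<lambda>x. complex_of_real (cmod (g x)))"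
  have fg': "f' \<in> L2" "g' \<in> L2" using fg by (auto simp: f'_def g'_def L2_def)
  have sh: "integrable lborel (\<lambda>x. cnj (f (x - t)) * g x)" for t
    using L2_integrable_inner[OF L2_shift[OF fg(1)] fg(3)] .
  have int: "integrable (lborel \<Otimes>\<^sub>M lborel) (case_prod ?F)"
  proof (rule lborel_pair.Fubini_integrable)
    have eq: "(LINT x|lborel. norm (case_prod ?F (t, x))) = cmod (complex_of_real (k t) * cinner (transl t (cls f')) (cls g'))" for t
    proof -
      have "cinner (transl t (cls f')) (cls g') = l2inner (\<lambda>x. f' (x - t)) g'"
        using fg' by (simp add: transl_cls cinner_cls L2_shift)
      also have "\<dots> = complex_of_real (LINT x|lborel. cmod (f (x - t)) * cmod (g x))"
        by (simp add: l2inner_def f'_def g'_def flip: of_real_mult)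
      finally have "cinner (transl t (cls f')) (cls g') = complex_of_real (LINT x|lborel. cmod (f (x - t)) * cmod (g x))" .
      moreover have "0 \<le> (LINT x|lborel. cmod (f (x - t)) * cmod (g x))" by simp
      ultimately show ?thesis using k0 by (simp add: norm_mult)
    qed
    show "integrable lborel (\<lambda>t. LINT x|lborel. norm (case_prod ?F (t, x)))"
      unfolding eq by (intro integrable_norm kern_integrable_cinner k)
    show "AE t in lborel. integrable lborel (\<lambda>x. case_prod ?F (t, x))"
      using sh by (intro AE_I2) simp
  qed auto
  have "cinner (convl k x) y = (LINT x|lborel. (LINT t|lborel. ?F t x))"
  proof -
    have "cnj (conv k f x) * g x = (LINT t|lborel. ?F t x)" for x
      unfolding conv_def Bochner_Integration.integral_cnj[symmetric]
      by (subst integral_mult_left_zero[symmetric]) (simp add: mult.assoc)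
    then show ?thesis using fg k by (simp add: convl_cls conv_bound cinner_cls l2inner_def)
  qed
  also have "\<dots> = (LINT t|lborel. (LINT x|lborel. ?F t x))"
    by (rule lborel_pair.Fubini_integral[OF int])
  also have "\<dots> = (LINT t|lborel. complex_of_real (k t) * cinner (transl t x) y)"
    using fg by (simp add: transl_cls cinner_cls L2_shift l2inner_def)
  finally show ?thesis .
qed

lemma kern_reflect: "kern k \<Longrightarrow> kern (\<lambda>t. k (- t))"
  using lborel_integrable_real_affine[of k "-1" 0] by (auto simp: kern_def)

lemma convl_adjoint:
  assumes "kern k" shows "adjoint_pair (convl k) (convl (\<lambda>t. k (- t)))"
  unfolding adjoint_pair_def
proof (intro allI)
  fix x y
  have "cinner x (convl (\<lambda>t. k (- t)) y) = cnj (cinner (convl (\<lambda>t. k (- t)) y) x)"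
    by (rule cinner_commute)
  also have "\<dots> = (LINT t|lborel. complex_of_real (k (- t)) * cnj (cinner (transl t y) x))"
    by (simp add: cinner_convl kern_reflect assms flip: Bochner_Integration.integral_cnj)
  also have "\<dots> = (LINT t|lborel. complex_of_real (k (- t)) * cinner (transl (- t) x) y)"
    using cinner_commute[of x "transl _ y"] adjoint_pairD[OF transl_adjoint, of "- _" x y] by simp
  also have "\<dots> = (LINT t|lborel. complex_of_real (k t) * cinner (transl t x) y)"
    using lborel_integral_real_affine[of "-1" "\<lambda>t. complex_of_real (k t) * cinner (transl t x) y" 0] by simp
  also have "\<dots> = cinner (convl k x) y" by (simp add: cinner_convl assms)
  finally show "cinner (convl k x) y = cinner x (convl (\<lambda>t. k (- t)) y)" by simp
qed

text \<open>Composition convolves the kernels. On the level of matrix coefficients only the values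
  of the convolved kernel matter, and these are explicit for exponential kernels.\<close>

lemma cinner_convl_compose:
  assumes k: "kern k" and l: "kern l"
  shows "cinner (convl k (convl l x)) y
    = (LINT u|lborel. complex_of_real (LINT t|lborel. k t * l (u - t)) * cinner (transl u x) y)"
proof -
  note [measurable] = kern_measurable[OF k] kern_measurable[OF l]
  have k0: "0 \<le> k t" "0 \<le> l t" for t using k l by (auto simp: kern_def)
  have ls: "integrable lborel (\<lambda>u. l (u - t))" for t
    using l lborel_integrable_real_affine[of l 1 "-t"] by (simp add: kern_def)
  have ls': "kern (\<lambda>u. l (u - t))" for t using ls l by (simp add: kern_def)
  define \<Phi> where "\<Phi> u = cinner (transl u x) y" for u
  have [measurable]: "\<Phi> \<in> borel_measurable borel" unfolding \<Phi>_def by measurable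
  let ?F = "\<lambda>t u. complex_of_real (k t * l (u - t)) * \<Phi> u"
  have int: "integrable (lborel \<Otimes>\<^sub>M lborel) (case_prod ?F)"
  proof (rule Bochner_Integration.integrable_bound)
    show "integrable (lborel \<Otimes>\<^sub>M lborel) (\<lambda>p. (norm x * norm y) * (case p of (t, u) \<Rightarrow> k t * l (u - t)))"
    proof (intro integrable_mult_right lborel_pair.Fubini_integrable)
      have "(LINT u|lborel. norm (case (t, u) of (t, u) \<Rightarrow> k t * l (u - t))) = k t * (LINT u|lborel. l u)" for t
        using k0 integral_shift[of l t] by simp
      then show "integrable lborel (\<lambda>t. LINT u|lborel. norm (case (t, u) of (t, u) \<Rightarrow> k t * l (u - t)))"
        using k by (simp add: kern_def)
      show "AE t in lborel. integrable lborel (\<lambda>u. case (t, u) of (t, u) \<Rightarrow> k t * l (u - t))"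
        using ls by (intro AE_I2) simp
    qed auto
    show "AE p in lborel \<Otimes>\<^sub>M lborel. norm (case_prod ?F p) \<le> norm ((norm x * norm y) * (case p of (t, u) \<Rightarrow> k t * l (u - t)))"
      using k0 cinner_transl_le[of _ x y]
      by (intro AE_I2) (auto simp: norm_mult \<Phi>_def mult.commute[of "norm x * norm y"] intro!: mult_left_mono)
  qed auto
  have "cinner (convl k (convl l x)) y = (LINT t|lborel. complex_of_real (k t) * cinner (transl t (convl l x)) y)"
    by (rule cinner_convl[OF k])
  also have "\<dots> = (LINT t|lborel. (LINT u|lborel. ?F t u))"
  proof (intro Bochner_Integration.integral_cong refl)
    fix t
    have "cinner (transl t (convl l x)) y = (LINT s|lborel. complex_of_real (l s) * cinner (transl s x) (transl (- t) y))"
      by (simp add: adjoint_pairD[OF transl_adjoint] cinner_convl l)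
    also have "\<dots> = (LINT s|lborel. complex_of_real (l s) * \<Phi> (s + t))"
      unfolding \<Phi>_def adjoint_pairD[OF transl_adjoint[of t], symmetric] by (simp add: transl_transl add.commute)
    also have "\<dots> = (LINT u|lborel. complex_of_real (l (u - t)) * \<Phi> u)"
      using integral_shift[of "\<lambda>s. complex_of_real (l s) * \<Phi> (s + t)" t] by simp
    finally show "complex_of_real (k t) * cinner (transl t (convl l x)) y = (LINT u|lborel. ?F t u)"
      by (simp add: mult.assoc)
  qed
  also have "\<dots> = (LINT u|lborel. (LINT t|lborel. ?F t u))"
    by (rule lborel_pair.Fubini_integral[OF int, symmetric])
  also have "\<dots> = (LINT u|lborel. complex_of_real (LINT t|lborel. k t * l (u - t)) * cinner (transl u x) y)"
    by (simp only: integral_mult_left_zero integral_complex_of_real \<Phi>_def)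
  finally show ?thesis .
qed

section \<open>Resolvent families\<close>

text \<open>The density of the exponential distribution of rate \<open>a\<close>; convolution with
  it inverts 1 + (1/a) d/dx. Mass one makes it a contraction, and support in the nonnegative times
  makes it an average of the translations that generate the algebra.\<close>

definition expk :: "real \<Rightarrow> real \<Rightarrow> real" where
  "expk a t = a * exp (- a * t) * indicator {0..} t"

lemma integral_exp_Ici:
  fixes a c :: real assumes a: "0 < a"
  shows "has_bochner_integral lborel (\<lambda>t. exp (- a * t) * indicator {c..} t) (exp (- a * c) / a)"
proof -
  have "(\<integral>\<^sup>+t. ennreal (exp (- a * t)) * indicator {c..} t \<partial>lborel) = ennreal (0 - (- exp (- a * c) / a))"
  proof (rule nn_integral_FTC_atLeast)
    show "((\<lambda>t. - exp (- a * t) / a) has_real_derivative exp (- a * t)) (at t)" for t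
      using a by (auto intro!: derivative_eq_intros)
    have "filterlim (\<lambda>t. - (a * t)) at_bot at_top"
      using a by (auto simp: filterlim_uminus_at_bot intro!: filterlim_tendsto_pos_mult_at_top[OF tendsto_const] filterlim_ident)
    then have "((\<lambda>t. - exp (- a * t) / a) \<longlongrightarrow> - 0 / a) at_top"
      using a by (intro tendsto_intros) (auto intro!: filterlim_compose[OF exp_at_bot])
    then show "((\<lambda>t. - exp (- a * t) / a) \<longlongrightarrow> 0) at_top" by simp
  qed auto
  then have "(\<integral>\<^sup>+t. ennreal (exp (- a * t) * indicator {c..} t) \<partial>lborel) = ennreal (exp (- a * c) / a)"
    by (simp add: ennreal_mult' ennreal_indicator)
  then show ?thesis
    using a by (intro has_bochner_integral_nn_integral) auto
qed

lemma expk_measurable [measurable]: "expk a \<in> borel_measurable borel"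
  unfolding expk_def[abs_def] by measurable

lemma expk_nonneg: "0 < a \<Longrightarrow> 0 \<le> expk a t"
  by (simp add: expk_def)

lemma expk_integral: "0 < a \<Longrightarrow> has_bochner_integral lborel (expk a) 1"
  using has_bochner_integral_mult_right[OF integral_exp_Ici[of a 0], of a]
  by (simp add: expk_def[abs_def] mult.assoc)

lemma kern_expk: "0 < a \<Longrightarrow> kern (expk a)"
  using expk_integral[of a] by (auto simp: kern_def expk_nonneg has_bochner_integral_iff)

text \<open>The mean 1/a is the source of the factor 1/a in \<open>commutator_bound\<close>.\<close>

lemma expk_moment: "0 < a \<Longrightarrow> has_bochner_integral lborel (\<lambda>t. t * expk a t) (1 / a)"
proof -
  assume a: "0 < a"
  have "(\<integral>\<^sup>+t. ennreal (a * t * exp (- a * t)) * indicator {0..} t \<partial>lborel) = ennreal (0 - (- (0 + 1 / a) * exp (- a * 0)))"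
  proof (rule nn_integral_FTC_atLeast)
    show "((\<lambda>t. - (t + 1 / a) * exp (- a * t)) has_real_derivative a * t * exp (- a * t)) (at t)" for t
      using a by (auto intro!: derivative_eq_intros simp: field_simps)
    have "((\<lambda>t. - (t + 1 / a) * exp (- a * t)) \<longlongrightarrow> 0) at_top"
      using a by real_asymp
    then show "((\<lambda>t. - (t + 1 / a) * exp (- a * t)) \<longlongrightarrow> 0) at_top" .
  qed (use a in auto)
  moreover have "ennreal (a * t * exp (- a * t)) * indicator {0..} t = ennreal (t * expk a t)" for t
    by (auto simp: expk_def indicator_def ac_simps)
  ultimately have "(\<integral>\<^sup>+t. ennreal (t * expk a t) \<partial>lborel) = ennreal (1 / a)"
    by simp
  then show ?thesis
    using a by (intro has_bochner_integral_nn_integral) (auto simp: expk_def indicator_def)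
qed

text \<open>The characteristic function of the exponential distribution. It exhibits multiplication
  by \<open>mphi b\<close> as an average of modulations with nonnegative parameter.\<close>

lemma expk_Fourier:
  assumes b: "0 < b"
  shows "(LINT s|lborel. complex_of_real (expk b s) * exp (\<i> * complex_of_real (s * u))) = 1 / (1 - \<i> * complex_of_real (u / b))"
proof -
  define c where "c = complex_of_real b - \<i> * complex_of_real u"
  have c: "c \<noteq> 0" "Re c = b" using b by (auto simp: c_def complex_eq_iff)
  have e: "exp (- (c * complex_of_real s)) = complex_of_real (exp (- b * s)) * exp (\<i> * complex_of_real (s * u))" for s
    by (simp add: c_def algebra_simps exp_diff exp_minus field_simps flip: exp_of_real exp_add)
  have ne: "cmod (exp (- (c * complex_of_real s))) = exp (- b * s)" for s
    using c by (simp add: norm_exp_eq_Re)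
  have "(\<lambda>n. LINT s|lborel. indicator {0..real n} s *\<^sub>R exp (- (c * complex_of_real s)))
      \<longlonglongrightarrow> (LINT s|lborel. indicator {0..} s *\<^sub>R exp (- (c * complex_of_real s)))"
  proof (rule integral_dominated_convergence[where w = "\<lambda>s. exp (- b * s) * indicator {0..} s"])
    show "integrable lborel (\<lambda>s. exp (- b * s) * indicator {0..} s)"
      using integral_exp_Ici[OF b, of 0] by (simp add: has_bochner_integral_iff)
    show "AE s in lborel. (\<lambda>n. indicator {0..real n} s *\<^sub>R exp (- (c * complex_of_real s)))
        \<longlonglongrightarrow> indicator {0..} s *\<^sub>R exp (- (c * complex_of_real s))"
    proof (rule AE_I2, rule tendsto_eventually)
      fix s :: real
      obtain n0 where "s \<le> real n0" using real_arch_simple by blast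
      then show "\<forall>\<^sub>F n in sequentially. indicat_real {0..real n} s *\<^sub>R exp (- (c * complex_of_real s)) = indicat_real {0..} s *\<^sub>R exp (- (c * complex_of_real s))"
        unfolding eventually_sequentially by (intro exI[of _ n0]) (auto simp: indicator_def)
    qed
    show "AE s in lborel. norm (indicator {0..real n} s *\<^sub>R exp (- (c * complex_of_real s))) \<le> exp (- b * s) * indicator {0..} s" for n
      by (intro AE_I2) (auto simp: indicator_def ne c)
  qed measurable
  moreover have "(LINT s|lborel. indicator {0..real n} s *\<^sub>R exp (- (c * complex_of_real s))) = 1 / c - exp (- (c * complex_of_real (real n))) / c" for n
  proof -
    have "has_bochner_integral lborel (\<lambda>s. indicator {0..real n} s *\<^sub>R exp (- (c * complex_of_real s)))
       (- exp (- (c * complex_of_real (real n))) / c - (- exp (- (c * complex_of_real 0)) / c))"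
    proof (rule has_bochner_integral_FTC_Icc)
      fix s :: real
      show "((\<lambda>s. - exp (- (c * complex_of_real s)) / c) has_vector_derivative exp (- (c * complex_of_real s))) (at s within {0..real n})"
        using c(1) by (auto intro!: derivative_eq_intros has_vector_derivative_real_field)
    qed (auto intro!: continuous_intros)
    then show ?thesis by (simp add: has_bochner_integral_iff)
  qed
  moreover have "(\<lambda>n. 1 / c - exp (- (c * complex_of_real (real n))) / c) \<longlonglongrightarrow> 1 / c - 0 / c"
  proof -
    have "(\<lambda>n. exp (- b * real n)) \<longlonglongrightarrow> 0" using b by real_asymp
    then have "(\<lambda>n. cmod (exp (- (c * complex_of_real (real n))))) \<longlonglongrightarrow> 0" by (simp only: ne)
    then have "(\<lambda>n. exp (- (c * complex_of_real (real n)))) \<longlonglongrightarrow> 0" by (rule tendsto_norm_zero_cancel)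
    then show ?thesis using c(1) by (intro tendsto_diff tendsto_divide tendsto_const)
  qed
  ultimately have "(LINT s|lborel. indicator {0..} s *\<^sub>R exp (- (c * complex_of_real s))) = 1 / c"
    by (simp add: LIMSEQ_unique)
  then have "complex_of_real b * (LINT s|lborel. indicator {0..} s *\<^sub>R exp (- (c * complex_of_real s))) = complex_of_real b / c" by simp
  also have "complex_of_real b / c = 1 / (1 - \<i> * complex_of_real (u / b))"
    using b c by (simp add: c_def field_simps)
  finally have "(LINT s|lborel. complex_of_real b * (indicator {0..} s *\<^sub>R exp (- (c * complex_of_real s)))) = 1 / (1 - \<i> * complex_of_real (u / b))"
    by (simp only: integral_mult_right_zero)
  moreover have "complex_of_real b * (indicator {0..} s *\<^sub>R exp (- (c * complex_of_real s))) = complex_of_real (expk b s) * exp (\<i> * complex_of_real (s * u))" for s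
    unfolding e by (simp add: expk_def indicator_def)
  ultimately show ?thesis by simp
qed

text \<open>Partial fractions for the product of two resolvents, seen on the kernels.\<close>

lemma expk_conv:
  assumes ab: "0 < a" "0 < b" "a \<noteq> b"
  shows "(LINT t|lborel. expk a t * expk b (u - t)) = (b * expk a u - a * expk b u) / (b - a)"
proof (cases "0 \<le> u")
  case False
  then have "expk a t * expk b (u - t) = 0" for t by (auto simp: expk_def indicator_def)
  then have "(LINT t|lborel. expk a t * expk b (u - t)) = 0"
    by (simp only: Bochner_Integration.integral_zero)
  then show ?thesis using False by (simp add: expk_def[of _ u])
next
  case True
  have "expk a t * expk b (u - t) = (a * b * exp (- b * u) * exp ((b - a) * t)) * indicator {0..u} t" for t
    by (auto simp: expk_def indicator_def algebra_simps simp flip: exp_add)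
  then have "(LINT t|lborel. expk a t * expk b (u - t)) = (LINT t|lborel. (a * b * exp (- b * u) * exp ((b - a) * t)) * indicator {0..u} t)"
    by simp
  also have "\<dots> = a * b * exp (- b * u) * exp ((b - a) * u) / (b - a) - a * b * exp (- b * u) * exp ((b - a) * 0) / (b - a)"
    using True ab by (intro integral_FTC_Icc_real) (auto intro!: derivative_eq_intros continuous_intros)
  also have "exp (- b * u) * exp ((b - a) * u) = exp (- a * u)"
    by (simp add: algebra_simps flip: exp_add)
  then have "a * b * exp (- b * u) * exp ((b - a) * u) / (b - a) - a * b * exp (- b * u) * exp ((b - a) * 0) / (b - a) = (b * expk a u - a * expk b u) / (b - a)"
    using True by (simp add: expk_def algebra_simps diff_divide_distrib mult.assoc)
  finally show ?thesis .
qed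

text \<open>The point \<open>u = 0\<close> is excluded because both one-sided kernels contribute
  there and the right-hand side is twice the integral; as a null set it does not affect the operator
  identity.\<close>

lemma expk_conv_reflect:
  assumes ab: "0 < a" "0 < b" and u: "u \<noteq> 0"
  shows "(LINT t|lborel. expk a (- t) * expk b (u - t)) = (b * expk a (- u) + a * expk b u) / (a + b)"
proof -
  have "(LINT t|lborel. expk a (- t) * expk b (u - t)) = (LINT t|lborel. expk a t * expk b (u + t))"
    using lborel_integral_real_affine[of "-1" "\<lambda>t. expk a t * expk b (u + t)" 0] by simp
  also have "\<dots> = (LINT t|lborel. (a * b * exp (- b * u)) * (exp (- (a + b) * t) * indicator {max 0 (- u)..} t))"
    by (intro Bochner_Integration.integral_cong) (auto simp: expk_def indicator_def algebra_simps simp flip: exp_add)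
  also have "\<dots> = (a * b * exp (- b * u)) * (exp (- (a + b) * max 0 (- u)) / (a + b))"
    using integral_exp_Ici[of "a + b" "max 0 (- u)"] ab by (simp add: has_bochner_integral_iff)
  also have "\<dots> = (b * expk a (- u) + a * expk b u) / (a + b)"
    using u by (cases "0 < u") (auto simp: expk_def indicator_def max_def algebra_simps simp flip: exp_add)
  finally show ?thesis .
qed

lemma convl_commute:
  assumes k: "kern k" and l: "kern l"
  shows "convl k o\<^sub>L convl l = convl l o\<^sub>L convl k"
proof (intro blinfun_eqI cinner_ext)
  fix x y
  have "(LINT t|lborel. l t * k (u - t)) = (LINT t|lborel. k t * l (u - t))" for u
    using lborel_integral_real_affine[of "-1" "\<lambda>t. k t * l (u - t)" u] by (simp add: mult.commute)
  then show "cinner ((convl k o\<^sub>L convl l) x) y = cinner ((convl l o\<^sub>L convl k) x) y"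
    by (simp add: cinner_convl_compose k l)
qed

text \<open>For a group of unitaries with generator \<open>A\<close> these are the algebraic identities of \<open>R a = (1 + A / a)\<^sup>-\<^sup>1\<close> and its adjoint; they replace the spectral theorem.\<close>

definition resolvent_family :: "(real \<Rightarrow> l2 \<Rightarrow>\<^sub>L l2) \<Rightarrow> (real \<Rightarrow> l2 \<Rightarrow>\<^sub>L l2) \<Rightarrow> bool" where
  "resolvent_family R R' \<longleftrightarrow>
    (\<forall>a>0. adjoint_pair (R a) (R' a) \<and> norm (R a) \<le> 1) \<and>
    (\<forall>a>0. \<forall>b>0. a \<noteq> b \<longrightarrow> R a o\<^sub>L R b = (1 / (b - a)) *\<^sub>R (b *\<^sub>R R a - a *\<^sub>R R b)) \<and>
    (\<forall>a>0. \<forall>b>0. R' a o\<^sub>L R b = (1 / (a + b)) *\<^sub>R (b *\<^sub>R R' a + a *\<^sub>R R b)) \<and>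
    (\<forall>a>0. \<forall>b>0. R b o\<^sub>L R' a = R' a o\<^sub>L R b)"

definition Gr :: "real \<Rightarrow> l2 \<Rightarrow>\<^sub>L l2" where "Gr a = convl (expk a)"
definition Gr' :: "real \<Rightarrow> l2 \<Rightarrow>\<^sub>L l2" where "Gr' a = convl (\<lambda>t. expk a (- t))"

lemma resolvent_family_Gr: "resolvent_family Gr Gr'"
  unfolding resolvent_family_def
proof (intro conjI allI impI)
  fix a b :: real assume a: "0 < a"
  show "adjoint_pair (Gr a) (Gr' a)" unfolding Gr_def Gr'_def by (rule convl_adjoint[OF kern_expk[OF a]])
  show "norm (Gr a) \<le> 1"
    using norm_convl_le[OF kern_expk[OF a]] expk_integral[OF a] by (simp add: Gr_def has_bochner_integral_iff)
  assume b: "0 < b"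
  have W: "cinner (Gr c x) y = (LINT u|lborel. complex_of_real (expk c u) * cinner (transl u x) y)"
          "integrable lborel (\<lambda>u. complex_of_real (expk c u) * cinner (transl u x) y)"
          "cinner (Gr' c x) y = (LINT u|lborel. complex_of_real (expk c (- u)) * cinner (transl u x) y)"
          "integrable lborel (\<lambda>u. complex_of_real (expk c (- u)) * cinner (transl u x) y)" if "0 < c" for c x y
    using kern_expk[OF that] by (simp_all add: Gr_def Gr'_def cinner_convl kern_reflect kern_integrable_cinner)
  show "Gr b o\<^sub>L Gr' a = Gr' a o\<^sub>L Gr b"
    unfolding Gr_def Gr'_def using a b by (intro convl_commute kern_reflect kern_expk)
  { assume ab: "a \<noteq> b"
    show "Gr a o\<^sub>L Gr b = (1 / (b - a)) *\<^sub>R (b *\<^sub>R Gr a - a *\<^sub>R Gr b)"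
    proof (intro blinfun_eqI cinner_ext)
      fix x y
      have "cinner (Gr a (Gr b x)) y = (LINT u|lborel. complex_of_real ((b * expk a u - a * expk b u) / (b - a)) * cinner (transl u x) y)"
        using a b ab by (simp add: Gr_def cinner_convl_compose kern_expk expk_conv)
      also have "\<dots> = (LINT u|lborel. complex_of_real (b / (b - a)) * (complex_of_real (expk a u) * cinner (transl u x) y)
           - complex_of_real (a / (b - a)) * (complex_of_real (expk b u) * cinner (transl u x) y))"
        by (intro Bochner_Integration.integral_cong) (auto simp: algebra_simps diff_divide_distrib)
      also have "\<dots> = complex_of_real (b / (b - a)) * cinner (Gr a x) y - complex_of_real (a / (b - a)) * cinner (Gr b x) y"
        using W(1,2)[OF a] W(1,2)[OF b] by (subst Bochner_Integration.integral_diff) (auto simp del: of_real_divide)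
      finally show "cinner ((Gr a o\<^sub>L Gr b) x) y = cinner (((1 / (b - a)) *\<^sub>R (b *\<^sub>R Gr a - a *\<^sub>R Gr b)) x) y"
        by (simp add: blinfun.scaleR_left blinfun.diff_left scaleR_cscale cinner_scale_left cinner_diff_left algebra_simps diff_divide_distrib)
    qed }
  show "Gr' a o\<^sub>L Gr b = (1 / (a + b)) *\<^sub>R (b *\<^sub>R Gr' a + a *\<^sub>R Gr b)"
  proof (intro blinfun_eqI cinner_ext)
    fix x y
    have "cinner (Gr' a (Gr b x)) y = (LINT u|lborel. complex_of_real (LINT t|lborel. expk a (- t) * expk b (u - t)) * cinner (transl u x) y)"
      using a b by (simp add: Gr_def Gr'_def cinner_convl_compose kern_expk kern_reflect)
    also have "\<dots> = (LINT u|lborel. complex_of_real (b / (a + b)) * (complex_of_real (expk a (- u)) * cinner (transl u x) y)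
         + complex_of_real (a / (a + b)) * (complex_of_real (expk b u) * cinner (transl u x) y))"
    proof (rule integral_cong_AE)
      have "AE u in lborel. u \<noteq> (0::real)" by (rule AE_lborel_singleton)
      then show "AE u in lborel. complex_of_real (LINT t|lborel. expk a (- t) * expk b (u - t)) * cinner (transl u x) y
         = complex_of_real (b / (a + b)) * (complex_of_real (expk a (- u)) * cinner (transl u x) y)
         + complex_of_real (a / (a + b)) * (complex_of_real (expk b u) * cinner (transl u x) y)"
        by eventually_elim (simp add: expk_conv_reflect a b algebra_simps add_divide_distrib)
    qed measurable
    also have "\<dots> = complex_of_real (b / (a + b)) * cinner (Gr' a x) y + complex_of_real (a / (a + b)) * cinner (Gr b x) y"
      using W(3,4)[OF a] W(1,2)[OF b] by (subst Bochner_Integration.integral_add) (auto simp del: of_real_divide)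
    finally show "cinner ((Gr' a o\<^sub>L Gr b) x) y = cinner (((1 / (a + b)) *\<^sub>R (b *\<^sub>R Gr' a + a *\<^sub>R Gr b)) x) y"
      by (simp add: blinfun.scaleR_left blinfun.add_left scaleR_cscale cinner_scale_left cinner_add_left algebra_simps add_divide_distrib)
  qed
qed

definition mphi :: "real \<Rightarrow> fn" where "mphi b x = 1 / (1 - \<i> * complex_of_real (x / b))"

lemma mphi_denom: "1 - \<i> * complex_of_real u \<noteq> 0" "1 + \<i> * complex_of_real u \<noteq> 0" "1 \<le> cmod (1 - \<i> * complex_of_real u)"
  by (auto simp: complex_eq_iff cmod_def)

lemma mphi_le: "cmod (mphi b x) \<le> 1"
  using mphi_denom(3)[of "x / b"] by (simp add: mphi_def norm_divide del: of_real_divide)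

lemma bm_mphi: "bm (mphi b)"
  by (rule bmI[OF _ mphi_le]) (simp add: mphi_def[abs_def])

text \<open>\<open>Gr a\<close> and \<open>Mr b\<close> are the Laplace averages of the translations and of the modulations, hence lie in the parabolic algebra.\<close>

definition Mr :: "real \<Rightarrow> l2 \<Rightarrow>\<^sub>L l2" where "Mr b = bmult (mphi b)"
definition Mr' :: "real \<Rightarrow> l2 \<Rightarrow>\<^sub>L l2" where "Mr' b = bmult (\<lambda>x. cnj (mphi b x))"

lemma bmult_scale_apply: "bm \<phi> \<Longrightarrow> bmult (\<lambda>x. c * \<phi> x) v = c *\<^sub>C bmult \<phi> v"
proof -
  assume "bm \<phi>"
  moreover obtain f where f: "f \<in> L2" "v = cls f" by (rule l2_cases)
  ultimately show ?thesis by (simp add: bmult_cls bm_scale L2_bm_mult cls_cscale mult.assoc)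
qed

lemma bmult_scaleR: "bm \<phi> \<Longrightarrow> bmult (\<lambda>x. complex_of_real r * \<phi> x) = r *\<^sub>R bmult \<phi>"
  by (rule blinfun_eqI) (simp add: bmult_scale_apply blinfun.scaleR_left scaleR_cscale)

lemma bm_add: "bm \<phi> \<Longrightarrow> bm \<psi> \<Longrightarrow> bm (\<lambda>x. \<phi> x + \<psi> x)"
  using bm_diff[of \<phi> "\<lambda>x. (-1) * \<psi> x"] bm_scale[of \<psi> "-1"] by simp

lemma bmult_add:
  assumes "bm \<phi>" "bm \<psi>" shows "bmult (\<lambda>x. \<phi> x + \<psi> x) = bmult \<phi> + bmult \<psi>"
  using assms by (intro blinfun_eq_cls) (simp add: bmult_cls bm_add L2_bm_mult blinfun.add_left cls_add distrib_right)

lemma resolvent_family_Mr: "resolvent_family Mr Mr'"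
  unfolding resolvent_family_def
proof (intro conjI allI impI)
  fix a b :: real assume a: "0 < a"
  show "adjoint_pair (Mr a) (Mr' a)" unfolding Mr_def Mr'_def by (rule bmult_adjoint[OF bm_mphi])
  show "norm (Mr a) \<le> 1" unfolding Mr_def by (rule norm_bmult_le[OF bm_mphi mphi_le])
  assume b: "0 < b"
  note bms = bm_mphi bm_cnj[OF bm_mphi] bm_scale[OF bm_mphi] bm_scale[OF bm_cnj[OF bm_mphi]]
  show "Mr b o\<^sub>L Mr' a = Mr' a o\<^sub>L Mr b"
    unfolding Mr_def Mr'_def by (simp add: bmult_compose bms mult.commute)
  { assume ab: "a \<noteq> b"
    have "mphi a x * mphi b x = complex_of_real (b / (b - a)) * mphi a x - complex_of_real (a / (b - a)) * mphi b x" for x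
    proof -
      have [simp]: "complex_of_real a - \<i> * complex_of_real x \<noteq> 0" "complex_of_real b - \<i> * complex_of_real x \<noteq> 0"
        using a b by (auto simp: complex_eq_iff)
      have e: "mphi c x = complex_of_real c / (complex_of_real c - \<i> * complex_of_real x)" if "0 < c" for c
        using that by (simp add: mphi_def field_simps)
      show ?thesis unfolding e[OF a] e[OF b] using a b ab by (simp add: divide_simps) (simp add: algebra_simps)
    qed
    then have "Mr a o\<^sub>L Mr b = bmult (\<lambda>x. complex_of_real (b / (b - a)) * mphi a x - complex_of_real (a / (b - a)) * mphi b x)"
      unfolding Mr_def by (simp only: bmult_compose bms)
    also have "\<dots> = (b / (b - a)) *\<^sub>R Mr a - (a / (b - a)) *\<^sub>R Mr b"
      unfolding Mr_def by (simp only: bmult_diff bms bmult_scaleR)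
    also have "\<dots> = (1 / (b - a)) *\<^sub>R (b *\<^sub>R Mr a - a *\<^sub>R Mr b)" by (simp add: scaleR_right_diff_distrib)
    finally show "Mr a o\<^sub>L Mr b = (1 / (b - a)) *\<^sub>R (b *\<^sub>R Mr a - a *\<^sub>R Mr b)" . }
  have "cnj (mphi a x) * mphi b x = complex_of_real (b / (a + b)) * cnj (mphi a x) + complex_of_real (a / (a + b)) * mphi b x" for x
  proof -
    have [simp]: "complex_of_real a + \<i> * complex_of_real x \<noteq> 0" "complex_of_real b - \<i> * complex_of_real x \<noteq> 0"
        "complex_of_real a + complex_of_real b \<noteq> 0"
      using a b by (auto simp: complex_eq_iff simp flip: of_real_add)
    have e: "mphi b x = complex_of_real b / (complex_of_real b - \<i> * complex_of_real x)"
      "cnj (mphi a x) = complex_of_real a / (complex_of_real a + \<i> * complex_of_real x)"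
      using a b by (simp_all add: mphi_def field_simps)
    show ?thesis unfolding e using a b by (simp add: divide_simps) (simp add: algebra_simps)
  qed
  then have "Mr' a o\<^sub>L Mr b = bmult (\<lambda>x. complex_of_real (b / (a + b)) * cnj (mphi a x) + complex_of_real (a / (a + b)) * mphi b x)"
    unfolding Mr_def Mr'_def by (simp only: bmult_compose bms)
  also have "\<dots> = (b / (a + b)) *\<^sub>R Mr' a + (a / (a + b)) *\<^sub>R Mr b"
    unfolding Mr_def Mr'_def by (simp only: bmult_add bms bmult_scaleR)
  also have "\<dots> = (1 / (a + b)) *\<^sub>R (b *\<^sub>R Mr' a + a *\<^sub>R Mr b)" by (simp add: scaleR_right_distrib)
  finally show "Mr' a o\<^sub>L Mr b = (1 / (a + b)) *\<^sub>R (b *\<^sub>R Mr' a + a *\<^sub>R Mr b)" .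
qed

interpretation compose: bounded_bilinear blinfun_compose
  by (rule bounded_bilinear_blinfun_compose)

lemma adjoint_unique: "adjoint_pair A B \<Longrightarrow> adjoint_pair A B' \<Longrightarrow> B = B'"
  by (intro blinfun_eqI cinner_ext) (metis adjoint_pairD adjoint_pair_sym)

text \<open>Again partial fractions: for \<open>Mr\<close> the skew part is multiplication by 2 i
  (x/a) / (1 + (x/a)^2), and the sum \<open>R a + R' a\<close> by 2 / (1 + (x/a)^2). The gain is
  that the bracket stays bounded while the scalar in front decays with the ratio of the two
  parameters.\<close>

lemma resolvent_product:
  assumes RF: "resolvent_family R R'" and ab: "0 < a" "0 < b" "a \<noteq> b"
  shows "(R a - R' a) o\<^sub>L (R b - R' b) = (2 * a * b / (b\<^sup>2 - a\<^sup>2)) *\<^sub>R ((R a + R' a) - (R b + R' b))"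
proof -
  define p q where "p = 1 / (b - a)" and "q = 1 / (a + b)"
  have pq: "b * p - b * q = 2 * a * b / (b\<^sup>2 - a\<^sup>2)" "a * p + a * q = 2 * a * b / (b\<^sup>2 - a\<^sup>2)"
  proof -
    have "b\<^sup>2 - a\<^sup>2 = (b - a) * (a + b)" "b - a \<noteq> 0" "a + b \<noteq> 0" using ab by (auto simp: power2_eq_square algebra_simps)
    then show "b * p - b * q = 2 * a * b / (b\<^sup>2 - a\<^sup>2)" "a * p + a * q = 2 * a * b / (b\<^sup>2 - a\<^sup>2)"
      unfolding p_def q_def by (simp_all add: divide_simps) (simp_all add: algebra_simps)
  qed
  have 1: "R a o\<^sub>L R b = p *\<^sub>R (b *\<^sub>R R a - a *\<^sub>R R b)"
    and 2: "R' a o\<^sub>L R b = q *\<^sub>R (b *\<^sub>R R' a + a *\<^sub>R R b)"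
    and 3: "R a o\<^sub>L R' b = q *\<^sub>R (a *\<^sub>R R' b + b *\<^sub>R R a)"
    using RF ab unfolding resolvent_family_def p_def q_def by (auto simp: add.commute)
  have adj: "adjoint_pair (R c) (R' c)" if "0 < c" for c using RF that by (simp add: resolvent_family_def)
  have "R b o\<^sub>L R a = (1 / (a - b)) *\<^sub>R (a *\<^sub>R R b - b *\<^sub>R R a)"
    using RF ab unfolding resolvent_family_def by auto
  also have "\<dots> = p *\<^sub>R (b *\<^sub>R R a - a *\<^sub>R R b)"
    unfolding p_def by (metis (no_types, opaque_lifting) minus_diff_eq minus_divide_right scaleR_minus_left scaleR_minus_right)
  finally have "R b o\<^sub>L R a = p *\<^sub>R (b *\<^sub>R R a - a *\<^sub>R R b)" .
  \<comment> \<open>The product of two adjoints is the adjoint of the product in reverse order, and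
    adjoints are unique.\<close>
  then have 4: "R' a o\<^sub>L R' b = p *\<^sub>R (b *\<^sub>R R' a - a *\<^sub>R R' b)"
    using adjoint_pair_compose[OF adj[OF ab(2)] adj[OF ab(1)]] adj ab
    by (intro adjoint_unique[of "R b o\<^sub>L R a"]) (auto intro!: adjoint_pair_scaleR adjoint_pair_diff)
  have "(R a - R' a) o\<^sub>L (R b - R' b) = (b * p - b * q) *\<^sub>R (R a + R' a) - (a * p + a * q) *\<^sub>R (R b + R' b)"
    by (simp add: compose.diff_left compose.diff_right 1 2 3 4 algebra_simps)
  then show ?thesis unfolding pq by (simp only: scaleR_right_diff_distrib)
qed

text \<open>The skew parts satisfy \<open>norm (T a o T b) = O(a / b)\<close> for \<open>a < b\<close>, so for lacunary parameters they are almost orthogonal and the sum of \<open>N\<close> of them has norm \<open>O(sqrt N)\<close>, although each has norm of order one.\<close>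

lemma resolvent_average:
  assumes RF: "resolvent_family R R'" and N: "0 < N" and r: "8 * real N + 1 \<le> r"
  shows "norm (\<Sum>j<N. R (r ^ Suc j) - R' (r ^ Suc j)) \<le> sqrt (5 * real N)"
proof -
  define T where "T j = R (r ^ Suc j) - R' (r ^ Suc j)" for j
  define S where "S = (\<Sum>j<N. T j)"
  have r1: "1 < r" using r N by linarith
  have pos: "0 < r ^ Suc j" for j using r1 by simp
  have adj: "adjoint_pair (R c) (R' c)" "norm (R c) \<le> 1" "norm (R' c) \<le> 1" if "0 < c" for c
    using RF that norm_adjoint[of "R c" "R' c"] by (auto simp: resolvent_family_def)
  have Tadj: "adjoint_pair (T j) (- T j)" for j
    unfolding T_def using adjoint_pair_diff[OF adj(1)[OF pos] adjoint_pair_sym[OF adj(1)[OF pos]], of j] by simp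
  have T2: "norm (T j) \<le> 2" for j
    unfolding T_def using norm_triangle_ineq4[of "R (r ^ Suc j)" "R' (r ^ Suc j)"] adj(2,3)[OF pos[of j]] by linarith
  have off: "norm (T i o\<^sub>L T j) \<le> 1 / real N" if "i \<noteq> j" for i j
  proof -
    define a b where "a = r ^ Suc i" and "b = r ^ Suc j"
    have ab: "0 < a" "0 < b" "a \<noteq> b"
      using pos that r1 by (auto simp: a_def b_def power_inject_exp simp del: power_Suc)
    \<comment> \<open>The 8 is the numerator 2 of \<open>resolvent_product\<close> times the bound 4
      for its bracket. The ratio \<open>8 * real N + 1\<close> makes each off-diagonal product at
      most 1/N, so all of them together contribute at most N, next to 4 N from the diagonal.\<close>
    have key: "8 * x * y / (y\<^sup>2 - x\<^sup>2) \<le> 1 / real N" if "0 < x" "r * x \<le> y" for x y :: real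
    proof -
      have yx: "8 * real N * x \<le> y - x" using that r mult_right_mono[OF r, of x] by (simp add: algebra_simps)
      have "0 < 8 * real N * x" using that N by simp
      then have "0 < y - x" using yx by linarith
      then have pp: "0 < (y - x) * (y + x)" using that by simp
      have "8 * real N * x * y \<le> (y - x) * y" using yx \<open>0 < y - x\<close> that by (intro mult_right_mono) auto
      also have "\<dots> \<le> (y - x) * (y + x)" using that \<open>0 < y - x\<close> by (intro mult_left_mono) auto
      finally have "8 * x * y * real N \<le> (y - x) * (y + x)" by (simp add: algebra_simps)
      then have "8 * x * y / ((y - x) * (y + x)) \<le> 1 / real N"
        using pp N by (simp add: divide_simps mult.commute)
      then show ?thesis by (simp add: power2_eq_square algebra_simps)
    qed
    have "norm (T i o\<^sub>L T j) = norm ((2 * a * b / (b\<^sup>2 - a\<^sup>2)) *\<^sub>R ((R a + R' a) - (R b + R' b)))"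
      unfolding T_def a_def[symmetric] b_def[symmetric] by (simp only: resolvent_product[OF RF ab])
    also have "\<dots> \<le> \<bar>2 * a * b / (b\<^sup>2 - a\<^sup>2)\<bar> * 4"
    proof -
      have "norm ((R a + R' a) - (R b + R' b)) \<le> 4"
        using norm_triangle_ineq4[of "R a + R' a" "R b + R' b"] norm_triangle_ineq[of "R a" "R' a"]
          norm_triangle_ineq[of "R b" "R' b"] adj(2,3)[OF ab(1)] adj(2,3)[OF ab(2)] by linarith
      then show ?thesis unfolding norm_scaleR by (rule mult_left_mono) simp
    qed
    also have "\<dots> \<le> 1 / real N"
    proof (cases "i < j")
      case True
      then have "r ^ Suc (Suc i) \<le> r ^ Suc j" using r1 by (intro power_increasing) auto
      then have le: "r * a \<le> b" by (simp add: a_def b_def)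
      then have "a < b" using r1 ab mult_strict_right_mono[OF r1 ab(1)] by linarith
      then have "0 < b\<^sup>2 - a\<^sup>2" using ab by (simp add: power_strict_mono)
      then show ?thesis using key[OF ab(1) le] ab by (simp add: abs_mult abs_divide)
    next
      case False
      then have "r ^ Suc (Suc j) \<le> r ^ Suc i" using r1 \<open>i \<noteq> j\<close> by (intro power_increasing) auto
      then have le: "r * b \<le> a" by (simp add: a_def b_def)
      then have "b < a" using r1 ab mult_strict_right_mono[OF r1 ab(2)] by linarith
      then have "0 < a\<^sup>2 - b\<^sup>2" using ab by (simp add: power_strict_mono)
      then have "\<bar>b\<^sup>2 - a\<^sup>2\<bar> = a\<^sup>2 - b\<^sup>2" by simp
      then have "\<bar>2 * a * b / (b\<^sup>2 - a\<^sup>2)\<bar> * 4 = 8 * b * a / (a\<^sup>2 - b\<^sup>2)"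
        using ab by (simp add: abs_mult abs_divide)
      then show ?thesis using key[OF ab(2) le] by simp
    qed
    finally show ?thesis .
  qed
  have "S o\<^sub>L S = (\<Sum>i<N. T i o\<^sub>L S)" unfolding S_def by (rule compose.sum_left)
  also have "\<dots> = (\<Sum>i<N. \<Sum>j<N. T i o\<^sub>L T j)" unfolding S_def by (intro sum.cong refl compose.sum_right)
  finally have "norm (S o\<^sub>L S) = norm (\<Sum>i<N. \<Sum>j<N. T i o\<^sub>L T j)" by simp
  also have "\<dots> \<le> (\<Sum>i<N. \<Sum>j<N. (if i = j then 4 else 0) + 1 / real N)"
  proof (intro order_trans[OF norm_sum] sum_mono)
    fix i j
    show "norm (T i o\<^sub>L T j) \<le> (if i = j then 4 else 0) + 1 / real N"
    proof (cases "i = j")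
      case True
      have "norm (T i o\<^sub>L T j) \<le> norm (T i) * norm (T j)" by (rule norm_blinfun_compose)
      also have "\<dots> \<le> 2 * 2" by (intro mult_mono T2) auto
      finally show ?thesis using True by (simp add: add_increasing2)
    qed (use off in auto)
  qed
  also have "\<dots> = 5 * real N" using N by (simp add: sum.distrib)
  finally have SS: "norm (S o\<^sub>L S) \<le> 5 * real N" .
  have Sadj: "adjoint_pair S (- S)"
    unfolding S_def using adjoint_pair_sum[of "{..<N}" T "\<lambda>j. - T j"] Tadj by (simp add: sum_negf)
  \<comment> \<open>As \<open>S\<close> is skew-adjoint, the square of its norm is bounded by the
    norm of \<open>S o\<^sub>L S\<close>.\<close>
  have "norm S \<le> sqrt (5 * real N)"
  proof (rule norm_blinfun_bound)
    fix x
    have "(norm (S x))\<^sup>2 = Re (cinner (S x) (S x))" by (simp add: cinner_self)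
    also have "\<dots> = Re (cinner x (- S (S x)))" by (simp add: adjoint_pairD[OF Sadj] blinfun.minus_left)
    also have "\<dots> \<le> norm x * norm ((S o\<^sub>L S) x)"
      using norm_cinner_le[of x "- S (S x)"] complex_Re_le_cmod[of "cinner x (- S (S x))"] by simp
    also have "\<dots> \<le> norm x * (5 * real N * norm x)"
      using SS by (intro mult_left_mono order_trans[OF norm_blinfun] mult_right_mono) auto
    finally have "(norm (S x))\<^sup>2 \<le> (5 * real N) * (norm x)\<^sup>2" by (simp add: power2_eq_square algebra_simps)
    then have "norm (S x) \<le> sqrt ((5 * real N) * (norm x)\<^sup>2)" by (rule real_le_rsqrt)
    then show "norm (S x) \<le> sqrt (5 * real N) * norm x" by (simp add: real_sqrt_mult)
  qed simp
  then show ?thesis by (simp add: S_def T_def)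
qed

section \<open>Membership in the parabolic algebra\<close>

definition Ms :: "real \<Rightarrow> l2 \<Rightarrow>\<^sub>L l2" where
  "Ms s = bmult (\<lambda>x. exp (\<i> * complex_of_real (s * x)))"

lemma bm_exp: "bm (\<lambda>x. exp (\<i> * complex_of_real (s * x)))"
  by (rule bmI[of _ 1]) (auto simp: norm_exp_eq_Re)

text \<open>The counterpart of \<open>cinner_convl\<close> for modulations: Fubini applied to the
  Fourier integral of \<open>mphi b\<close>.\<close>

lemma cinner_Mr:
  assumes b: "0 < b"
  shows "cinner (Mr b x) y = (LINT s|lborel. complex_of_real (expk b s) * cinner (Ms s x) y)"
proof -
  obtain f g where fg: "f \<in> L2" "x = cls f" "g \<in> L2" "y = cls g" by (metis l2_cases)
  note [measurable] = L2_measurable[OF fg(1)] L2_measurable[OF fg(3)]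
  define h where "h u = cnj (f u) * g u" for u
  have h: "integrable lborel h" unfolding h_def by (rule L2_integrable_inner[OF fg(1,3)])
  have [measurable]: "h \<in> borel_measurable borel" unfolding h_def by measurable
  have k: "integrable lborel (expk b)" using expk_integral[OF b] by (simp add: has_bochner_integral_iff)
  let ?F = "\<lambda>s u. complex_of_real (expk b s) * cnj (exp (\<i> * complex_of_real (s * u))) * h u"
  have nF: "cmod (?F s u) = expk b s * cmod (h u)" for s u
    using expk_nonneg[OF b, of s] by (simp add: norm_mult norm_exp_eq_Re)
  have int: "integrable (lborel \<Otimes>\<^sub>M lborel) (case_prod ?F)"
  proof (rule lborel_pair.Fubini_integrable)
    show "integrable lborel (\<lambda>s. LINT u|lborel. norm (case_prod ?F (s, u)))"
      unfolding prod.case nF using k by simp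
    show "AE s in lborel. integrable lborel (\<lambda>u. case_prod ?F (s, u))"
    proof (rule AE_I2, simp only: prod.case, rule Bochner_Integration.integrable_bound)
      fix s show "integrable lborel (\<lambda>u. expk b s * cmod (h u))" using h by simp
      show "AE u in lborel. norm (?F s u) \<le> norm (expk b s * cmod (h u))" by (simp only: nF) simp
    qed measurable
  qed measurable
  have "cinner (Mr b x) y = (LINT u|lborel. cnj (mphi b u) * h u)"
    using fg bm_mphi L2_bm_mult[OF bm_mphi fg(1)]
    by (simp add: Mr_def bmult_cls cinner_cls l2inner_def h_def mult.assoc)
  also have "\<dots> = (LINT u|lborel. (LINT s|lborel. ?F s u))"
  proof (intro Bochner_Integration.integral_cong refl)
    fix u
    have "cnj (mphi b u) = (LINT s|lborel. complex_of_real (expk b s) * cnj (exp (\<i> * complex_of_real (s * u))))"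
      unfolding mphi_def expk_Fourier[OF b, symmetric] Bochner_Integration.integral_cnj[symmetric]
      by (simp only: complex_cnj_mult complex_cnj_complex_of_real)
    then show "cnj (mphi b u) * h u = (LINT s|lborel. ?F s u)" by (simp only: integral_mult_left_zero)
  qed
  also have "\<dots> = (LINT s|lborel. (LINT u|lborel. ?F s u))" by (rule lborel_pair.Fubini_integral[OF int])
  also have "\<dots> = (LINT s|lborel. complex_of_real (expk b s) * cinner (Ms s x) y)"
  proof (intro Bochner_Integration.integral_cong refl)
    fix s
    have "cinner (Ms s x) y = (LINT u|lborel. cnj (exp (\<i> * complex_of_real (s * u))) * h u)"
      using fg L2_bm_mult[OF bm_exp fg(1), of s]
      by (simp only: Ms_def bmult_cls[OF bm_exp] cinner_cls l2inner_def h_def mult.assoc complex_cnj_mult)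
    then show "(LINT u|lborel. ?F s u) = complex_of_real (expk b s) * cinner (Ms s x) y"
      by (simp only: mult.assoc integral_mult_right_zero)
  qed
  finally show ?thesis .
qed

text \<open>The WOT-continuous functionals are the finite sums of matrix coefficients; \<open>bipolar A\<close> says that \<open>A\<close> is annihilated by those that annihilate all products \<open>M\<^sub>\<lambda> D\<^sub>\<mu>\<close>.\<close>

definition bipolar :: "(l2 \<Rightarrow>\<^sub>L l2) \<Rightarrow> bool" where
  "bipolar A \<longleftrightarrow> (\<forall>(n::nat) x y.
     (\<forall>lam\<ge>0. \<forall>mu\<ge>0. (\<Sum>i<n. cinner (Ms lam (transl mu (x i))) (y i)) = 0)
     \<longrightarrow> (\<Sum>i<n. cinner (A (x i)) (y i)) = 0)"

lemma bipolar_zero: "bipolar 0" by (simp add: bipolar_def)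

lemma bipolar_add: "bipolar A \<Longrightarrow> bipolar B \<Longrightarrow> bipolar (A + B)"
  unfolding bipolar_def by (simp add: blinfun.add_left cinner_add_left sum.distrib)

lemma bipolar_sum: "(\<And>i. i \<in> I \<Longrightarrow> bipolar (A i)) \<Longrightarrow> bipolar (sum A I)"
  by (induction I rule: infinite_finite_induct) (auto intro: bipolar_zero bipolar_add)

lemma bipolar_scaleR: "bipolar A \<Longrightarrow> bipolar (r *\<^sub>R A)"
  unfolding bipolar_def by (simp add: blinfun.scaleR_left scaleR_cscale cinner_scale_left flip: sum_distrib_left)

text \<open>Each condition involves finitely many matrix coefficients, so strong convergence is
  enough; this matters because the witness is only a strong limit of its partial sums.\<close>

lemma bipolar_limit:
  fixes L :: "l2 \<Rightarrow>\<^sub>L l2"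
  assumes "\<And>n. bipolar (A n)" "\<And>x. (\<lambda>n. A n x) \<longlonglongrightarrow> L x" shows "bipolar L"
  unfolding bipolar_def
proof (intro allI impI)
  fix n :: nat and x y
  assume *: "\<forall>lam\<ge>0. \<forall>mu\<ge>0. (\<Sum>i<n. cinner (Ms lam (transl mu (x i))) (y i)) = 0"
  have "(\<lambda>m. \<Sum>i<n. cinner (A m (x i)) (y i)) \<longlonglongrightarrow> (\<Sum>i<n. cinner (L (x i)) (y i))"
    by (intro tendsto_intros assms(2))
  moreover have "(\<Sum>i<n. cinner (A m (x i)) (y i)) = 0" for m
    using assms(1)[of m] * unfolding bipolar_def by blast
  ultimately show "(\<Sum>i<n. cinner (L (x i)) (y i)) = 0" by (simp add: LIMSEQ_const_iff)
qed

text \<open>The Weyl commutation relation.\<close>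

lemma Ms_transl: "transl t (Ms s x) = exp (- \<i> * complex_of_real (s * t)) *\<^sub>C Ms s (transl t x)"
proof -
  have "transl t (Ms s x) = bmult (\<lambda>x. exp (\<i> * complex_of_real (s * (x - t)))) (transl t x)"
    unfolding Ms_def by (rule transl_bmult[OF bm_exp])
  also have "(\<lambda>x. exp (\<i> * complex_of_real (s * (x - t)))) = (\<lambda>x. exp (- \<i> * complex_of_real (s * t)) * exp (\<i> * complex_of_real (s * x)))"
    by (simp add: fun_eq_iff algebra_simps flip: exp_add)
  finally show ?thesis by (simp only: bmult_scale_apply[OF bm_exp] Ms_def)
qed

text \<open>By the Weyl relation the conjugation changes each product of a modulation and a
  translation by a unimodular scalar only, hence \<open>t\<close> may have either sign.\<close>

lemma bipolar_conjugate:
  assumes "bipolar A" shows "bipolar (transl t o\<^sub>L A o\<^sub>L transl (- t))"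
  unfolding bipolar_def
proof (intro allI impI)
  fix n :: nat and x y
  assume *: "\<forall>lam\<ge>0. \<forall>mu\<ge>0. (\<Sum>i<n. cinner (Ms lam (transl mu (x i))) (y i)) = 0"
  have "(\<Sum>i<n. cinner (Ms lam (transl mu (transl (- t) (x i)))) (transl (- t) (y i))) = 0"
    if "0 \<le> lam" "0 \<le> mu" for lam mu
  proof -
    have "cinner (Ms lam (transl mu (transl (- t) (x i)))) (transl (- t) (y i))
        = cnj (exp (- \<i> * complex_of_real (lam * t))) * cinner (Ms lam (transl mu (x i))) (y i)" for i
      unfolding adjoint_pairD[OF transl_adjoint[of t], symmetric] Ms_transl transl_transl cinner_scale_left by simp
    then show ?thesis using * that by (simp only: sum_distrib_left[symmetric]) simp
  qed
  then have "(\<Sum>i<n. cinner (A (transl (- t) (x i))) (transl (- t) (y i))) = 0"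
    by (intro assms[unfolded bipolar_def, rule_format])
  then show "(\<Sum>i<n. cinner ((transl t o\<^sub>L A o\<^sub>L transl (- t)) (x i)) (y i)) = 0"
    by (simp add: adjoint_pairD[OF transl_adjoint])
qed

text \<open>Both factors are weak integrals over nonnegative parameters. An annihilating functional
  therefore vanishes under the integral sign, first for the modulations at fixed \<open>t\<close>,
  then for the translations.\<close>

lemma bipolar_Mr_Gr:
  assumes "0 < a" "0 < b" shows "bipolar (Mr b o\<^sub>L Gr a)"
  unfolding bipolar_def
proof (intro allI impI)
  fix n :: nat and x y
  assume *: "\<forall>lam\<ge>0. \<forall>mu\<ge>0. (\<Sum>i<n. cinner (Ms lam (transl mu (x i))) (y i)) = 0"
  have adj: "adjoint_pair (Mr b) (Mr' b)" using resolvent_family_Mr assms by (simp add: resolvent_family_def)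
  have intM: "integrable lborel (\<lambda>s. complex_of_real (expk b s) * cinner (Ms s v) w)" for v w
  proof (rule Bochner_Integration.integrable_bound[of _ "\<lambda>s. expk b s * (norm v * norm w)"])
    show "integrable lborel (\<lambda>s. expk b s * (norm v * norm w))"
      using expk_integral[OF assms(2)] by (simp add: has_bochner_integral_iff)
    obtain f g where fg: "f \<in> L2" "v = cls f" "g \<in> L2" "w = cls g" by (metis l2_cases)
    note [measurable] = L2_measurable[OF fg(1)] L2_measurable[OF fg(3)]
    have "cinner (Ms s v) w = (LINT u|lborel. cnj (exp (\<i> * complex_of_real (s * u)) * f u) * g u)" for s
      using fg L2_bm_mult[OF bm_exp fg(1), of s] by (simp only: Ms_def bmult_cls[OF bm_exp] cinner_cls l2inner_def)
    then show "(\<lambda>s. complex_of_real (expk b s) * cinner (Ms s v) w) \<in> borel_measurable lborel" by simp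
    have "norm (Ms s) \<le> 1" for s unfolding Ms_def by (rule norm_bmult_le[OF bm_exp]) (simp add: norm_exp_eq_Re)
    then have "cmod (cinner (Ms s v) w) \<le> norm v * norm w" for s
      by (intro order_trans[OF norm_cinner_le] mult_right_mono order_trans[OF norm_blinfun] mult_left_le_one_le) auto
    then show "AE s in lborel. norm (complex_of_real (expk b s) * cinner (Ms s v) w) \<le> norm (expk b s * (norm v * norm w))"
      using expk_nonneg[OF assms(2)] by (intro AE_I2) (auto simp: norm_mult intro!: mult_left_mono)
  qed
  have z: "(\<Sum>i<n. cinner (transl t (x i)) (Mr' b (y i))) = 0" if "0 \<le> t" for t
  proof -
    have "(\<Sum>i<n. cinner (transl t (x i)) (Mr' b (y i))) = (\<Sum>i<n. (LINT s|lborel. complex_of_real (expk b s) * cinner (Ms s (transl t (x i))) (y i)))"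
      by (simp add: cinner_Mr assms flip: adjoint_pairD[OF adj])
    also have "\<dots> = (LINT s|lborel. (\<Sum>i<n. complex_of_real (expk b s) * cinner (Ms s (transl t (x i))) (y i)))"
      by (rule Bochner_Integration.integral_sum[symmetric]) (rule intM)
    also have "\<dots> = (LINT (s::real)|lborel. 0)"
      using * that by (intro Bochner_Integration.integral_cong refl)
        (auto simp: expk_def indicator_def simp flip: sum_distrib_left)
    finally show ?thesis by simp
  qed
  have "(\<Sum>i<n. cinner ((Mr b o\<^sub>L Gr a) (x i)) (y i)) = (\<Sum>i<n. (LINT t|lborel. complex_of_real (expk a t) * cinner (transl t (x i)) (Mr' b (y i))))"
    by (simp add: adjoint_pairD[OF adj] Gr_def cinner_convl kern_expk assms)
  also have "\<dots> = (LINT t|lborel. (\<Sum>i<n. complex_of_real (expk a t) * cinner (transl t (x i)) (Mr' b (y i))))"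
    by (rule Bochner_Integration.integral_sum[symmetric]) (rule kern_integrable_cinner[OF kern_expk[OF assms(1)]])
  also have "\<dots> = (LINT (t::real)|lborel. 0)"
    using z by (intro Bochner_Integration.integral_cong refl)
      (auto simp: expk_def indicator_def simp flip: sum_distrib_left)
  finally show "(\<Sum>i<n. cinner ((Mr b o\<^sub>L Gr a) (x i)) (y i)) = 0" by simp
qed

text \<open>Instead of the Hahn-Banach theorem: on finitely many pairs of vectors the matrix coefficients can be matched exactly, by finite-dimensional linear algebra.\<close>

lemma finite_dim_bipolar:
  fixes W :: "(nat \<Rightarrow> complex) set"
  assumes "(\<lambda>_. 0) \<in> W" "\<And>v w. v \<in> W \<Longrightarrow> w \<in> W \<Longrightarrow> (\<lambda>i. v i + w i) \<in> W" "\<And>c w. w \<in> W \<Longrightarrow> (\<lambda>i. c * w i) \<in> W"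
    and "\<And>c. (\<And>w. w \<in> W \<Longrightarrow> (\<Sum>i<n. c i * w i) = 0) \<Longrightarrow> (\<Sum>i<n. c i * v i) = 0"
  shows "\<exists>w\<in>W. \<forall>i<n. w i = v i"
  using assms
proof (induction n arbitrary: W v)
  case 0
  then show ?case by blast
next
  case (Suc n)
  note W0 = Suc.prems(1) and Wadd = Suc.prems(2) and Wsc = Suc.prems(3) and ann = Suc.prems(4)
  show ?case
  proof (cases "\<exists>w\<in>W. w n \<noteq> 0")
    case False
    have "(\<Sum>i<Suc n. (if i = n then 1 else 0) * v i) = 0"
      by (rule ann) (use False in \<open>auto simp: if_distrib[of "\<lambda>x. x * _"] cong: if_cong\<close>)
    then have vn: "v n = 0" by (simp add: if_distrib[of "\<lambda>x. x * _"] cong: if_cong)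
    have "\<exists>w\<in>W. \<forall>i<n. w i = v i"
    proof (rule Suc.IH[OF W0 Wadd Wsc])
      fix c assume c: "\<And>w. w \<in> W \<Longrightarrow> (\<Sum>i<n. c i * w i) = 0"
      have "(\<Sum>i<Suc n. c i * v i) = 0" by (rule ann) (use c False in auto)
      then show "(\<Sum>i<n. c i * v i) = 0" by (simp add: vn)
    qed
    then show ?thesis using False vn by (metis less_Suc_eq)
  next
    case True
    then obtain w1 where w1: "w1 \<in> W" "w1 n \<noteq> 0" by blast
    define w0 where "w0 i = (1 / w1 n) * w1 i" for i
    have w0: "w0 \<in> W" "w0 n = 1"
      using Wsc[OF w1(1), of "1 / w1 n"] w1(2) by (simp_all add: w0_def[abs_def])
    define W' where "W' = {w \<in> W. w n = 0}"
    define v' where "v' i = v i - v n * w0 i" for i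
    have "\<exists>w\<in>W'. \<forall>i<n. w i = v' i"
    proof (rule Suc.IH)
      show "(\<lambda>_. 0) \<in> W'" using W0 by (simp add: W'_def)
      show "(\<lambda>i. v i + w i) \<in> W'" if "v \<in> W'" "w \<in> W'" for v w using that Wadd by (simp add: W'_def)
      show "(\<lambda>i. c * w i) \<in> W'" if "w \<in> W'" for c w using that Wsc by (simp add: W'_def)
      fix c assume c: "\<And>w. w \<in> W' \<Longrightarrow> (\<Sum>i<n. c i * w i) = 0"
      \<comment> \<open>The last coefficient is fixed so that the functional kills
        \<open>w0\<close>; then it kills all of \<open>W\<close>, which is spanned by
        \<open>W'\<close> and \<open>w0\<close>.\<close>
      define d where "d i = (if i < n then c i else - (\<Sum>j<n. c j * w0 j))" for i
      have "(\<Sum>i<Suc n. d i * v i) = 0"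
      proof (rule ann)
        fix w assume w: "w \<in> W"
        have "(\<lambda>i. w i + (- w n) * w0 i) \<in> W'"
          using Wadd[OF w Wsc[OF w0(1), of "- w n"]] w0 by (simp add: W'_def)
        from c[OF this] show "(\<Sum>i<Suc n. d i * w i) = 0"
          by (simp add: d_def algebra_simps sum.distrib sum_subtractf sum_distrib_left)
      qed
      then show "(\<Sum>i<n. c i * v' i) = 0"
        by (simp add: d_def v'_def algebra_simps sum.distrib sum_subtractf sum_distrib_left)
    qed
    then obtain w where w: "w \<in> W'" "\<And>i. i < n \<Longrightarrow> w i = v' i" by blast
    show ?thesis
    proof (rule bexI)
      show "(\<lambda>i. w i + v n * w0 i) \<in> W" using w(1) Wadd Wsc[OF w0(1)] by (simp add: W'_def)
      show "\<forall>i<Suc n. w i + v n * w0 i = v i"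
        using w w0 by (auto simp: less_Suc_eq v'_def W'_def)
    qed
  qed
qed

lemma gen_alg_L2: "S \<in> gen_alg \<Longrightarrow> f \<in> L2 \<Longrightarrow> S f \<in> L2"
proof (induction arbitrary: f rule: gen_alg.induct)
  case (gen_M lam)
  then show ?case unfolding Mop_def by (intro L2_bm_mult bm_exp)
next
  case (gen_D mu)
  then show ?case unfolding Dop_def by (simp add: L2_shift)
next
  case (gen_add T S)
  then show ?case unfolding op_add_def by (intro L2_add) auto
next
  case (gen_scale T c)
  then show ?case unfolding op_scale_def by (intro L2_scale) auto
qed simp

lemma cls_Mop: "f \<in> L2 \<Longrightarrow> cls (Mop s f) = Ms s (cls f)"
  unfolding Ms_def Mop_def by (simp only: bmult_cls[OF bm_exp])

lemma cls_Dop: "f \<in> L2 \<Longrightarrow> cls (Dop t f) = transl t (cls f)"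
  unfolding Dop_def by (simp only: transl_cls)

lemma bipolar_imp_Ap:
  assumes A: "bipolar A" "clinear_op A" shows "op_of A \<in> Ap"
  unfolding Ap_def wot_closure_def
proof (intro CollectI conjI bop_op_of[OF A(2)] allI impI, elim conjE)
  fix F :: "(fn \<times> fn) set" and e :: real
  assume F: "finite F" "F \<subseteq> L2 \<times> L2" and e: "0 < e"
  obtain p :: "nat \<Rightarrow> fn \<times> fn" and n where p: "F = p ` {i. i < n}"
    using finite_imp_nat_seg_image_inj_on[OF F(1)] by blast
  define f g where "f i = fst (p i)" and "g i = snd (p i)" for i
  have fg: "f i \<in> L2" "g i \<in> L2" if "i < n" for i
  proof -
    have "p i \<in> L2 \<times> L2" using F(2) p that by blast
    then show "f i \<in> L2" "g i \<in> L2" by (auto simp: f_def g_def mem_Times_iff)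
  qed
  \<comment> \<open>The attainable vectors of matrix coefficients on the pairs in \<open>F\<close>,
    padded with zeros from \<open>n\<close> on. They form a linear space, so exact interpolation
    applies and the tolerance \<open>e\<close> is met with error 0.\<close>
  define W where "W = (\<lambda>S i. if i < n then l2inner (S (f i)) (g i) else 0) ` gen_alg"
  have WI: "w \<in> W" if "S \<in> gen_alg" "\<And>i. w i = (if i < n then l2inner (S (f i)) (g i) else 0)" for S w
    unfolding W_def using that by (intro image_eqI[of _ _ S]) auto
  have add: "(\<lambda>i. v i + w i) \<in> W" if "v \<in> W" "w \<in> W" for v w
  proof -
    from that obtain S S' where S: "S \<in> gen_alg" "S' \<in> gen_alg"
      "v = (\<lambda>i. if i < n then l2inner (S (f i)) (g i) else 0)" "w = (\<lambda>i. if i < n then l2inner (S' (f i)) (g i) else 0)"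
      by (auto simp: W_def)
    show ?thesis
    proof (rule WI[OF gen_add[OF S(1,2)]])
      fix i
      show "v i + w i = (if i < n then l2inner (op_add S S' (f i)) (g i) else 0)"
        using S fg[of i] by (auto simp: op_add_def gen_alg_L2 L2_add cinner_add_left simp flip: cinner_cls cls_add)
    qed
  qed
  have scale: "(\<lambda>i. c * w i) \<in> W" if "w \<in> W" for c w
  proof -
    from that obtain S where S: "S \<in> gen_alg" "w = (\<lambda>i. if i < n then l2inner (S (f i)) (g i) else 0)"
      by (auto simp: W_def)
    show ?thesis
    \<comment> \<open>The conjugate appears because \<open>l2inner\<close> is antilinear in its
      first argument, where the operator stands.\<close>
    proof (rule WI[OF gen_scale[OF S(1), of "cnj c"]])
      fix i
      show "c * w i = (if i < n then l2inner (op_scale (cnj c) S (f i)) (g i) else 0)"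
        using S fg[of i] by (auto simp: op_scale_def gen_alg_L2 L2_scale cinner_scale_left simp flip: cinner_cls cls_cscale)
    qed
  qed
  have zero: "(\<lambda>_. 0) \<in> W"
  proof -
    have "(\<lambda>i. if i < n then l2inner (Mop 0 (f i)) (g i) else 0) \<in> W"
      by (rule WI[OF gen_M[of 0]]) auto
    from scale[OF this, of 0] show ?thesis by simp
  qed
  have "\<exists>w\<in>W. \<forall>i<n. w i = l2inner (op_of A (f i)) (g i)"
  proof (rule finite_dim_bipolar[OF zero add scale])
    fix c assume c: "\<And>w. w \<in> W \<Longrightarrow> (\<Sum>i<n. c i * w i) = 0"
    \<comment> \<open>The coefficients are absorbed into the second vectors, which turns a linear
      functional on coordinates into a sum of matrix coefficients as in
      \<open>bipolar\<close>.\<close>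
    have "(\<Sum>i<n. cinner (A (cls (f i))) (c i *\<^sub>C cls (g i))) = 0"
    proof (rule A(1)[unfolded bipolar_def, rule_format])
      fix lam mu :: real assume lm: "0 \<le> lam" "0 \<le> mu"
      have S: "Mop lam \<circ> Dop mu \<in> gen_alg" using lm by (intro gen_mult gen_M gen_D)
      have "cinner (Ms lam (transl mu (cls (f i)))) (c i *\<^sub>C cls (g i)) = c i * (if i < n then l2inner ((Mop lam \<circ> Dop mu) (f i)) (g i) else 0)"
        if "i < n" for i
      proof -
        have "Dop mu (f i) \<in> L2" "Mop lam (Dop mu (f i)) \<in> L2"
          using fg[OF that] gen_alg_L2[OF gen_D[OF lm(2)]] gen_alg_L2[OF gen_M[OF lm(1)]] by auto
        then show ?thesis using fg[OF that] that
          by (simp add: cinner_scale_right cls_Mop cls_Dop flip: cinner_cls)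
      qed
      then have "(\<Sum>i<n. cinner (Ms lam (transl mu (cls (f i)))) (c i *\<^sub>C cls (g i)))
          = (\<Sum>i<n. c i * (if i < n then l2inner ((Mop lam \<circ> Dop mu) (f i)) (g i) else 0))"
        by (intro sum.cong) auto
      also have "\<dots> = 0" by (rule c[OF WI[OF S]]) auto
      finally show "(\<Sum>i<n. cinner (Ms lam (transl mu (cls (f i)))) (c i *\<^sub>C cls (g i))) = 0" .
    qed
    moreover have "cinner (A (cls (f i))) (c i *\<^sub>C cls (g i)) = c i * l2inner (op_of A (f i)) (g i)" if "i < n" for i
      using fg[OF that] by (simp add: cinner_scale_right op_of_L2 flip: cinner_cls)
    ultimately show "(\<Sum>i<n. c i * l2inner (op_of A (f i)) (g i)) = 0" by simp
  qed
  then obtain S where S: "S \<in> gen_alg" "\<And>i. i < n \<Longrightarrow> l2inner (S (f i)) (g i) = l2inner (op_of A (f i)) (g i)"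
    by (auto simp: W_def)
  show "\<exists>B\<in>gen_alg. \<forall>(f, g)\<in>F. cmod (l2inner (op_of A f) g - l2inner (B f) g) < e"
  proof (rule bexI[OF _ S(1)], clarify)
    fix f' g' assume "(f', g') \<in> F"
    then obtain i where "i < n" "p i = (f', g')" using p by force
    then show "cmod (l2inner (op_of A f') g' - l2inner (S f') g') < e"
      using S(2)[of i] e by (simp add: f_def g_def)
  qed
qed

section \<open>Commutators and compactness of products of resolvents\<close>

lemma mphi_diff: "0 < b \<Longrightarrow> cmod (mphi b x - mphi b y) \<le> \<bar>x - y\<bar> / b"
proof -
  assume b: "0 < b"
  have "mphi b x - mphi b y = \<i> * complex_of_real ((x - y) / b) * (mphi b x * mphi b y)"
    unfolding mphi_def using mphi_denom(1)[of "x / b"] mphi_denom(1)[of "y / b"] b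
    by (simp add: divide_simps) (simp add: algebra_simps)
  then have "cmod (mphi b x - mphi b y) = (\<bar>x - y\<bar> / b) * (cmod (mphi b x) * cmod (mphi b y))"
    using b by (simp add: norm_mult norm_divide del: of_real_diff of_real_divide)
  also have "\<dots> \<le> (\<bar>x - y\<bar> / b) * (1 * 1)"
    using b by (intro mult_left_mono mult_mono mphi_le) auto
  finally show ?thesis by simp
qed

text \<open>Moving \<open>Mr b\<close> past a translation by \<open>t\<close> replaces
  \<open>mphi b\<close> by its shift, an error of norm at most t/b by the Lipschitz bound
  \<open>mphi_diff\<close>; averaging against \<open>expk a\<close> replaces \<open>t\<close> by the
  mean 1/a.\<close>

lemma commutator_bound:
  assumes ab: "0 < a" "0 < b"
  shows "norm ((Mr b o\<^sub>L Gr a) - (Gr a o\<^sub>L Mr b)) \<le> 1 / (a * b)"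
proof (rule norm_blinfun_cinner_bound)
  fix x y
  have adj: "adjoint_pair (Mr b) (Mr' b)" using resolvent_family_Mr ab by (simp add: resolvent_family_def)
  note k = kern_expk[OF ab(1)]
  have "cinner (((Mr b o\<^sub>L Gr a) - (Gr a o\<^sub>L Mr b)) x) y = cinner (Gr a x) (Mr' b y) - cinner (Gr a (Mr b x)) y"
    by (simp add: blinfun.diff_left cinner_diff_left adjoint_pairD[OF adj])
  also have "\<dots> = (LINT t|lborel. complex_of_real (expk a t) * cinner (transl t x) (Mr' b y) - complex_of_real (expk a t) * cinner (transl t (Mr b x)) y)"
    unfolding Gr_def cinner_convl[OF k]
    by (rule Bochner_Integration.integral_diff[symmetric]; rule kern_integrable_cinner[OF k])
  also have "cmod \<dots> \<le> (LINT t|lborel. (t * expk a t) * (1 / b * norm x * norm y))"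
  proof (rule Bochner_Integration.integral_norm_bound_integral)
    show "integrable lborel (\<lambda>t. complex_of_real (expk a t) * cinner (transl t x) (Mr' b y) - complex_of_real (expk a t) * cinner (transl t (Mr b x)) y)"
      by (intro Bochner_Integration.integrable_diff kern_integrable_cinner k)
    show "integrable lborel (\<lambda>t. (t * expk a t) * (1 / b * norm x * norm y))"
      using expk_moment[OF ab(1)] by (simp add: has_bochner_integral_iff)
    fix t
    show "cmod (complex_of_real (expk a t) * cinner (transl t x) (Mr' b y) - complex_of_real (expk a t) * cinner (transl t (Mr b x)) y)
       \<le> (t * expk a t) * (1 / b * norm x * norm y)"
    proof (cases "0 \<le> t")
      case False
      then show ?thesis by (simp add: expk_def)
    next
      case True
      let ?\<phi> = "\<lambda>u. mphi b u - mphi b (u - t)"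
      have bm: "bm ?\<phi>" by (intro bm_diff bm_mphi bm_shift)
      have "cinner (transl t x) (Mr' b y) - cinner (transl t (Mr b x)) y = cinner (bmult ?\<phi> (transl t x)) y"
        unfolding adjoint_pairD[OF adj, symmetric] cinner_diff_left[symmetric]
        by (simp add: Mr_def transl_bmult bm_mphi bmult_diff bm_shift blinfun.diff_left)
      moreover have "norm (bmult ?\<phi>) \<le> t / b"
        using mphi_diff[OF ab(2)] True by (intro norm_bmult_le[OF bm]) (metis abs_of_nonneg diff_diff_eq2 add_diff_cancel_left')
      then have "norm (bmult ?\<phi> (transl t x)) \<le> t / b * norm x"
        using norm_blinfun[of "bmult ?\<phi>" "transl t x"] mult_right_mono[of "norm (bmult ?\<phi>)" "t / b" "norm x"] by simp
      then have "cmod (cinner (bmult ?\<phi> (transl t x)) y) \<le> t / b * norm x * norm y"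
        by (intro order_trans[OF norm_cinner_le] mult_right_mono) auto
      ultimately have "expk a t * cmod (cinner (transl t x) (Mr' b y) - cinner (transl t (Mr b x)) y) \<le> expk a t * (t / b * norm x * norm y)"
        using expk_nonneg[OF ab(1)] by (intro mult_left_mono) auto
      then show ?thesis
        using expk_nonneg[OF ab(1), of t] by (simp add: norm_mult ac_simps flip: right_diff_distrib)
    qed
  qed
  also have "\<dots> = 1 / (a * b) * norm x * norm y"
    using expk_moment[OF ab(1)] by (simp add: has_bochner_integral_iff)
  finally show "cmod (cinner (((Mr b o\<^sub>L Gr a) - (Gr a o\<^sub>L Mr b)) x) y) \<le> 1 / (a * b) * norm x * norm y" .
qed (use ab in simp)

lemma mphi_L2: "0 < b \<Longrightarrow> mphi b \<in> L2"
proof -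
  assume b: "0 < b"
  have "integrable lborel (\<lambda>x::real. inverse (1 + x\<^sup>2))"
    using integrable_inverse_1_plus_square by (simp add: set_integrable_def einterval_eq_UNIV)
  from lborel_integrable_real_affine[OF this, of "1 / b" 0] b
  have i: "integrable lborel (\<lambda>x::real. inverse (1 + (x / b)\<^sup>2))" by simp
  have "(cmod (mphi b x))\<^sup>2 = inverse (1 + (x / b)\<^sup>2)" for x
    unfolding mphi_def by (simp add: norm_divide power_divide cmod_power2 inverse_eq_divide)
  then show ?thesis using i bm_measurable[OF bm_mphi] by (simp add: L2_def)
qed

text \<open>The vector representing evaluation at \<open>x\<close> after convolution with
  \<open>expk a\<close>, see \<open>conv_expk\<close>. Bounds and equicontinuity of convolutions
  thereby become statements about one curve in the Hilbert space.\<close>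

definition expk_at :: "real \<Rightarrow> real \<Rightarrow> l2" where
  "expk_at a x = cls (\<lambda>t. complex_of_real (expk a (x - t)))"

lemma expk_L2:
  assumes a: "0 < a" shows "(\<lambda>t. complex_of_real (expk a (x - t))) \<in> L2"
proof -
  have "integrable lborel (\<lambda>t. a\<^sup>2 * (exp (- (2 * a) * t) * indicator {0..} t))"
    using integral_exp_Ici[of "2 * a" 0] a by (simp add: has_bochner_integral_iff)
  moreover have "a\<^sup>2 * (exp (- (2 * a) * t) * indicator {0..} t) = (expk a t)\<^sup>2" for t
    by (auto simp: expk_def indicator_def power2_eq_square simp flip: exp_add)
  ultimately have "integrable lborel (\<lambda>t. (expk a t)\<^sup>2)" by (simp only:)
  from lborel_integrable_real_affine[OF this, of "-1" x]
  show ?thesis by (simp add: L2_def)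
qed

lemma expk_at_inner:
  assumes a: "0 < a" shows "cinner (expk_at a x) (expk_at a y) = complex_of_real (a / 2 * exp (- a * \<bar>x - y\<bar>))"
proof -
  have *: "(LINT t|lborel. expk a (x - t) * expk a (y - t)) = a / 2 * exp (- a * (y - x))" if "x \<le> y" for x y
  proof -
    have "(LINT t|lborel. expk a (x - t) * expk a (y - t)) = (LINT s|lborel. expk a s * expk a (y - x + s))"
      using lborel_integral_real_affine[of "-1" "\<lambda>s. expk a s * expk a (y - x + s)" x] by (simp add: algebra_simps)
    also have "\<dots> = (LINT s|lborel. a\<^sup>2 * exp (- a * (y - x)) * (exp (- (2 * a) * s) * indicator {0..} s))"
      using that by (intro Bochner_Integration.integral_cong refl)
        (auto simp: expk_def indicator_def power2_eq_square algebra_simps simp flip: exp_add)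
    also have "\<dots> = a\<^sup>2 * exp (- a * (y - x)) * (1 / (2 * a))"
      using integral_exp_Ici[of "2 * a" 0] a by (simp add: has_bochner_integral_iff)
    finally show ?thesis using a by (simp add: power2_eq_square)
  qed
  have "cinner (expk_at a x) (expk_at a y) = complex_of_real (LINT t|lborel. expk a (x - t) * expk a (y - t))"
    unfolding expk_at_def using a by (simp add: cinner_cls expk_L2 l2inner_def flip: of_real_mult)
  also have "(LINT t|lborel. expk a (x - t) * expk a (y - t)) = a / 2 * exp (- a * \<bar>x - y\<bar>)"
  proof (cases "x \<le> y")
    case True then show ?thesis using *[OF True] by simp
  next
    case False
    then show ?thesis using *[of y x] by (simp add: mult.commute)
  qed
  finally show ?thesis .
qed

lemma norm_expk_at_diff:
  assumes a: "0 < a" shows "(norm (expk_at a x - expk_at a y))\<^sup>2 = a * (1 - exp (- a * \<bar>x - y\<bar>))"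
proof -
  have "(norm (expk_at a x - expk_at a y))\<^sup>2 = Re (cinner (expk_at a x - expk_at a y) (expk_at a x - expk_at a y))" by (simp add: cinner_self)
  also have "\<dots> = a * (1 - exp (- a * \<bar>x - y\<bar>))"
    using a by (simp add: cinner_diff_left cinner_diff_right expk_at_inner abs_minus_commute algebra_simps)
  finally show ?thesis .
qed

lemma conv_expk: "0 < a \<Longrightarrow> f \<in> L2 \<Longrightarrow> conv (expk a) f x = cinner (expk_at a x) (cls f)"
proof -
  assume a: "0 < a" "f \<in> L2"
  have "conv (expk a) f x = (LINT t|lborel. complex_of_real (expk a (x - t)) * f t)"
    unfolding conv_def
    using lborel_integral_real_affine[of "-1" "\<lambda>t. complex_of_real (expk a (x - t)) * f t" x] by simp
  then show ?thesis using a by (simp add: expk_at_def cinner_cls expk_L2 l2inner_def)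
qed

lemma isCont_expk_at: assumes a: "0 < a" shows "isCont (expk_at a) x"
proof -
  have "(\<lambda>y. a * (1 - exp (- a * \<bar>y - x\<bar>))) \<midarrow>x\<rightarrow> a * (1 - exp (- a * \<bar>x - x\<bar>))"
    by (intro tendsto_intros)
  then have "(\<lambda>y. (norm (expk_at a y - expk_at a x))\<^sup>2) \<midarrow>x\<rightarrow> 0" by (simp add: norm_expk_at_diff a)
  then have "(\<lambda>y. norm (expk_at a y - expk_at a x)) \<midarrow>x\<rightarrow> 0"
    using tendsto_real_sqrt by fastforce
  then have "(\<lambda>y. expk_at a y - expk_at a x) \<midarrow>x\<rightarrow> 0" by (rule tendsto_norm_zero_cancel)
  then show ?thesis unfolding isCont_def by (rule LIM_zero_cancel)
qed

text \<open>The functions \<open>Gr a (u n)\<close> are uniformly bounded and equicontinuous, so a subsequence converges pointwise; the decay of \<open>mphi b\<close> turns this into convergence in norm by dominated convergence.\<close>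

lemma compact_Mr_Gr:
  assumes ab: "0 < a" "0 < b" shows "compact_bl (Mr b o\<^sub>L Gr a)"
  unfolding compact_bl_def
proof (intro allI impI)
  fix u :: "nat \<Rightarrow> l2" assume "bounded (range u)"
  then obtain M where M: "\<And>n. norm (u n) \<le> M" "0 < M" unfolding bounded_pos by auto
  define C where "C = sqrt (a / 2) * M"
  have nk: "norm (expk_at a x) = sqrt (a / 2)" for x
  proof -
    have "complex_of_real ((norm (expk_at a x))\<^sup>2) = complex_of_real (a / 2)"
      unfolding cinner_self[symmetric] expk_at_inner[OF ab(1)] by simp
    then have "(norm (expk_at a x))\<^sup>2 = a / 2" by (simp only: of_real_eq_iff)
    then show ?thesis by (metis norm_ge_zero real_sqrt_unique)
  qed
  define \<gamma> where "\<gamma> n x = cinner (expk_at a x) (u n)" for n x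
  have bd: "cmod (\<gamma> n x) \<le> C" for n x
    unfolding \<gamma>_def C_def nk[of x, symmetric] by (intro order_trans[OF norm_cinner_le] mult_left_mono M norm_ge_zero)
  obtain r :: "nat \<Rightarrow> nat" where r: "strict_mono r" "\<And>x. x \<in> \<rat> \<Longrightarrow> \<exists>l. (\<lambda>n. \<gamma> (r n) x) \<longlonglongrightarrow> l"
    using function_convergent_subsequence[OF countable_rat, of \<gamma> C] bd by blast
  have conv: "convergent (\<lambda>n. \<gamma> (r n) x)" for x
  proof (rule Cauchy_convergent, rule metric_CauchyI)
    fix e :: real assume e: "0 < e"
    have "\<forall>\<^sub>F y in at x. dist (expk_at a y) (expk_at a x) < e / (3 * M)"
      using isCont_expk_at[OF ab(1), of x] e M(2) unfolding isCont_def by (intro tendstoD) auto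
    then obtain d where d: "d > 0" "\<And>y. y \<noteq> x \<Longrightarrow> dist y x < d \<Longrightarrow> dist (expk_at a y) (expk_at a x) < e / (3 * M)"
      unfolding eventually_at by blast
    obtain q where q: "q \<in> \<rat>" "x < q" "q < x + d" using Rats_dense_in_real[of x "x + d"] d(1) by auto
    have near: "dist (\<gamma> n q) (\<gamma> n x) < e / 3" for n
    proof -
      have "dist (\<gamma> n q) (\<gamma> n x) \<le> norm (expk_at a q - expk_at a x) * norm (u n)"
        unfolding \<gamma>_def dist_norm cinner_diff_left[symmetric] by (rule norm_cinner_le)
      also have "\<dots> \<le> norm (expk_at a q - expk_at a x) * M" by (intro mult_left_mono M) auto
      also have "\<dots> < e / (3 * M) * M"
        using d(2)[of q] q M(2) by (intro mult_strict_right_mono) (auto simp: dist_norm)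
      finally show ?thesis using M(2) by simp
    qed
    have "Cauchy (\<lambda>n. \<gamma> (r n) q)" using r(2)[OF q(1)] LIMSEQ_imp_Cauchy by blast
    then obtain N where N: "\<And>m n. m \<ge> N \<Longrightarrow> n \<ge> N \<Longrightarrow> dist (\<gamma> (r m) q) (\<gamma> (r n) q) < e / 3"
      using e unfolding Cauchy_def by (metis divide_pos_pos zero_less_numeral)
    have "dist (\<gamma> (r m) x) (\<gamma> (r n) x) < e" if "m \<ge> N" "n \<ge> N" for m n
    proof -
      have "dist (\<gamma> (r m) x) (\<gamma> (r n) x) \<le> dist (\<gamma> (r m) x) (\<gamma> (r m) q)
          + (dist (\<gamma> (r m) q) (\<gamma> (r n) q) + dist (\<gamma> (r n) q) (\<gamma> (r n) x))"
        by (meson add_left_mono dist_triangle order_trans)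
      then show ?thesis using N[OF that] near[of "r m"] near[of "r n"] by (simp add: dist_commute)
    qed
    then show "\<exists>N. \<forall>m\<ge>N. \<forall>n\<ge>N. dist (\<gamma> (r m) x) (\<gamma> (r n) x) < e" by blast
  qed
  define g where "g x = lim (\<lambda>n. \<gamma> (r n) x)" for x
  have lim: "(\<lambda>n. \<gamma> (r n) x) \<longlonglongrightarrow> g x" for x using conv by (simp add: g_def convergent_LIMSEQ_iff)
  have gC: "cmod (g x) \<le> C" for x
    using Lim_bounded[OF tendsto_norm[OF lim[of x]]] bd by blast
  have \<gamma>eq: "\<gamma> n = conv (expk a) (rep (u n))" for n
    using ab by (simp add: fun_eq_iff \<gamma>_def conv_expk rep_L2)
  have \<gamma>L2: "\<gamma> n \<in> L2" for n unfolding \<gamma>eq by (rule conv_bound[OF kern_expk[OF ab(1)] rep_L2])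
  note [measurable] = L2_measurable[OF \<gamma>L2] bm_measurable[OF bm_mphi]
  have [measurable]: "g \<in> borel_measurable borel"
    unfolding g_def by (rule borel_measurable_lim_metric) auto
  have bg: "bm g" by (rule bmI[OF _ gC]) simp
  have bp: "bm (\<lambda>x. \<gamma> (r n) x)" for n by (rule bmI[OF _ bd]) simp
  \<comment> \<open>The roles are exchanged: the convolutions act as uniformly bounded multipliers
    on the fixed square-integrable function \<open>mphi b\<close>.\<close>
  have "(\<lambda>n. bmult (\<gamma> (r n)) (cls (mphi b))) \<longlonglongrightarrow> bmult g (cls (mphi b))"
    by (rule bmult_tendsto[OF bp bg bd lim])
  moreover have "bmult (\<gamma> (r n)) (cls (mphi b)) = (Mr b o\<^sub>L Gr a) (u (r n))" for n
  proof -
    have "(Mr b o\<^sub>L Gr a) (u (r n)) = Mr b (Gr a (cls (rep (u (r n)))))" by simp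
    also have "\<dots> = Mr b (cls (\<gamma> (r n)))"
      unfolding Gr_def by (simp only: convl_cls[OF kern_expk[OF ab(1)] rep_L2] \<gamma>eq)
    also have "\<dots> = cls (\<lambda>x. mphi b x * \<gamma> (r n) x)"
      unfolding Mr_def by (rule bmult_cls[OF bm_mphi \<gamma>L2])
    also have "\<dots> = bmult (\<gamma> (r n)) (cls (mphi b))"
      by (simp add: bmult_cls bp mphi_L2 ab mult.commute)
    finally show ?thesis by simp
  qed
  ultimately show "\<exists>r::nat \<Rightarrow> nat. strict_mono r \<and> convergent (\<lambda>n. (Mr b o\<^sub>L Gr a) (u (r n)))"
    using r(1) by (auto simp: convergent_def)
qed

section \<open>Compact elements that are almost selfadjoint\<close>

text \<open>The base is the smallest ratio that \<open>resolvent_average\<close> admits. The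
  exponents start at 1, so every parameter is at least \<open>8 * real N + 1\<close>; this makes the
  average close to the identity on the range of \<open>R 1\<close> and keeps commutators of order
  1/N.\<close>

definition ravg :: "(real \<Rightarrow> l2 \<Rightarrow>\<^sub>L l2) \<Rightarrow> nat \<Rightarrow> l2 \<Rightarrow>\<^sub>L l2" where
  "ravg R N = (1 / real N) *\<^sub>R (\<Sum>j<N. R ((8 * real N + 1) ^ Suc j))"

lemma norm_triangle3: "norm (a + b + c) \<le> norm a + norm b + norm c"
  for a :: "'a::real_normed_vector"
  by (meson add_right_mono norm_triangle_ineq order_trans)

lemma ravg_pow_ge: "8 * real N + 1 \<le> (8 * real N + 1) ^ Suc j"
  using power_increasing[of 1 "Suc j" "8 * real N + 1"] by simp

lemma ravg_pow_pos: "0 < (8 * real N + 1 :: real) ^ Suc j"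
  by (rule zero_less_power) simp

lemma norm_average_le:
  fixes f :: "nat \<Rightarrow> 'a::real_normed_vector"
  assumes "0 < N" "\<And>j. j < N \<Longrightarrow> norm (f j) \<le> c"
  shows "norm ((1 / real N) *\<^sub>R (\<Sum>j<N. f j)) \<le> c"
proof -
  have "norm (\<Sum>j<N. f j) \<le> (\<Sum>j<N. c)" using assms(2) by (intro order_trans[OF norm_sum] sum_mono) auto
  then have "norm (\<Sum>j<N. f j) \<le> real N * c" by simp
  then show ?thesis using assms(1) by (simp add: field_simps)
qed

lemma resolvent_familyD:
  assumes "resolvent_family R R'" "0 < a"
  shows "adjoint_pair (R a) (R' a)" "norm (R a) \<le> 1" "norm (R' a) \<le> 1"
  using assms norm_adjoint[of "R a" "R' a"] by (auto simp: resolvent_family_def)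

lemma ravg_adjoint: "resolvent_family R R' \<Longrightarrow> adjoint_pair (ravg R N) (ravg R' N)"
  unfolding ravg_def by (intro adjoint_pair_scaleR adjoint_pair_sum resolvent_familyD(1) ravg_pow_pos)

lemma ravg_norm:
  assumes "resolvent_family R R'" "0 < N" shows "norm (ravg R N) \<le> 1" "norm (ravg R' N) \<le> 1"
  unfolding ravg_def
  by (intro norm_average_le assms(2) resolvent_familyD(2,3)[OF assms(1) ravg_pow_pos])+

lemma ravg_skew:
  assumes "resolvent_family R R'" "0 < N"
  shows "norm (ravg R N - ravg R' N) \<le> sqrt (5 / real N)"
proof -
  have "ravg R N - ravg R' N = (1 / real N) *\<^sub>R (\<Sum>j<N. R ((8 * real N + 1) ^ Suc j) - R' ((8 * real N + 1) ^ Suc j))"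
    by (simp only: ravg_def sum_subtractf scaleR_right_diff_distrib)
  then have "norm (ravg R N - ravg R' N) = (1 / real N) * norm (\<Sum>j<N. R ((8 * real N + 1) ^ Suc j) - R' ((8 * real N + 1) ^ Suc j))"
    by (simp only: norm_scaleR) simp
  also have "\<dots> \<le> (1 / real N) * sqrt (5 * real N)"
    by (intro mult_left_mono resolvent_average assms) auto
  also have "\<dots> = sqrt (5 / real N)"
  proof (rule real_sqrt_unique[symmetric])
    show "((1 / real N) * sqrt (5 * real N))\<^sup>2 = 5 / real N"
      using assms(2) by (simp add: power_mult_distrib power_divide power2_eq_square)
  qed simp
  finally show ?thesis .
qed

text \<open>By the resolvent identity \<open>(R a - 1) R 1 = (R a - R 1) / (1 - a)\<close>.\<close>

lemma ravg_approx:
  assumes RF: "resolvent_family R R'" and N: "0 < N"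
  shows "norm (ravg R N (R 1 v) - R 1 v) \<le> norm v / real N"
proof -
  have "ravg R N (R 1 v) - R 1 v = (1 / real N) *\<^sub>R (\<Sum>j<N. R ((8 * real N + 1) ^ Suc j) (R 1 v) - R 1 v)"
    using N by (simp add: ravg_def blinfun.scaleR_left blinfun.sum_left sum_subtractf scaleR_right_diff_distrib sum_constant_scaleR del: power_Suc)
  also have "norm \<dots> \<le> norm v / real N"
  proof (rule norm_average_le[OF N])
    fix j
    define a where "a = (8 * real N + 1) ^ Suc j"
    have a: "8 * real N + 1 \<le> a" unfolding a_def by (rule ravg_pow_ge)
    have N1: "1 \<le> real N" using N by simp
    have a1: "0 < a" "a \<noteq> 1" using a N1 by linarith+
    have "R a o\<^sub>L R 1 = (1 / (1 - a)) *\<^sub>R (1 *\<^sub>R R a - a *\<^sub>R R 1)"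
      using RF a1 unfolding resolvent_family_def by auto
    then have "R a (R 1 v) = (1 / (1 - a)) *\<^sub>R (R a v - a *\<^sub>R R 1 v)"
      by (simp add: blinfun.diff_left blinfun.scaleR_left fun_eq_iff flip: blinfun_apply_blinfun_compose)
    also have "\<dots> - R 1 v = (1 / (1 - a)) *\<^sub>R (R a v - R 1 v)"
    proof -
      have "(1 / (1 - a)) *\<^sub>R (R a v - R 1 v) + R 1 v = (1 / (1 - a)) *\<^sub>R (R a v - R 1 v + (1 - a) *\<^sub>R R 1 v)"
        using a1 by (simp add: scaleR_right_distrib)
      also have "R a v - R 1 v + (1 - a) *\<^sub>R R 1 v = R a v - a *\<^sub>R R 1 v"
        by (simp add: scaleR_left_diff_distrib)
      finally show ?thesis by (simp add: algebra_simps)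
    qed
    finally have eq: "R a (R 1 v) - R 1 v = (1 / (1 - a)) *\<^sub>R (R a v - R 1 v)" .
    have n1: "norm (R c v) \<le> norm v" if "0 < c" for c
      using norm_blinfun[of "R c" v] resolvent_familyD(2)[OF RF that] mult_right_mono[of "norm (R c)" 1 "norm v"] by simp
    have "norm (R a v - R 1 v) \<le> 2 * norm v"
      using norm_triangle_ineq4[of "R a v" "R 1 v"] n1[OF a1(1)] n1[of 1] by simp
    then have "norm (R a (R 1 v) - R 1 v) \<le> (1 / (a - 1)) * (2 * norm v)"
      unfolding eq norm_scaleR using a N1 by (intro mult_mono) (auto simp: abs_divide)
    also have "\<dots> \<le> (1 / (2 * real N)) * (2 * norm v)"
      using a N1 by (intro mult_right_mono divide_left_mono) auto
    finally show "norm (R ((8 * real N + 1) ^ Suc j) (R 1 v) - R 1 v) \<le> norm v / real N"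
      unfolding a_def by simp
  qed
  finally show ?thesis .
qed

lemma ravg_commutator:
  assumes N: "0 < N" and a: "1 \<le> a"
  shows "norm ((ravg Mr N o\<^sub>L Gr a) - (Gr a o\<^sub>L ravg Mr N)) \<le> 1 / real N"
proof -
  have "(ravg Mr N o\<^sub>L Gr a) - (Gr a o\<^sub>L ravg Mr N)
      = (1 / real N) *\<^sub>R (\<Sum>j<N. (Mr ((8 * real N + 1) ^ Suc j) o\<^sub>L Gr a) - (Gr a o\<^sub>L Mr ((8 * real N + 1) ^ Suc j)))"
    by (simp only: ravg_def compose.scaleR_left compose.scaleR_right compose.sum_left compose.sum_right sum_subtractf scaleR_right_diff_distrib)
  also have "norm \<dots> \<le> 1 / real N"
  proof (rule norm_average_le[OF N])
    fix j
    let ?b = "(8 * real N + 1) ^ Suc j"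
    have "norm ((Mr ?b o\<^sub>L Gr a) - (Gr a o\<^sub>L Mr ?b)) \<le> 1 / (a * ?b)"
      using a by (intro commutator_bound ravg_pow_pos) auto
    also have "\<dots> \<le> 1 / real N"
    proof (rule divide_left_mono)
      have "real N \<le> 1 * ?b" using ravg_pow_ge[of N j] by linarith
      also have "\<dots> \<le> a * ?b" using a ravg_pow_pos[of N j] by (intro mult_right_mono) auto
      finally show "real N \<le> a * ?b" .
      show "0 < a * ?b * real N" using a N ravg_pow_pos[of N j] by simp
    qed simp
    finally show "norm ((Mr ?b o\<^sub>L Gr a) - (Gr a o\<^sub>L Mr ?b)) \<le> 1 / real N" .
  qed
  finally show ?thesis .
qed

text \<open>The left factor localizes in position and the right one in frequency; only their product
  is compact.\<close>

definition mixed :: "nat \<Rightarrow> l2 \<Rightarrow>\<^sub>L l2" where "mixed N = ravg Mr N o\<^sub>L ravg Gr N"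
definition mixed' :: "nat \<Rightarrow> l2 \<Rightarrow>\<^sub>L l2" where "mixed' N = ravg Gr' N o\<^sub>L ravg Mr' N"

lemma mixed_adjoint: "adjoint_pair (mixed N) (mixed' N)"
  unfolding mixed_def mixed'_def
  by (intro adjoint_pair_compose ravg_adjoint resolvent_family_Mr resolvent_family_Gr)

lemma mixed_expand:
  "mixed N = (1 / real N * (1 / real N)) *\<^sub>R (\<Sum>i<N. \<Sum>j<N. Mr ((8 * real N + 1) ^ Suc i) o\<^sub>L Gr ((8 * real N + 1) ^ Suc j))"
proof -
  have "mixed N = (1 / real N * (1 / real N)) *\<^sub>R ((\<Sum>i<N. Mr ((8 * real N + 1) ^ Suc i)) o\<^sub>L (\<Sum>j<N. Gr ((8 * real N + 1) ^ Suc j)))"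
    by (simp only: mixed_def ravg_def compose.scaleR_left compose.scaleR_right scaleR_scaleR)
  then show ?thesis by (subst (asm) compose.sum_left) (simp only: compose.sum_right)
qed

lemma mixed_compact: "compact_bl (mixed N)"
  unfolding mixed_expand by (intro compact_bl_scaleR compact_bl_sum compact_Mr_Gr ravg_pow_pos)

lemma mixed_bipolar: "bipolar (mixed N)"
  unfolding mixed_expand by (intro bipolar_scaleR bipolar_sum bipolar_Mr_Gr ravg_pow_pos)

lemma mixed_norm: "0 < N \<Longrightarrow> norm (mixed N) \<le> 1"
  unfolding mixed_def using ravg_norm(1)[OF resolvent_family_Mr] ravg_norm(1)[OF resolvent_family_Gr]
  by (intro order_trans[OF norm_blinfun_compose] mult_le_one) auto

lemma ravg_Mr_Gr_commutator:
  assumes N: "0 < N"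
  shows "norm ((ravg Mr N o\<^sub>L ravg Gr N) - (ravg Gr N o\<^sub>L ravg Mr N)) \<le> 1 / real N"
proof -
  have "(ravg Mr N o\<^sub>L ravg Gr N) - (ravg Gr N o\<^sub>L ravg Mr N)
      = (1 / real N) *\<^sub>R (\<Sum>j<N. (ravg Mr N o\<^sub>L Gr ((8 * real N + 1) ^ Suc j)) - (Gr ((8 * real N + 1) ^ Suc j) o\<^sub>L ravg Mr N))"
    by (simp only: ravg_def[of Gr] compose.scaleR_left compose.scaleR_right compose.sum_left compose.sum_right sum_subtractf scaleR_right_diff_distrib)
  also have "norm \<dots> \<le> 1 / real N"
    using N by (intro norm_average_le ravg_commutator order_trans[OF _ ravg_pow_ge]) auto
  finally show ?thesis .
qed

text \<open>Taking the adjoint reverses the factors, so besides the two small skew parts a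
  commutator of the adjoint averages appears; its norm is that of its own adjoint, the commutator of
  the original averages.\<close>

lemma mixed_skew:
  assumes N: "0 < N" shows "norm (mixed N - mixed' N) \<le> 2 * sqrt (5 / real N) + 1 / real N"
proof -
  let ?H = "ravg Mr N" and ?H' = "ravg Mr' N" and ?G = "ravg Gr N" and ?G' = "ravg Gr' N"
  note RM = resolvent_family_Mr and RG = resolvent_family_Gr
  have adj: "adjoint_pair ((?G o\<^sub>L ?H) - (?H o\<^sub>L ?G)) ((?H' o\<^sub>L ?G') - (?G' o\<^sub>L ?H'))"
    by (intro adjoint_pair_diff adjoint_pair_compose ravg_adjoint RM RG)
  have eq: "mixed N - mixed' N = ((?H - ?H') o\<^sub>L ?G) + (?H' o\<^sub>L (?G - ?G')) + ((?H' o\<^sub>L ?G') - (?G' o\<^sub>L ?H'))"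
    by (simp add: mixed_def mixed'_def compose.diff_left compose.diff_right)
  have "norm (mixed N - mixed' N) \<le> norm ((?H - ?H') o\<^sub>L ?G) + norm (?H' o\<^sub>L (?G - ?G')) + norm ((?H' o\<^sub>L ?G') - (?G' o\<^sub>L ?H'))"
    unfolding eq by (rule norm_triangle3)
  also have "\<dots> \<le> sqrt (5 / real N) * 1 + 1 * sqrt (5 / real N) + 1 / real N"
  proof (intro add_mono)
    show "norm ((?H - ?H') o\<^sub>L ?G) \<le> sqrt (5 / real N) * 1"
      by (intro order_trans[OF norm_blinfun_compose] mult_mono ravg_skew[OF RM N] ravg_norm(1)[OF RG N]) auto
    show "norm (?H' o\<^sub>L (?G - ?G')) \<le> 1 * sqrt (5 / real N)"
      by (intro order_trans[OF norm_blinfun_compose] mult_mono ravg_skew[OF RG N] ravg_norm(2)[OF RM N]) auto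
    show "norm ((?H' o\<^sub>L ?G') - (?G' o\<^sub>L ?H')) \<le> 1 / real N"
      unfolding norm_adjoint[OF adj, symmetric] norm_minus_commute[of "?G o\<^sub>L ?H"] by (rule ravg_Mr_Gr_commutator[OF N])
  qed
  finally show ?thesis by simp
qed

text \<open>Each average is close to the identity only on the range of its own resolvent at 1. The
  vector lies in the range of \<open>Gr 1\<close>; to use that it also comes from
  \<open>Mr 1\<close>, the modulation average is first commuted past \<open>Gr 1\<close>.\<close>

lemma mixed_approx:
  assumes N: "0 < N"
  shows "norm (mixed N (Gr 1 (Mr 1 v)) - Gr 1 (Mr 1 v)) \<le> 3 * norm v / real N"
proof -
  let ?H = "ravg Mr N" and ?G = "ravg Gr N"
  define z where "z = Mr 1 v"
  note RM = resolvent_family_Mr and RG = resolvent_family_Gr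
  have nz: "norm z \<le> norm v"
    unfolding z_def using norm_blinfun[of "Mr 1" v] resolvent_familyD(2)[OF RM, of 1] mult_right_mono[of "norm (Mr 1)" 1 "norm v"] by simp
  have eq: "mixed N (Gr 1 z) - Gr 1 z = ?H (?G (Gr 1 z) - Gr 1 z) + ((?H o\<^sub>L Gr 1) - (Gr 1 o\<^sub>L ?H)) z + Gr 1 (?H z - z)"
    by (simp add: mixed_def blinfun.diff_left blinfun.diff_right)
  have "norm (mixed N (Gr 1 z) - Gr 1 z) \<le> norm (?H (?G (Gr 1 z) - Gr 1 z)) + norm (((?H o\<^sub>L Gr 1) - (Gr 1 o\<^sub>L ?H)) z) + norm (Gr 1 (?H z - z))"
    unfolding eq by (rule norm_triangle3)
  also have "\<dots> \<le> 1 * (norm v / real N) + 1 / real N * norm v + 1 * (norm v / real N)"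
  proof (intro add_mono)
    show "norm (?H (?G (Gr 1 z) - Gr 1 z)) \<le> 1 * (norm v / real N)"
      using N nz by (intro order_trans[OF norm_blinfun] mult_mono ravg_norm(1)[OF RM N] order_trans[OF ravg_approx[OF RG N]] divide_right_mono) auto
    show "norm (((?H o\<^sub>L Gr 1) - (Gr 1 o\<^sub>L ?H)) z) \<le> 1 / real N * norm v"
      using N nz by (intro order_trans[OF norm_blinfun] mult_mono ravg_commutator) auto
    show "norm (Gr 1 (?H z - z)) \<le> 1 * (norm v / real N)"
      unfolding z_def using N by (intro order_trans[OF norm_blinfun] mult_mono ravg_approx[OF RM N] resolvent_familyD(2)[OF RG]) auto
  qed
  finally show ?thesis by (simp add: z_def)
qed

text \<open>Were the product zero, so would be its adjoint; \<open>mphi 1\<close> has no zeros, so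
  \<open>Mr' 1\<close> can be cancelled and \<open>Gr 1\<close> vanishes. But it maps
  \<open>expk_at 1 0\<close> to the function exp (-|x|) / 2.\<close>

lemma Gr_Mr_nonzero: "\<exists>v. Gr 1 (Mr 1 v) \<noteq> 0"
proof (rule ccontr)
  assume "\<nexists>v. Gr 1 (Mr 1 v) \<noteq> 0"
  then have z: "Gr 1 (Mr 1 v) = 0" for v by blast
  have aM: "adjoint_pair (Mr 1) (Mr' 1)" and aG: "adjoint_pair (Gr 1) (Gr' 1)"
    using resolvent_familyD(1)[OF resolvent_family_Mr, of 1] resolvent_familyD(1)[OF resolvent_family_Gr, of 1] by auto
  have "Gr' 1 x = 0" for x
  proof -
    have "cinner v (Mr' 1 (Gr' 1 x)) = 0" for v
      using z[of v] by (simp flip: adjoint_pairD[OF aM] adjoint_pairD[OF aG])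
    then have m0: "Mr' 1 (Gr' 1 x) = 0" by (metis cinner_self of_real_eq_0_iff power_eq_0_iff norm_eq_zero)
    obtain f where f: "f \<in> L2" "Gr' 1 x = cls f" by (rule l2_cases)
    have "cls (\<lambda>t. cnj (mphi 1 t) * f t) = cls (\<lambda>_. 0)"
      using m0 f by (simp add: Mr'_def bmult_cls bm_cnj bm_mphi cls_zero)
    then have "ae_eq (\<lambda>t. cnj (mphi 1 t) * f t) (\<lambda>_. 0)"
      using f by (simp add: cls_eq_iff L2_zero L2_bm_mult bm_cnj bm_mphi)
    moreover have "mphi 1 t \<noteq> 0" for t using mphi_denom(1)[of t] by (simp add: mphi_def)
    ultimately have "ae_eq f (\<lambda>_. 0)" by (simp add: ae_eq_def)
    then show ?thesis using f by (simp add: L2_zero flip: cls_eq_iff cls_zero)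
  qed
  then have "cinner (Gr 1 x) y = 0" for x y by (simp add: adjoint_pairD[OF aG])
  then have "Gr 1 (expk_at 1 0) = 0" by (metis cinner_ext cinner_zero_left)
  moreover have "Gr 1 (expk_at 1 0) = cls (conv (expk 1) (\<lambda>t. complex_of_real (expk 1 (0 - t))))"
    unfolding Gr_def expk_at_def by (intro convl_cls kern_expk expk_L2) auto
  moreover have "conv (expk 1) (\<lambda>t. complex_of_real (expk 1 (0 - t))) = (\<lambda>x. complex_of_real (1 / 2 * exp (- \<bar>x\<bar>)))"
  proof
    fix x :: real
    have "conv (expk 1) (\<lambda>t. complex_of_real (expk 1 (0 - t))) x = cinner (expk_at 1 x) (expk_at 1 0)"
      unfolding expk_at_def[of 1 0] by (rule conv_expk[OF _ expk_L2]) auto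
    then show "conv (expk 1) (\<lambda>t. complex_of_real (expk 1 (0 - t))) x = complex_of_real (1 / 2 * exp (- \<bar>x\<bar>))"
      by (simp add: expk_at_inner)
  qed
  moreover have "conv (expk 1) (\<lambda>t. complex_of_real (expk 1 (0 - t))) \<in> L2"
    by (intro conv_bound(1) kern_expk expk_L2) auto
  ultimately have "ae_eq (\<lambda>x. complex_of_real (1 / 2 * exp (- \<bar>x\<bar>))) (\<lambda>_. 0)"
    by (metis cls_eq_iff cls_zero L2_zero)
  then have "AE x::real in lborel. False" by (simp add: ae_eq_def)
  then show False by (simp add: eventually_False ae_filter_eq_bot_iff)
qed

lemma mixed_sequence:
  obtains B B' w where "w \<noteq> 0" "\<And>n. adjoint_pair (B n) (B' n)" "\<And>n::nat. norm (B n) \<le> 1"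
    "\<And>n. compact_bl (B n)" "\<And>n. bipolar (B n)" "\<And>n. norm (B n - B' n) \<le> (1 / 2) ^ n"
    "\<And>n. norm w / 2 \<le> norm (blinfun_apply (B n) w)"
proof -
  obtain v where v: "Gr 1 (Mr 1 v) \<noteq> 0" using Gr_Mr_nonzero by blast
  define w where "w = Gr 1 (Mr 1 v)"
  have "\<exists>N. 0 < N \<and> norm (mixed N - mixed' N) \<le> (1 / 2) ^ n \<and> norm w / 2 \<le> norm (mixed N w)" for n
  proof -
    have "(\<lambda>N. 2 * sqrt (5 / real N) + 1 / real N) \<longlonglongrightarrow> 0" by real_asymp
    then have "\<forall>\<^sub>F N in sequentially. 2 * sqrt (5 / real N) + 1 / real N < (1 / 2) ^ n"
      by (rule order_tendstoD) simp
    moreover have "(\<lambda>N. 3 * norm v / real N) \<longlonglongrightarrow> 0" by real_asymp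
    then have "\<forall>\<^sub>F N in sequentially. 3 * norm v / real N < norm w / 2"
      by (rule order_tendstoD) (use v in \<open>simp add: w_def\<close>)
    ultimately have "\<forall>\<^sub>F N in sequentially. 0 < N \<and> norm (mixed N - mixed' N) \<le> (1 / 2) ^ n \<and> norm w / 2 \<le> norm (mixed N w)"
      using eventually_gt_at_top[of 0]
    proof eventually_elim
      case (elim N)
      have "norm w - norm (mixed N w) \<le> norm (mixed N w - w)"
        using norm_triangle_ineq2[of w "mixed N w"] by (simp add: norm_minus_commute)
      then have "norm w / 2 \<le> norm (mixed N w)" using elim mixed_approx[of N v] by (simp add: w_def)
      then show ?case using elim mixed_skew[of N] by linarith
    qed
    then show ?thesis by (auto simp: eventually_sequentially)
  qed
  then obtain N where "\<And>n. 0 < N n \<and> norm (mixed (N n) - mixed' (N n)) \<le> (1 / 2) ^ n \<and> norm w / 2 \<le> norm (mixed (N n) w)"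
    by metis
  then show ?thesis
    using v mixed_adjoint mixed_norm mixed_compact mixed_bipolar
    by (intro that[of w "\<lambda>n. mixed (N n)" "\<lambda>n. mixed' (N n)"]) (auto simp: w_def)
qed

section \<open>Block sums\<close>

definition lcut :: "real set \<Rightarrow> l2 \<Rightarrow>\<^sub>L l2" where "lcut I = bmult (indicator I)"

lemma cut_adjoint: "I \<in> sets borel \<Longrightarrow> adjoint_pair (lcut I) (lcut I)"
proof -
  assume "I \<in> sets borel"
  moreover have "(\<lambda>x. cnj (indicator I x)) = (indicator I :: fn)" by (auto simp: indicator_def)
  ultimately show ?thesis unfolding lcut_def using bmult_adjoint[OF bm_indicator, of I] by simp
qed

lemma norm_cut_le: "I \<in> sets borel \<Longrightarrow> norm (lcut I) \<le> 1"
  unfolding lcut_def by (rule norm_bmult_le[OF bm_indicator]) (auto simp: indicator_def)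

lemma norm_cut_apply_le: "I \<in> sets borel \<Longrightarrow> norm (lcut I x) \<le> norm x"
  using norm_blinfun[of "lcut I" x] norm_cut_le[of I] mult_right_mono[of "norm (lcut I)" 1 "norm x"] by simp

lemma cut_cut: "I \<in> sets borel \<Longrightarrow> J \<in> sets borel \<Longrightarrow> lcut I (lcut J x) = lcut (I \<inter> J) x"
proof -
  assume IJ: "I \<in> sets borel" "J \<in> sets borel"
  have "(lcut I o\<^sub>L lcut J) x = lcut (I \<inter> J) x"
  proof -
    have "(\<lambda>x. indicator I x * indicator J x) = (indicator (I \<inter> J) :: fn)"
      by (auto simp: indicator_def fun_eq_iff)
    then show ?thesis
      unfolding lcut_def bmult_compose[OF bm_indicator[OF IJ(1)] bm_indicator[OF IJ(2)]] by simp
  qed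
  then show ?thesis by simp
qed

lemma cut_empty: "lcut {} x = 0"
proof -
  obtain f where f: "f \<in> L2" "x = cls f" by (rule l2_cases)
  then show ?thesis unfolding lcut_def using bm_indicator[of "{}"] by (simp add: bmult_cls cls_zero)
qed

lemma transl_cut:
  "transl t (lcut {-R..<R} x) = lcut {t - R..<t + R} (transl t x)"
proof -
  have "(\<lambda>x. indicator {-R..<R} (x - t)) = (indicator {t - R..<t + R} :: fn)"
    by (auto simp: indicator_def fun_eq_iff)
  then show ?thesis unfolding lcut_def using transl_bmult[OF bm_indicator[of "{-R..<R}"], of t x] by simp
qed

lemma cut_tendsto:
  assumes "\<And>n. n \<le> m n" shows "(\<lambda>n. lcut {-real (m n)..<real (m n)} x) \<longlonglongrightarrow> x"
proof -
  have "(\<lambda>n. bmult (indicator {-real (m n)..<real (m n)}) x) \<longlonglongrightarrow> bmult (\<lambda>_. 1) x"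
  proof (rule bmult_tendsto[where B = 1])
    show "(\<lambda>n. indicator {-real (m n)..<real (m n)} y :: complex) \<longlonglongrightarrow> 1" for y
    proof (rule tendsto_eventually)
      obtain n0 where n0: "\<bar>y\<bar> < real n0" using reals_Archimedean2 by blast
      have "indicator {-real (m n)..<real (m n)} y = (1::complex)" if "n0 \<le> n" for n
      proof -
        have "real n0 \<le> real (m n)" using that assms[of n] by simp
        then have "- real (m n) \<le> y" "y < real (m n)" using n0 by linarith+
        then show ?thesis by (simp add: indicator_def)
      qed
      then show "\<forall>\<^sub>F n in sequentially. indicator {-real (m n)..<real (m n)} y = (1::complex)"
        by (auto simp: eventually_sequentially)
    qed
  qed (auto intro: bm_indicator bmI[of _ 1] simp: indicator_def)
  moreover have "bmult (\<lambda>_. 1) x = x"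
  proof -
    obtain f where f: "f \<in> L2" "x = cls f" by (rule l2_cases)
    then show ?thesis by (simp add: bmult_cls bmI[of _ 1])
  qed
  ultimately show ?thesis by (simp add: lcut_def)
qed

text \<open>Strong convergence of the cut-offs to the identity is uniform on the relatively compact
  image of the unit ball; the argument runs along a sequence of counterexamples.\<close>

lemma compact_cut:
  assumes A: "compact_bl A" and e: "0 < e"
  shows "\<exists>n0. \<forall>n\<ge>n0. norm (A - (lcut {-real n..<real n} o\<^sub>L A)) \<le> e"
proof (rule ccontr)
  assume "\<not> ?thesis"
  then have "\<forall>n0. \<exists>n\<ge>n0. \<not> norm (A - (lcut {-real n..<real n} o\<^sub>L A)) \<le> e" by blast
  then obtain m where m: "\<And>k. k \<le> m k" "\<And>k. \<not> norm (A - (lcut {-real (m k)..<real (m k)} o\<^sub>L A)) \<le> e"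
    by metis
  define P where "P k = lcut {-real (m k)..<real (m k)}" for k
  have "\<exists>u. norm u \<le> 1 \<and> e < norm (A u - P k (A u))" for k
  proof -
    have "\<exists>x. \<not> norm ((A - (P k o\<^sub>L A)) x) \<le> e * norm x"
      using m(2)[of k] e norm_blinfun_bound[of e "A - (P k o\<^sub>L A)"] unfolding P_def by force
    then obtain x where x: "e * norm x < norm (A x - P k (A x))" by (auto simp: blinfun.diff_left not_le)
    then have "x \<noteq> 0" by auto
    define u where "u = (1 / norm x) *\<^sub>R x"
    have "A u - P k (A u) = (1 / norm x) *\<^sub>R (A x - P k (A x))"
      by (simp add: u_def blinfun.scaleR_right scaleR_right_diff_distrib)
    then have "norm (A u - P k (A u)) = norm (A x - P k (A x)) / norm x" by simp
    then have "e < norm (A u - P k (A u))" using x \<open>x \<noteq> 0\<close> by (simp add: pos_less_divide_eq)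
    then show ?thesis using \<open>x \<noteq> 0\<close> by (intro exI[of _ u]) (simp add: u_def)
  qed
  then obtain u where u: "\<And>k. norm (u k) \<le> 1" "\<And>k. e < norm (A (u k) - P k (A (u k)))" by metis
  have "bounded (range u)" using u(1) by (auto simp: bounded_iff)
  then obtain r :: "nat \<Rightarrow> nat" where r: "strict_mono r" "convergent (\<lambda>n. A (u (r n)))"
    using compact_blE[OF A] by blast
  then obtain l where l: "(\<lambda>n. A (u (r n))) \<longlonglongrightarrow> l" by (auto simp: convergent_def)
  have "(\<lambda>n. P (r n) l) \<longlonglongrightarrow> l"
    unfolding P_def using m(1) seq_suble[OF r(1)] order_trans by (intro cut_tendsto) blast
  then have z: "(\<lambda>n. 2 * norm (A (u (r n)) - l) + norm (l - P (r n) l)) \<longlonglongrightarrow> 2 * norm (l - l) + norm (l - l)"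
    by (intro tendsto_intros l)
  have "e \<le> 2 * norm (A (u (r n)) - l) + norm (l - P (r n) l)" for n
  proof -
    let ?y = "A (u (r n))"
    have eq: "?y - P (r n) ?y = (?y - l) + (l - P (r n) l) + P (r n) (l - ?y)" by (simp add: blinfun.diff_right)
    have "norm (?y - P (r n) ?y) \<le> norm (?y - l) + norm (l - P (r n) l) + norm (P (r n) (l - ?y))"
      unfolding eq by (rule norm_triangle3)
    moreover have "norm (P (r n) (l - ?y)) \<le> norm (?y - l)"
      unfolding P_def norm_minus_commute[of ?y] by (rule norm_cut_apply_le) simp
    ultimately show ?thesis using u(2)[of "r n"] by linarith
  qed
  then have "e \<le> 2 * norm (l - l) + norm (l - l)" by (intro LIMSEQ_le_const[OF z]) auto
  then show False using e by simp
qed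

text \<open>Cutting on the right is cutting the adjoint on the left, and the adjoint is compact too.
  One \<open>n\<close> must serve both sides.\<close>

lemma compact_corner:
  assumes A: "compact_bl A" "adjoint_pair A A'" and e: "0 < e"
  shows "\<exists>n. norm (A - (lcut {-real n..<real n} o\<^sub>L A o\<^sub>L lcut {-real n..<real n})) \<le> e"
proof -
  have e2: "0 < e / 2" using e by simp
  obtain n1 where n1: "\<And>n. n1 \<le> n \<Longrightarrow> norm (A - (lcut {-real n..<real n} o\<^sub>L A)) \<le> e / 2"
    using compact_cut[OF A(1) e2] by blast
  obtain n2 where n2: "\<And>n. n2 \<le> n \<Longrightarrow> norm (A' - (lcut {-real n..<real n} o\<^sub>L A')) \<le> e / 2"
    using compact_cut[OF compact_bl_adjoint[OF A] e2] by blast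
  define P where "P = lcut {-real (max n1 n2)..<real (max n1 n2)}"
  have 1: "norm (A - (P o\<^sub>L A)) \<le> e / 2" and 2: "norm (A' - (P o\<^sub>L A')) \<le> e / 2"
    using n1[of "max n1 n2"] n2[of "max n1 n2"] by (auto simp: P_def)
  have adjP: "adjoint_pair P P" unfolding P_def by (rule cut_adjoint) simp
  have 3: "norm (A - (A o\<^sub>L P)) \<le> e / 2"
    using norm_adjoint[OF adjoint_pair_diff[OF A(2) adjoint_pair_compose[OF A(2) adjP]]] 2 by simp
  have nP: "norm P \<le> 1" unfolding P_def by (rule norm_cut_le) simp
  have eq: "A - (P o\<^sub>L A o\<^sub>L P) = (A - (P o\<^sub>L A)) + (P o\<^sub>L (A - (A o\<^sub>L P)))"
    by (rule blinfun_eqI) (simp add: blinfun.diff_left blinfun.diff_right blinfun.add_left)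
  have "norm (A - (P o\<^sub>L A o\<^sub>L P)) \<le> norm (A - (P o\<^sub>L A)) + norm (P o\<^sub>L (A - (A o\<^sub>L P)))"
    unfolding eq by (rule norm_triangle_ineq)
  also have "norm (P o\<^sub>L (A - (A o\<^sub>L P))) \<le> 1 * (e / 2)"
    using nP 3 by (intro order_trans[OF norm_blinfun_compose] mult_mono) auto
  finally have "norm (A - (P o\<^sub>L A o\<^sub>L P)) \<le> e" using 1 by simp
  then show ?thesis unfolding P_def by blast
qed

text \<open>Distinct blocks have orthogonal ranges, so by Pythagoras and Bessel the tails of the
  series are dominated by those of a convergent series. The convergence is strong, in general not in
  norm, and the sum can fail to be compact.\<close>

lemma block_sum:
  fixes Q C :: "nat \<Rightarrow> l2 \<Rightarrow>\<^sub>L l2"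
  assumes Q: "\<And>n. adjoint_pair (Q n) (Q n)" "\<And>n x. Q n (Q n x) = Q n x" "\<And>m n x. m \<noteq> n \<Longrightarrow> Q m (Q n x) = 0"
    and C: "\<And>n. norm (C n) \<le> 1"
  obtains S :: "l2 \<Rightarrow>\<^sub>L l2" where "\<And>x. (\<lambda>n. Q n (C n (Q n x))) sums S x"
proof -
  have innerQ: "inner (Q n x) y = inner x (Q n y)" for n x y
    by (simp add: inner_cinner adjoint_pairD[OF Q(1)])
  have orth: "pairwise (\<lambda>i j. orthogonal (Q i (f i)) (Q j (f j))) I" for f :: "nat \<Rightarrow> l2" and I
    by (auto simp: pairwise_def orthogonal_def innerQ Q(3))
  have bessel: "(\<Sum>n\<in>I. (norm (Q n x))\<^sup>2) \<le> (norm x)\<^sup>2" if "finite I" for I x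
  proof -
    define s where "s = (\<Sum>n\<in>I. (norm (Q n x))\<^sup>2)"
    have s0: "0 \<le> s" by (simp add: s_def sum_nonneg)
    have "s = (norm (\<Sum>n\<in>I. Q n x))\<^sup>2"
      unfolding s_def using norm_sum_Pythagorean[OF that orth[of "\<lambda>_. x"]] by simp
    moreover have "s = inner (\<Sum>n\<in>I. Q n x) x"
      unfolding s_def inner_sum_left using innerQ Q(2) by (simp add: power2_norm_eq_inner)
    ultimately have "s * s \<le> s * (norm x)\<^sup>2"
      \<comment> \<open>The number \<open>s\<close> is both the squared norm of the projected vector
        and its inner product with \<open>x\<close>; Cauchy-Schwarz then gives Bessel's
        inequality.\<close>
      using Cauchy_Schwarz_ineq[of "\<Sum>n\<in>I. Q n x" x] by (simp add: power2_eq_square power2_norm_eq_inner[symmetric])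
    then show ?thesis using s0 unfolding s_def[symmetric]
      by (cases "s = 0") (auto simp: mult_le_cancel_left)
  qed
  have block: "(norm (\<Sum>n\<in>I. Q n (C n (Q n x))))\<^sup>2 \<le> (\<Sum>n\<in>I. (norm (Q n x))\<^sup>2)" if "finite I" for I x
  proof -
    have "(norm (\<Sum>n\<in>I. Q n (C n (Q n x))))\<^sup>2 = (\<Sum>n\<in>I. (norm (Q n (C n (Q n x))))\<^sup>2)"
      by (rule norm_sum_Pythagorean[OF that orth])
    also have "\<dots> \<le> (\<Sum>n\<in>I. (norm (Q n x))\<^sup>2)"
    proof (intro sum_mono power_mono norm_ge_zero)
      fix n
      have Qle: "norm (Q n y) \<le> norm y" for y
        using bessel[of "{n}" y] by simp
      have "norm (C n (Q n x)) \<le> norm (Q n x)"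
        using norm_blinfun[of "C n" "Q n x"] C[of n] mult_right_mono[of "norm (C n)" 1 "norm (Q n x)"] by simp
      then show "norm (Q n (C n (Q n x))) \<le> norm (Q n x)" using Qle order_trans by blast
    qed
    finally show ?thesis .
  qed
  have summ: "summable (\<lambda>n. Q n (C n (Q n x)))" for x
  proof -
    have sQ: "summable (\<lambda>n. (norm (Q n x))\<^sup>2)"
      by (rule bounded_imp_summable[of _ "(norm x)\<^sup>2"]) (auto intro: bessel)
    show ?thesis unfolding summable_Cauchy
    proof (intro allI impI)
      fix e :: real assume e: "0 < e"
      then obtain N where N: "\<And>m n. m \<ge> N \<Longrightarrow> norm (\<Sum>k=m..<n. (norm (Q k x))\<^sup>2) < e\<^sup>2"
        using sQ unfolding summable_Cauchy by (meson zero_less_power)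
      have "norm (\<Sum>k=m..<n. Q k (C k (Q k x))) < e" if "m \<ge> N" for m n
      proof -
        have "(norm (\<Sum>k=m..<n. Q k (C k (Q k x))))\<^sup>2 < e\<^sup>2"
          using block[of "{m..<n}" x] N[OF that, of n] by (simp add: sum_nonneg)
        then show ?thesis using e by (simp add: power_less_imp_less_base)
      qed
      then show "\<exists>N. \<forall>m\<ge>N. \<forall>n. norm (\<Sum>k=m..<n. Q k (C k (Q k x))) < e" by blast
    qed
  qed
  have bl: "bounded_linear (\<lambda>x. \<Sum>n. Q n (C n (Q n x)))"
  proof (rule bounded_linear_intro[of _ 1])
    show "(\<Sum>n. Q n (C n (Q n (x + y)))) = (\<Sum>n. Q n (C n (Q n x))) + (\<Sum>n. Q n (C n (Q n y)))" for x y
      using suminf_add[OF summ[of x] summ[of y]] by (simp add: blinfun.add_right)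
    show "(\<Sum>n. Q n (C n (Q n (r *\<^sub>R x)))) = r *\<^sub>R (\<Sum>n. Q n (C n (Q n x)))" for r x
      using suminf_scaleR_right[OF summ[of x], of r] by (simp add: blinfun.scaleR_right)
    show "norm (\<Sum>n. Q n (C n (Q n x))) \<le> norm x * 1" for x
    proof -
      have "(\<lambda>N. norm (\<Sum>n<N. Q n (C n (Q n x)))) \<longlonglongrightarrow> norm (\<Sum>n. Q n (C n (Q n x)))"
        by (intro tendsto_norm summable_LIMSEQ summ)
      moreover have "norm (\<Sum>n<N. Q n (C n (Q n x))) \<le> norm x" for N
      proof -
        have "(norm (\<Sum>n<N. Q n (C n (Q n x))))\<^sup>2 \<le> (norm x)\<^sup>2"
          by (rule order_trans[OF block bessel]) auto
        then show ?thesis by (rule power2_le_imp_le) simp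
      qed
      ultimately show ?thesis by (simp add: Lim_bounded)
    qed
  qed
  show ?thesis
    by (rule that[of "Blinfun (\<lambda>x. \<Sum>n. Q n (C n (Q n x)))"])
      (simp add: bounded_linear_Blinfun_apply[OF bl] summable_sums summ)
qed

text \<open>If \<open>A (e n)\<close> clustered at \<open>l \<noteq> 0\<close>, then \<open>A\<close> would map sums of \<open>N\<close> of the vectors, of norm \<open>O(sqrt N)\<close>, to vectors of norm of order \<open>N\<close>.\<close>

lemma compact_orthogonal:
  fixes e :: "nat \<Rightarrow> l2"
  assumes A: "compact_bl A" and e: "bounded (range e)" "\<And>m n. m \<noteq> n \<Longrightarrow> inner (e m) (e n) = 0" and d: "0 < d"
  shows "\<exists>n. norm (A (e n)) < d"
proof (rule ccontr)
  assume "\<not> ?thesis"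
  then have ge: "d \<le> norm (A (e n))" for n by (meson not_less)
  obtain M where M: "\<And>n. norm (e n) \<le> M" "0 < M" using e(1) unfolding bounded_pos by auto
  obtain r :: "nat \<Rightarrow> nat" where r: "strict_mono r" "convergent (\<lambda>n. A (e (r n)))"
    using compact_blE[OF A e(1)] by blast
  then obtain l where l: "(\<lambda>n. A (e (r n))) \<longlonglongrightarrow> l" by (auto simp: convergent_def)
  have ld: "d \<le> norm l" using ge by (intro LIMSEQ_le_const[OF tendsto_norm[OF l]]) auto
  obtain n0 where n0: "\<And>n. n \<ge> n0 \<Longrightarrow> norm (A (e (r n)) - l) < d / 2"
    using LIMSEQ_D[OF l, of "d / 2"] d by auto
  have bd: "real N * (d / 2) \<le> norm A * (M * sqrt (real N))" for N
  proof -
    define y where "y = (\<Sum>n\<in>{n0..<n0 + N}. e (r n))"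
    have "(norm y)\<^sup>2 = (\<Sum>n\<in>{n0..<n0 + N}. (norm (e (r n)))\<^sup>2)"
      unfolding y_def
    proof (rule norm_sum_Pythagorean)
      show "pairwise (\<lambda>i j. orthogonal (e (r i)) (e (r j))) {n0..<n0 + N}"
        using e(2) strict_mono_eq[OF r(1)] by (auto simp: pairwise_def orthogonal_def)
    qed simp
    also have "\<dots> \<le> (\<Sum>n\<in>{n0..<n0 + N}. M\<^sup>2)" by (intro sum_mono power_mono M) auto
    also have "\<dots> = real N * M\<^sup>2" by simp
    finally have "norm y \<le> sqrt (real N * M\<^sup>2)" by (rule real_le_rsqrt)
    then have ny: "norm y \<le> M * sqrt (real N)" using M(2) by (simp add: real_sqrt_mult mult.commute)
    have "A y = real N *\<^sub>R l + (\<Sum>n\<in>{n0..<n0 + N}. A (e (r n)) - l)"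
      by (simp add: y_def blinfun.sum_right sum_subtractf sum_constant_scaleR)
    moreover have "norm (\<Sum>n\<in>{n0..<n0 + N}. A (e (r n)) - l) \<le> (\<Sum>n\<in>{n0..<n0 + N}. d / 2)"
      using n0 by (intro order_trans[OF norm_sum] sum_mono) (auto intro: less_imp_le)
    ultimately have "norm (real N *\<^sub>R l) \<le> norm (A y) + real N * (d / 2)"
      using norm_triangle_ineq4[of "A y" "\<Sum>n\<in>{n0..<n0 + N}. A (e (r n)) - l"] by simp
    then have "real N * d \<le> norm (A y) + real N * (d / 2)"
      using mult_left_mono[OF ld, of "real N"] by simp
    moreover have "norm (A y) \<le> norm A * (M * sqrt (real N))"
      using ny by (intro order_trans[OF norm_blinfun] mult_left_mono) auto
    ultimately show ?thesis by linarith
  qed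
  obtain N :: nat where N: "(2 * norm A * M / d)\<^sup>2 < real N" using reals_Archimedean2 by blast
  have N0: "0 < real N" using N zero_le_power2 le_less_trans by blast
  then have "sqrt (real N) * (sqrt (real N) * (d / 2)) \<le> norm A * M * sqrt (real N)"
    using bd[of N] by (simp add: mult.assoc[symmetric])
  then have "sqrt (real N) * (sqrt (real N) * (d / 2)) \<le> sqrt (real N) * (norm A * M)" by (simp add: mult.commute)
  then have "sqrt (real N) * (d / 2) \<le> norm A * M" using N0 by (simp add: mult_le_cancel_left)
  then have "sqrt (real N) \<le> 2 * norm A * M / d" using d by (simp add: field_simps)
  then have "(sqrt (real N))\<^sup>2 \<le> (2 * norm A * M / d)\<^sup>2" by (rule power_mono) simp
  then show False using N by simp
qed

lemma summable_geometric_norm: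
  fixes f :: "nat \<Rightarrow> 'a::banach"
  assumes "\<And>n. norm (f n) \<le> (1 / 2) ^ n" shows "summable f"
proof (rule summable_norm_cancel, rule summable_comparison_test')
  show "summable (\<lambda>n. (1 / 2 :: real) ^ n)" by (rule summable_geometric) simp
  show "norm (norm (f n)) \<le> (1 / 2) ^ n" if "0 \<le> n" for n using assms by simp
qed

lemma compact_bl_suminf:
  assumes "\<And>n. compact_bl (A n)" "summable A" shows "compact_bl (suminf A)"
  by (rule compact_bl_limit[OF _ summable_LIMSEQ[OF assms(2)]]) (intro compact_bl_sum assms(1))

lemma sums_blinfun_apply:
  fixes A :: "nat \<Rightarrow> l2 \<Rightarrow>\<^sub>L l2"
  shows "summable A \<Longrightarrow> (\<lambda>n. A n x) sums (suminf A) x"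
  by (rule bounded_linear.sums[OF blinfun.bounded_linear_left]) (rule summable_sums)

lemma adjoint_pair_sums:
  assumes adj: "\<And>n. adjoint_pair (A n) (A' n)"
    and lim: "\<And>x. (\<lambda>n. blinfun_apply (A n) x) sums blinfun_apply X x" "\<And>x. (\<lambda>n. blinfun_apply (A' n) x) sums blinfun_apply X' x"
  shows "adjoint_pair X X'"
  unfolding adjoint_pair_def
proof (intro allI)
  fix x y
  have "(\<lambda>N. cinner (\<Sum>n<N. A n x) y) \<longlonglongrightarrow> cinner (X x) y"
    using lim(1)[of x] unfolding sums_def by (intro tendsto_intros)
  moreover have "(\<lambda>N. cinner x (\<Sum>n<N. A' n y)) \<longlonglongrightarrow> cinner x (X' y)"
    using lim(2)[of y] unfolding sums_def by (intro tendsto_intros)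
  moreover have "cinner (\<Sum>n<N. A n x) y = cinner x (\<Sum>n<N. A' n y)" for N
    using adjoint_pairD[OF adjoint_pair_sum[of "{..<N}" A A'], of x y] adj by (simp add: blinfun.sum_left)
  ultimately show "cinner (X x) y = cinner x (X' y)" using LIMSEQ_unique by simp
qed

text \<open>An orthonormal sequence on the negative half-line, on which every block of the witness
  vanishes; it detects a scalar part.\<close>

definition negint :: "nat \<Rightarrow> l2" where
  "negint n = cls (indicator {-real n - 1..<-real n})"

lemma negint_L2: "(indicator {-real n - 1..<-real n} :: fn) \<in> L2"
proof -
  have "(cmod (indicator {-real n - 1..<-real n} x))\<^sup>2 = indicator {-real n - 1..<-real n} x" for x :: real
    by (simp add: indicator_def)
  then show ?thesis by (simp add: L2_def)
qed

lemma negint_inner: "m \<noteq> n \<Longrightarrow> inner (negint m) (negint n) = 0"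
proof -
  assume "m \<noteq> n"
  then have "m + 1 \<le> n \<or> n + 1 \<le> m" by linarith
  then have d: "real m + 1 \<le> real n \<or> real n + 1 \<le> real m" by (metis of_nat_1 of_nat_add of_nat_le_iff)
  have "cnj (indicator {-real m - 1..<-real m} x) * indicator {-real n - 1..<-real n} x = 0" for x :: real
    using d by (auto simp: indicator_def)
  then have "l2inner (indicator {-real m - 1..<-real m}) (indicator {-real n - 1..<-real n}) = 0"
    unfolding l2inner_def by (simp only: Bochner_Integration.integral_zero)
  then show ?thesis by (simp add: inner_cinner negint_def cinner_cls negint_L2)
qed

lemma negint_norm: "norm (negint n) = 1"
proof -
  have "(cmod (indicator {-real n - 1..<-real n} x))\<^sup>2 = indicator {-real n - 1..<-real n} x" for x :: real
    by (simp add: indicator_def)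
  then show ?thesis by (simp add: negint_def norm_cls negint_L2 l2norm_def)
qed

lemma negint_cut: "0 \<le> a \<Longrightarrow> lcut {a..<b} (negint n) = 0"
proof -
  assume a: "0 \<le> a"
  have "(\<lambda>x. indicator {a..<b} x * indicator {-real n - 1..<-real n} x :: complex) = (\<lambda>_. 0)"
    using a by (auto simp: indicator_def fun_eq_iff)
  then show ?thesis by (simp add: lcut_def negint_def bmult_cls bm_indicator negint_L2 cls_zero)
qed

lemma bounded_rangeI: "(\<And>n. norm (u n) \<le> M) \<Longrightarrow> bounded (range u)"
  by (auto simp: bounded_iff)

text \<open>Translates \<open>A n\<close> of the compact operators of \<open>mixed_sequence\<close> are moved far apart, so that up to a norm-convergent compact error their sum is block diagonal. It is bounded but not compact, while the skew parts have summable norms.\<close>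

theorem quasicompact_witness:
  obtains X X' where "adjoint_pair X X'" "bipolar X" "compact_bl (X - X')"
    "\<And>c K. compact_bl K \<Longrightarrow> \<not> (\<forall>x. blinfun_apply X x = c *\<^sub>C x + blinfun_apply K x)"
proof -
  obtain B B' w where w: "w \<noteq> 0" and adjB: "\<And>n. adjoint_pair (B n) (B' n)" and nB: "\<And>n::nat. norm (B n) \<le> 1"
    and cB: "\<And>n. compact_bl (B n)" and ApB: "\<And>n. bipolar (B n)" and skew: "\<And>n. norm (B n - B' n) \<le> (1 / 2) ^ n"
    and Bw: "\<And>n. norm w / 2 \<le> norm (blinfun_apply (B n) w)"
    using mixed_sequence by metis
  \<comment> \<open>The factor 1/4 is for the end of the proof: truncation then costs at most a
    quarter of \<open>norm w\<close>, while \<open>B n w\<close> has at least half of it.\<close>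
  have "\<exists>m. norm (B n - (lcut {-real m..<real m} o\<^sub>L B n o\<^sub>L lcut {-real m..<real m})) \<le> (1 / 4) * (1 / 2) ^ n" for n
    by (rule compact_corner[OF cB adjB]) simp
  then obtain R where R: "\<And>n. norm (B n - (lcut {-real (R n)..<real (R n)} o\<^sub>L B n o\<^sub>L lcut {-real (R n)..<real (R n)})) \<le> (1 / 4) * (1 / 2) ^ n"
    by metis
  define P where "P n = lcut {-real (R n)..<real (R n)}" for n
  define s where "s n = (\<Sum>k<n. 2 * real (R k))" for n
  define t where "t n = s n + real (R n)" for n
  \<comment> \<open>Half-open intervals laid end to end from 0, the n-th with half-length
    \<open>R n\<close> around its centre \<open>t n\<close>.\<close>
  define I where "I n = {t n - real (R n)..<t n + real (R n)}" for n
  define Q where "Q n = lcut (I n)" for n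
  define A where "A n = transl (t n) o\<^sub>L B n o\<^sub>L transl (- t n)" for n
  define A' where "A' n = transl (t n) o\<^sub>L B' n o\<^sub>L transl (- t n)" for n
  have s0: "0 \<le> s n" for n by (simp add: s_def sum_nonneg)
  have smono: "s m \<le> s n" if "m \<le> n" for m n
    unfolding s_def using that by (intro sum_mono2) auto
  have I_eq: "I n = {s n..<s (Suc n)}" for n by (simp add: I_def t_def s_def add.commute)
  have Idisj: "I m \<inter> I n = {}" if "m \<noteq> n" for m n
  proof -
    have "s (Suc m) \<le> s n \<or> s (Suc n) \<le> s m" using that smono[of "Suc m" n] smono[of "Suc n" m] by linarith
    then show ?thesis by (auto simp: I_eq)
  qed
  have Ib [simp]: "I n \<in> sets borel" for n by (simp add: I_def)
  have Q1: "adjoint_pair (Q n) (Q n)" for n unfolding Q_def by (rule cut_adjoint) simp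
  have Q2: "Q n (Q n x) = Q n x" for n x by (simp add: Q_def cut_cut)
  have Q3: "Q m (Q n x) = 0" if "m \<noteq> n" for m n x using Idisj[OF that] by (simp add: Q_def cut_cut cut_empty)
  have Qt: "Q n x = transl (t n) (P n (transl (- t n) x))" for n x
    by (simp add: Q_def P_def I_def transl_cut transl_transl)
  have tt: "transl (- t n) (transl (t n) x) = x" for n x by (simp add: transl_transl)
  have conj_norm: "norm (transl (t n) o\<^sub>L Y o\<^sub>L transl (- t n)) \<le> norm Y" for Y n
    by (rule norm_blinfun_bound) (auto intro: order_trans[OF norm_blinfun])
  have adjA: "adjoint_pair (A n) (A' n)" for n
    using adjoint_pair_compose[OF adjoint_pair_compose[OF transl_adjoint[of "t n"] adjB[of n]] transl_adjoint[of "- t n"]]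
    unfolding A_def A'_def adjoint_pair_def by simp
  have nA: "norm (A n) \<le> 1" for n unfolding A_def using conj_norm[of n "B n"] nB[of n] by linarith
  have nA': "norm (A' n) \<le> 1" for n using norm_adjoint[OF adjA[of n]] nA[of n] by simp
  have cA: "compact_bl (A n)" for n unfolding A_def by (intro compact_bl_compose_left compact_bl_compose_right cB)
  have cA': "compact_bl (A' n)" for n by (rule compact_bl_adjoint[OF cA adjA])
  have ApA: "bipolar (A n)" for n unfolding A_def by (rule bipolar_conjugate[OF ApB])
  define E where "E n = A n - (Q n o\<^sub>L A n o\<^sub>L Q n)" for n
  define E' where "E' n = A' n - (Q n o\<^sub>L A' n o\<^sub>L Q n)" for n
  have Eeq: "E n = transl (t n) o\<^sub>L (B n - (P n o\<^sub>L B n o\<^sub>L P n)) o\<^sub>L transl (- t n)" for n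
    by (rule blinfun_eqI) (simp add: E_def A_def Qt tt blinfun.diff_left blinfun.diff_right)
  have nE4: "norm (E n) \<le> (1 / 4) * (1 / 2) ^ n" for n
    unfolding Eeq using conj_norm[of n "B n - (P n o\<^sub>L B n o\<^sub>L P n)"] R[of n] unfolding P_def by linarith
  have nE: "norm (E n) \<le> (1 / 2) ^ n" for n by (rule order_trans[OF nE4]) simp
  have adjE: "adjoint_pair (E n) (E' n)" for n
    using adjoint_pair_diff[OF adjA adjoint_pair_compose[OF adjoint_pair_compose[OF Q1 adjA] Q1], of n n n n]
    unfolding E_def E'_def adjoint_pair_def by (simp add: blinfun.diff_left)
  have nE': "norm (E' n) \<le> (1 / 2) ^ n" for n using norm_adjoint[OF adjE[of n]] nE[of n] by simp
  have cE: "compact_bl (E n)" for n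
    unfolding E_def by (intro compact_bl_diff compact_bl_compose_left compact_bl_compose_right cA)
  note sE = summable_geometric_norm[OF nE] and sE' = summable_geometric_norm[OF nE']
  obtain S where S: "\<And>x. (\<lambda>n. Q n (A n (Q n x))) sums blinfun_apply S x"
    by (rule block_sum[of Q A, OF Q1 Q2 Q3 nA]) (assumption | rule that)+
  obtain S' where S': "\<And>x. (\<lambda>n. Q n (A' n (Q n x))) sums blinfun_apply S' x"
    by (rule block_sum[of Q A', OF Q1 Q2 Q3 nA']) (assumption | rule that)+
  define X where "X = S + suminf E"
  define X' where "X' = S' + suminf E'"
  have Ex: "Q n (A n (Q n x)) + E n x = A n x" "Q n (A' n (Q n x)) + E' n x = A' n x" for n x
    by (simp_all add: E_def E'_def blinfun.diff_left)
  have X: "(\<lambda>n. A n x) sums X x" for x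
    using sums_add[OF S[of x] sums_blinfun_apply[OF sE, of x]] by (simp add: X_def Ex blinfun.add_left)
  have X': "(\<lambda>n. A' n x) sums X' x" for x
    using sums_add[OF S'[of x] sums_blinfun_apply[OF sE', of x]] by (simp add: X'_def Ex blinfun.add_left)
  have adjX: "adjoint_pair X X'" by (rule adjoint_pair_sums[OF adjA X X'])
  have ApX: "bipolar X"
  proof (rule bipolar_limit)
    \<comment> \<open>The untruncated operators are summed here, since cut-offs need not preserve
      \<open>bipolar\<close>.\<close>
    show "bipolar (\<Sum>n<N. A n)" for N by (intro bipolar_sum ApA)
    show "(\<lambda>N. (\<Sum>n<N. A n) x) \<longlonglongrightarrow> X x" for x
      using X[of x] by (simp add: sums_def blinfun.sum_left)
  qed
  have nD: "norm (A n - A' n) \<le> (1 / 2) ^ n" for n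
  proof -
    have "A n - A' n = transl (t n) o\<^sub>L (B n - B' n) o\<^sub>L transl (- t n)"
      by (rule blinfun_eqI) (simp add: A_def A'_def blinfun.diff_left blinfun.diff_right)
    then show ?thesis using conj_norm[of n "B n - B' n"] skew[of n] by simp
  qed
  have sD: "summable (\<lambda>n. A n - A' n)" by (rule summable_geometric_norm[OF nD])
  have "X - X' = (\<Sum>n. A n - A' n)"
  proof (rule blinfun_eqI)
    fix x
    have "(\<lambda>n. (A n - A' n) x) sums (X - X') x"
      using sums_diff[OF X[of x] X'[of x]] by (simp add: blinfun.diff_left)
    then show "(X - X') x = (\<Sum>n. A n - A' n) x" using sums_blinfun_apply[OF sD, of x] sums_unique2 by blast
  qed
  moreover have "compact_bl (\<Sum>n. A n - A' n)"
    by (rule compact_bl_suminf[OF _ sD]) (intro compact_bl_diff cA cA')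
  ultimately have cX: "compact_bl (X - X')" by simp
  have noX: "\<not> (\<forall>x. X x = c *\<^sub>C x + K x)" if K: "compact_bl K" for c and K :: "l2 \<Rightarrow>\<^sub>L l2"
  proof
    assume XK: "\<forall>x. X x = c *\<^sub>C x + K x"
    define L where "L = K - suminf E"
    have cL: "compact_bl L" unfolding L_def by (intro compact_bl_diff K compact_bl_suminf[OF cE sE])
    have SL: "S x = c *\<^sub>C x + L x" for x
    proof -
      have "S x + suminf E x = c *\<^sub>C x + K x" using XK by (simp add: X_def blinfun.add_left)
      then show ?thesis by (simp add: L_def blinfun.diff_left add_diff_eq eq_diff_eq)
    qed
    \<comment> \<open>On the negative half-line \<open>S\<close> is zero, so \<open>L\<close> would
      act there as \<open>- c\<close> on an orthonormal sequence, which a compact operator cannot do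
      for nonzero \<open>c\<close>.\<close>
    have "c = 0"
    proof (rule ccontr)
      assume c: "c \<noteq> 0"
      have "norm (L (negint n)) = cmod c" for n
      proof -
        have "Q m (A m (Q m (negint n))) = 0" for m
          using negint_cut[of "s m" "s (Suc m)" n] s0[of m] by (simp add: Q_def I_eq)
        then have "S (negint n) = 0" using S[of "negint n"] by (simp add: sums_unique2[OF _ sums_zero])
        then have "L (negint n) = - (c *\<^sub>C negint n)" using SL[of "negint n"] by (simp add: eq_neg_iff_add_eq_0 add.commute)
        then show ?thesis by (simp add: norm_cscale negint_norm)
      qed
      moreover have "\<exists>n. norm (L (negint n)) < cmod c"
        using c by (intro compact_orthogonal[OF cL] bounded_rangeI[of _ 1] negint_inner) (auto simp: negint_norm)
      ultimately show False by simp
    qed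
    then have SL: "S x = L x" for x using SL by simp
    \<comment> \<open>The translates of \<open>w\<close>, cut to their blocks: an orthogonal bounded
      sequence on which \<open>S\<close> stays away from 0.\<close>
    define e where "e n = Q n (transl (t n) w)" for n
    have ge: "norm w / 4 \<le> norm (L (e n))" for n
    proof -
      have "(\<lambda>m. Q m (A m (Q m (e n)))) = (\<lambda>m. if m = n then Q n (A n (Q n (e n))) else 0)"
        by (auto simp: e_def Q3 fun_eq_iff)
      then have "S (e n) = Q n (A n (Q n (e n)))"
        using S[of "e n"] sums_single[of n "\<lambda>_. Q n (A n (Q n (e n)))"] by (simp add: sums_unique2)
      also have "\<dots> = A n (transl (t n) w) - E n (transl (t n) w)"
        by (simp add: E_def e_def Q2 blinfun.diff_left)
      finally have "norm (A n (transl (t n) w)) - norm (E n (transl (t n) w)) \<le> norm (L (e n))"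
        unfolding SL[symmetric] by (simp add: norm_triangle_ineq2)
      moreover have "norm w / 2 \<le> norm (A n (transl (t n) w))" using Bw[of n] by (simp add: A_def tt)
      moreover have "norm (E n (transl (t n) w)) \<le> 1 / 4 * norm w"
      proof -
        have "norm (E n) \<le> 1 / 4 * 1" by (rule order_trans[OF nE4]) (intro mult_left_mono power_le_one; simp)
        then show ?thesis using norm_blinfun[of "E n" "transl (t n) w"] mult_right_mono[of "norm (E n)" "1 / 4" "norm w"] by simp
      qed
      ultimately show ?thesis by linarith
    qed
    have "\<exists>n. norm (L (e n)) < norm w / 4"
    proof (rule compact_orthogonal[OF cL])
      show "bounded (range e)"
        unfolding e_def Q_def by (rule bounded_rangeI[of _ "norm w"]) (metis norm_cut_apply_le norm_transl Ib)
      show "inner (e m) (e n) = 0" if "m \<noteq> n" for m n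
        using that by (simp add: e_def inner_cinner adjoint_pairD[OF Q1] Q3)
    qed (use w in simp)
    then show False using ge by (meson not_le)
  qed
  show ?thesis by (rule that[OF adjX ApX cX noX])
qed

section \<open>The selfadjoint part of the parabolic algebra\<close>

text \<open>The half-lines \<open>{s..}\<close> are closed under intersection and generate the Borel
  sets, so Dynkin's argument extends the vanishing to all Borel sets. Complements need the total
  integral, a limit of tails.\<close>

lemma set_integral_zero_of_tails:
  fixes h :: "real \<Rightarrow> complex"
  assumes h: "integrable lborel h" and tail: "\<And>s. (LINT x:{s..}|lborel. h x) = 0"
  shows "AE x in lborel. h x = 0"
proof (rule sigma_finite_measure.density_zero[OF sigma_finite_lborel h])
  have set_int: "set_integrable lborel A h" if "A \<in> sets borel" for A
    using h that unfolding set_integrable_def by (intro integrable_mult_indicator) auto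
  have total: "(LINT x|lborel. h x) = 0"
  proof -
    have "(\<lambda>n. LINT x:{- real n..}|lborel. h x) \<longlonglongrightarrow> (LINT x|lborel. h x)"
      unfolding set_lebesgue_integral_def
    proof (rule integral_dominated_convergence[where w = "\<lambda>x. norm (h x)"])
      show "AE x in lborel. (\<lambda>n. indicator {- real n..} x *\<^sub>R h x) \<longlonglongrightarrow> h x"
      proof (rule AE_I2, rule tendsto_eventually)
        fix x :: real
        obtain n0 where n0: "- x \<le> real n0" using real_arch_simple by blast
        show "\<forall>\<^sub>F n in sequentially. indicator {- real n..} x *\<^sub>R h x = h x"
          unfolding eventually_sequentially using n0 by (intro exI[of _ n0]) (auto simp: indicator_def)
      qed
      show "AE x in lborel. norm (indicator {- real n..} x *\<^sub>R h x) \<le> norm (h x)" for n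
        by (intro AE_I2) (auto simp: indicator_def)
    qed (use h in auto)
    then show ?thesis by (simp add: tail LIMSEQ_const_iff)
  qed
  fix A :: "real set" assume "A \<in> sets lborel"
  then have A: "A \<in> sigma_sets UNIV (range (\<lambda>x::real. {x..}))"
    by (simp add: borel_Ici[symmetric] flip: sets_measure_of)
      (metis borel_Ici sets_measure_of top_greatest Pow_UNIV)
  have Int_st: "Int_stable (range (\<lambda>x::real. {x..}))" 
  proof -
    have "{a..} \<inter> {b..} = {max a b..}" for a b :: real by auto
    then show ?thesis unfolding Int_stable_def by blast
  qed
  have subset_Pow: "range (\<lambda>x::real. {x..}) \<subseteq> Pow UNIV" by simp
  have sets_eq: "sigma_sets UNIV (range (\<lambda>x::real. {x..})) = sets borel"
    by (subst borel_Ici) simp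
  show "(LINT x:A|lborel. h x) = 0"
    using Int_st subset_Pow A
  proof (induction rule: sigma_sets_induct_disjoint)
    case (basic A)
    then show ?case using tail by auto
  next
    case empty
    then show ?case by (simp add: set_lebesgue_integral_def)
  next
    case (compl A)
    then have [measurable]: "A \<in> sets borel" by (simp add: sets_eq)
    have "(LINT x:UNIV - A|lborel. h x) = (LINT x|lborel. h x - indicator A x *\<^sub>R h x)"
      unfolding set_lebesgue_integral_def by (intro Bochner_Integration.integral_cong) (auto simp: indicator_def)
    also have "\<dots> = (LINT x|lborel. h x) - (LINT x:A|lborel. h x)"
      using set_int[of A] h unfolding set_lebesgue_integral_def set_integrable_def by (intro Bochner_Integration.integral_diff) auto
    finally show ?case using compl total by simp
  next
    case (union A)
    have "\<And>i. A i \<in> sets borel" using union(2) by (auto simp: sets_eq)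
    then have "(LINT x:(\<Union>i. A i)|lborel. h x) = (\<Sum>i. (LINT x:(A i)|lborel. h x))"
      using union(1) by (intro lebesgue_integral_countable_add set_int) (auto simp: disjoint_family_on_def)
    then show ?case using union by simp
  qed
qed

lemma Ap_bop: "T \<in> Ap \<Longrightarrow> bop T"
  by (simp add: Ap_def wot_closure_def)

text \<open>A single matrix coefficient is continuous in the weak operator topology; the tolerance
  is the supposed nonzero value itself.\<close>

lemma Ap_annihilate:
  assumes T: "T \<in> Ap" and fg: "f \<in> L2" "g \<in> L2" and ann: "\<And>A. A \<in> gen_alg \<Longrightarrow> l2inner (A f) g = 0"
  shows "l2inner (T f) g = 0"
proof (rule ccontr)
  assume "l2inner (T f) g \<noteq> 0"
  then have e: "0 < cmod (l2inner (T f) g)" by simp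
  have "\<forall>F. finite F \<and> F \<subseteq> L2 \<times> L2 \<longrightarrow> (\<forall>e>0. \<exists>A\<in>gen_alg. \<forall>(f, g)\<in>F. cmod (l2inner (T f) g - l2inner (A f) g) < e)"
    using T unfolding Ap_def wot_closure_def by blast
  from this[rule_format, of "{(f, g)}", OF _ e] fg obtain A where "A \<in> gen_alg"
    "cmod (l2inner (T f) g - l2inner (A f) g) < cmod (l2inner (T f) g)" by auto
  then show False using ann by simp
qed

text \<open>Modulations preserve supports and translations by \<open>mu \<ge> 0\<close> move them to
  the right: the generators leave the nest of half-line subspaces invariant.\<close>

lemma gen_alg_support:
  assumes "A \<in> gen_alg" "f \<in> L2" "AE x in lborel. x < t \<longrightarrow> f x = 0"
  shows "AE x in lborel. x < t \<longrightarrow> A f x = 0"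
  using assms
proof (induction arbitrary: f rule: gen_alg.induct)
  case (gen_D mu)
  note [measurable] = L2_measurable[OF gen_D(2)]
  have "AE x in lborel. - mu + 1 * x < t \<longrightarrow> f (- mu + 1 * x) = 0"
    using gen_D(3) by (intro AE_borel_affine) auto
  then show ?case by eventually_elim (use gen_D(1) in \<open>auto simp: Dop_def\<close>)
next
  case (gen_add T S)
  from gen_add.IH(1)[OF gen_add.prems] gen_add.IH(2)[OF gen_add.prems] show ?case
    by eventually_elim (simp add: op_add_def)
next
  case (gen_scale T c)
  from gen_scale.IH[OF gen_scale.prems] show ?case
    by eventually_elim (simp add: op_scale_def)
next
  case (gen_mult T S)
  then show ?case by (simp add: gen_alg_L2)
qed (auto simp: Mop_def elim!: eventually_mono)

lemma Ap_triangular: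
  assumes T: "T \<in> Ap"
  shows "cinner (hat T (lcut {s..} x)) (lcut {..<s} y) = 0"
proof -
  obtain f g where fg: "f \<in> L2" "x = cls f" "g \<in> L2" "y = cls g" by (metis l2_cases)
  define f1 g1 where "f1 = (\<lambda>x. indicator {s..} x * f x)" and "g1 = (\<lambda>x. indicator {..<s} x * g x)"
  have fg1: "f1 \<in> L2" "g1 \<in> L2" unfolding f1_def g1_def using fg by (auto intro!: L2_bm_mult bm_indicator)
  have "l2inner (T f1) g1 = 0"
  proof (rule Ap_annihilate[OF T fg1])
    fix A assume A: "A \<in> gen_alg"
    have "AE x in lborel. x < s \<longrightarrow> A f1 x = 0"
      by (rule gen_alg_support[OF A fg1(1)]) (auto simp: f1_def indicator_def)
    then have "AE x in lborel. cnj (A f1 x) * g1 x = 0"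
      by eventually_elim (auto simp: g1_def indicator_def)
    then show "l2inner (A f1) g1 = 0"
      unfolding l2inner_def by (rule integral_eq_zero_AE)
  qed
  then show ?thesis
    using fg fg1 by (simp add: lcut_def bmult_cls bm_indicator hat_cls Ap_bop[OF T] cinner_cls bop_L2[OF Ap_bop[OF T]] flip: f1_def g1_def)
qed

lemma cut_split: "lcut {s..} x + lcut {..<s} x = x"
proof -
  obtain f where f: "f \<in> L2" "x = cls f" by (rule l2_cases)
  have "(\<lambda>x. indicator {s..} x * f x + indicator {..<s} x * f x) = f" by (auto simp: indicator_def fun_eq_iff)
  then show ?thesis
    using f by (simp add: lcut_def bmult_cls bm_indicator cls_add L2_bm_mult)
qed

text \<open>\<open>T\<close> and its adjoint are both lower triangular for the nest of half-lines, hence \<open>T\<close> commutes with all cut-offs; testing with \<open>{s..}\<close> gives the pointwise identity.\<close>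

lemma commuting_product:
  assumes T: "T \<in> Ap" and S: "S \<in> Ap" and adj: "\<forall>f\<in>L2. \<forall>g\<in>L2. l2inner (S f) g = l2inner f (T g)"
    and fg: "f \<in> L2" "g \<in> L2"
  shows "AE x in lborel. cnj (S f x) * g x = cnj (f x) * T g x"
proof -
  have adjH: "cinner (hat S x) y = cinner x (hat T y)" for x y
  proof -
    obtain f g where fg: "f \<in> L2" "x = cls f" "g \<in> L2" "y = cls g" by (metis l2_cases)
    then show ?thesis using adj[rule_format, OF fg(1,3)]
      by (simp add: hat_cls Ap_bop T S cinner_cls bop_L2[OF Ap_bop[OF T]] bop_L2[OF Ap_bop[OF S]])
  qed
  have key: "cinner (hat S x) (lcut {s..} y) = cinner (lcut {s..} x) (hat T y)" for x y s
  proof -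
    let ?P = "lcut {s..}" and ?P' = "lcut {..<s}"
    \<comment> \<open>Both arguments are split by the cut-off at \<open>s\<close>. One cross term
      vanishes by triangularity of \<open>T\<close>, read through the adjoint, and the other by
      triangularity of \<open>S\<close>.\<close>
    have "cinner (hat S x) (?P y) = cinner (hat S (?P x)) (?P y) + cinner (hat S (?P' x)) (?P y)"
      by (metis cut_split blinfun.add_right cinner_add_left)
    also have "cinner (hat S (?P' x)) (?P y) = cnj (cinner (hat T (?P y)) (?P' x))"
      by (metis adjH cinner_commute)
    also have "\<dots> = 0" by (simp add: Ap_triangular[OF T])
    also have "cinner (hat S (?P x)) (?P y) + 0 = cinner (?P x) (hat T (?P y)) + cinner (hat S (?P x)) (?P' y)"
      using Ap_triangular[OF S, of s x y] by (simp add: adjH)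
    also have "\<dots> = cinner (?P x) (hat T (?P y)) + cinner (?P x) (hat T (?P' y))" by (simp add: adjH)
    also have "\<dots> = cinner (?P x) (hat T y)" by (metis cut_split blinfun.add_right cinner_add_right)
    finally show ?thesis .
  qed
  have SfL: "S f \<in> L2" and TgL: "T g \<in> L2" using fg bop_L2[OF Ap_bop] T S by auto
  have "AE x in lborel. cnj (S f x) * g x - cnj (f x) * T g x = 0"
  proof (rule set_integral_zero_of_tails)
    show "integrable lborel (\<lambda>x. cnj (S f x) * g x - cnj (f x) * T g x)"
      by (intro Bochner_Integration.integrable_diff L2_integrable_inner fg SfL TgL)
    fix s :: real
    have EL: "(\<lambda>x. indicator {s..} x * g x) \<in> L2" "(\<lambda>x. indicator {s..} x * f x) \<in> L2"
      using fg by (auto intro!: L2_bm_mult bm_indicator)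
    have "l2inner (S f) (\<lambda>x. indicator {s..} x * g x) = l2inner (\<lambda>x. indicator {s..} x * f x) (T g)"
      using key[of "cls f" s "cls g"] fg EL
      by (simp add: lcut_def bmult_cls bm_indicator hat_cls Ap_bop T S cinner_cls SfL TgL)
    then have "(LINT x|lborel. cnj (S f x) * (indicator {s..} x * g x)) - (LINT x|lborel. cnj (indicator {s..} x * f x) * T g x) = 0"
      by (simp add: l2inner_def)
    also have "(LINT x|lborel. cnj (S f x) * (indicator {s..} x * g x)) - (LINT x|lborel. cnj (indicator {s..} x * f x) * T g x)
       = (LINT x|lborel. cnj (S f x) * (indicator {s..} x * g x) - cnj (indicator {s..} x * f x) * T g x)"
      by (rule Bochner_Integration.integral_diff[symmetric]) (intro L2_integrable_inner SfL TgL EL)+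
    also have "\<dots> = (LINT x:{s..}|lborel. cnj (S f x) * g x - cnj (f x) * T g x)"
      unfolding set_lebesgue_integral_def by (intro Bochner_Integration.integral_cong) (auto simp: indicator_def)
    finally show "(LINT x:{s..}|lborel. cnj (S f x) * g x - cnj (f x) * T g x) = 0" .
  qed
  then show ?thesis by simp
qed

section \<open>Cauchy kernels and the Hardy space\<close>

definition cauchy :: "complex \<Rightarrow> fn" where "cauchy z x = 1 / (complex_of_real x + z)"

text \<open>The pole is at \<open>-z\<close>, so a parameter in the upper half plane gives a
  function analytic on the closed upper half plane.\<close>

lemma cauchy_denom: "0 < Im z \<Longrightarrow> complex_of_real x + z \<noteq> 0"
  by (auto simp: complex_eq_iff)

lemma cauchy_L2: assumes "0 < Im z" shows "cauchy z \<in> L2"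
proof -
  have "cauchy z = (\<lambda>x. (1 / (\<i> * complex_of_real (Im z))) * mphi (Im z) (x - (- Re z)))"
  proof
    fix x
    have "complex_of_real x + z = (\<i> * complex_of_real (Im z)) * (1 - \<i> * complex_of_real ((x - (- Re z)) / Im z))"
      using assms by (simp add: complex_eq_iff)
    then show "cauchy z x = (1 / (\<i> * complex_of_real (Im z))) * mphi (Im z) (x - (- Re z))"
      unfolding cauchy_def mphi_def by (simp only: times_divide_times_eq mult_1)
  qed
  moreover have "(\<lambda>x. (1 / (\<i> * complex_of_real (Im z))) * mphi (Im z) (x - (- Re z))) \<in> L2"
    by (intro L2_scale L2_shift mphi_L2 assms)
  ultimately show ?thesis by (simp only:)
qed

text \<open>Cauchy theorem on a large half disc.\<close>

lemma hardy_integral: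
  assumes w: "0 < Im w" and z: "0 < Im z" and lam: "0 \<le> lam"
  shows "(LINT x|lborel. exp (\<i> * complex_of_real (lam * x)) * (cauchy w x * cauchy z x)) = 0"
proof -
  define h where "h \<zeta> = exp (\<i> * complex_of_real lam * \<zeta>) * (1 / (\<zeta> + w) * (1 / (\<zeta> + z)))" for \<zeta>
  define H where "H x = exp (\<i> * complex_of_real (lam * x)) * (cauchy w x * cauchy z x)" for x
  have Hh: "H x = h (complex_of_real x)" for x by (simp add: H_def h_def cauchy_def mult.assoc)
  have intH: "integrable lborel H"
    unfolding H_def
    using L2_integrable_mult[OF L2_bm_mult[OF bm_exp cauchy_L2[OF w]] cauchy_L2[OF z], of lam] by (simp add: mult.assoc)
  define \<epsilon> where "\<epsilon> = min (Im w) (Im z)"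
  have \<epsilon>: "0 < \<epsilon>" using w z by (simp add: \<epsilon>_def)
  \<comment> \<open>A half plane slightly larger than the closed upper one, still free of the poles
    \<open>-w\<close> and \<open>-z\<close>: convex and containing the whole contour.\<close>
  define U where "U = {\<zeta>. - \<epsilon> < Im \<zeta>}"
  have holo: "h holomorphic_on U"
    unfolding h_def
  proof (intro holomorphic_intros)
    fix \<zeta> assume "\<zeta> \<in> U"
    then show "\<zeta> + w \<noteq> 0" "\<zeta> + z \<noteq> 0" by (auto simp: U_def \<epsilon>_def complex_eq_iff)
  qed
  have convU: "convex U" unfolding U_def using convex_halfspace_Im_gt by blast
  \<comment> \<open>The two Cauchy factors decay like 1/R each against an arc of length pi R, and
    \<open>lam \<ge> 0\<close> keeps the exponential bounded by 1 on the arc.\<close>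
  have bound: "cmod (integral {- R..R} H) \<le> 1 / ((R - cmod w) * (R - cmod z)) * R * pi"
    if R: "0 < R" "cmod w < R" "cmod z < R" for R :: real
  proof -
    let ?l = "linepath (complex_of_real (- R)) (complex_of_real R)"
    let ?c = "part_circlepath 0 R 0 pi"
    have pc: "path_image ?c \<subseteq> {\<zeta>. 0 \<le> Im \<zeta> \<and> cmod \<zeta> = R}"
      using R by (auto simp: path_image_part_circlepath' closed_segment_eq_real_ivl norm_mult intro!: mult_nonneg_nonneg sin_ge_zero)
    have pl: "path_image ?l \<subseteq> {\<zeta>. Im \<zeta> = 0}"
      by (auto simp: closed_segment_def)
    have U1: "path_image ?c \<subseteq> U" "path_image ?l \<subseteq> U" using pc pl \<epsilon> by (auto simp: U_def)
    have c0: "(h has_contour_integral 0) (?l +++ ?c)"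
    proof (rule Cauchy_theorem_convex_simple[OF holo convU])
      show "valid_path (?l +++ ?c)" by (rule valid_path_join) auto
      show "path_image (?l +++ ?c) \<subseteq> U" using U1 by (rule_tac subset_path_image_join)
      show "pathfinish (?l +++ ?c) = pathstart (?l +++ ?c)" by (simp add: exp_pi_i')
    qed
    have cont: "continuous_on U h" using holo by (rule holomorphic_on_imp_continuous_on)
    have ic: "h contour_integrable_on ?c"
      by (intro contour_integrable_continuous_part_circlepath continuous_on_subset[OF cont] U1)
    have il: "h contour_integrable_on ?l"
      by (intro contour_integrable_continuous_linepath continuous_on_subset[OF cont]) (use U1(2) in simp)
    have "contour_integral ?l h + contour_integral ?c h = 0"
      using contour_integral_join[OF il ic] c0 by (simp add: contour_integral_unique)
    then have "integral {- R..R} H = - contour_integral ?c h"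
      using R contour_integral_linepath_Reals_eq[of "complex_of_real (- R)" "complex_of_real R" h]
      by (simp add: Hh[abs_def] eq_neg_iff_add_eq_0)
    moreover have "cmod (contour_integral ?c h) \<le> 1 / ((R - cmod w) * (R - cmod z)) * R * \<bar>pi - 0\<bar>"
    proof (rule contour_integral_bound_part_circlepath[OF ic])
      fix \<zeta> assume "\<zeta> \<in> path_image ?c"
      then have \<zeta>: "0 \<le> Im \<zeta>" "cmod \<zeta> = R" using pc by auto
      have 1: "R - cmod w \<le> cmod (\<zeta> + w)" "R - cmod z \<le> cmod (\<zeta> + z)"
        using norm_diff_ineq[of \<zeta> w] norm_diff_ineq[of \<zeta> z] \<zeta> by auto
      have "cmod (exp (\<i> * complex_of_real lam * \<zeta>)) \<le> 1"
        using lam \<zeta>(1) by (simp add: norm_exp_eq_Re)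
      then have "cmod (h \<zeta>) \<le> 1 * (1 / (R - cmod w) * (1 / (R - cmod z)))"
        unfolding h_def norm_mult norm_divide norm_one
        using 1 R by (intro mult_mono divide_left_mono) (auto intro!: mult_pos_pos)
      then show "cmod (h \<zeta>) \<le> 1 / ((R - cmod w) * (R - cmod z))" by simp
    qed (use R in auto)
    ultimately show ?thesis by simp
  qed
  have "(\<lambda>n. LINT x|lborel. indicator {- real n..real n} x *\<^sub>R H x) \<longlonglongrightarrow> (LINT x|lborel. H x)"
  proof (rule integral_dominated_convergence[where w = "\<lambda>x. norm (H x)"])
    show "AE x in lborel. (\<lambda>n. indicator {- real n..real n} x *\<^sub>R H x) \<longlonglongrightarrow> H x"
    proof (rule AE_I2, rule tendsto_eventually)
      fix x :: real
      obtain n0 where n0: "\<bar>x\<bar> \<le> real n0" using real_arch_simple by blast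
      show "\<forall>\<^sub>F n in sequentially. indicator {- real n..real n} x *\<^sub>R H x = H x"
        unfolding eventually_sequentially using n0 by (intro exI[of _ n0]) (auto simp: indicator_def)
    qed
    show "AE x in lborel. norm (indicator {- real n..real n} x *\<^sub>R H x) \<le> norm (H x)" for n
      by (intro AE_I2) (auto simp: indicator_def)
  qed (use intH in auto)
  moreover have "(LINT x|lborel. indicator {- real n..real n} x *\<^sub>R H x) = integral {- real n..real n} H" for n
  proof -
    have "set_integrable lborel {- real n..real n} H"
      using intH unfolding set_integrable_def by (intro integrable_mult_indicator) auto
    then show ?thesis using set_borel_integral_eq_integral(2)[of "{- real n..real n}" H] by (simp add: set_lebesgue_integral_def)
  qed
  ultimately have lim1: "(\<lambda>n. integral {- real n..real n} H) \<longlonglongrightarrow> (LINT x|lborel. H x)" by simp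
  have "(\<lambda>n. integral {- real n..real n} H) \<longlonglongrightarrow> 0"
  proof (rule Lim_null_comparison)
    have "\<forall>\<^sub>F n in sequentially. max 0 (max (cmod w) (cmod z)) < real n"
      using filterlim_real_sequentially unfolding filterlim_at_top_dense by blast
    then show "\<forall>\<^sub>F n in sequentially. cmod (integral {- real n..real n} H) \<le> 1 / ((real n - cmod w) * (real n - cmod z)) * real n * pi"
      by eventually_elim (rule bound; simp)
    show "(\<lambda>n. 1 / ((real n - cmod w) * (real n - cmod z)) * real n * pi) \<longlonglongrightarrow> 0" by real_asymp
  qed
  then show ?thesis using LIMSEQ_unique[OF lim1] by (simp add: H_def)
qed

text \<open>The Hardy space of the upper half plane, as the annihilator of a family that is visibly invariant under the adjoints of the generators.\<close>

definition hardy :: "fn set" where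
  "hardy = {f \<in> L2. \<forall>lam\<ge>0. \<forall>z. 0 < Im z \<longrightarrow> (LINT x|lborel. exp (\<i> * complex_of_real (lam * x)) * (f x * cauchy z x)) = 0}"

lemma hardyD:
  "f \<in> hardy \<Longrightarrow> 0 \<le> lam \<Longrightarrow> 0 < Im z \<Longrightarrow> (LINT x|lborel. exp (\<i> * complex_of_real (lam * x)) * (f x * cauchy z x)) = 0"
  unfolding hardy_def by blast

lemma hardyI:
  "f \<in> L2 \<Longrightarrow> (\<And>lam z. 0 \<le> lam \<Longrightarrow> 0 < Im z \<Longrightarrow> (LINT x|lborel. exp (\<i> * complex_of_real (lam * x)) * (f x * cauchy z x)) = 0) \<Longrightarrow> f \<in> hardy"
  unfolding hardy_def by blast

lemma cauchy_hardy: "0 < Im w \<Longrightarrow> cauchy w \<in> hardy"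
  unfolding hardy_def using hardy_integral cauchy_L2 by blast

lemma hardy_integrable:
  "f \<in> L2 \<Longrightarrow> 0 < Im z \<Longrightarrow> integrable lborel (\<lambda>x. exp (\<i> * complex_of_real (lam * x)) * (f x * cauchy z x))"
  using L2_integrable_mult[OF L2_bm_mult[OF bm_exp] cauchy_L2, of f z lam] by (simp add: mult.assoc)

text \<open>A modulation raises the frequency \<open>lam\<close>, and a translation by
  \<open>mu\<close> moves the parameter \<open>z\<close> by a real amount and produces a constant
  factor. The test family in \<open>hardy\<close> carries both parameters in order to be closed
  under these two moves.\<close>

lemma gen_alg_hardy: "A \<in> gen_alg \<Longrightarrow> f \<in> hardy \<Longrightarrow> A f \<in> hardy"
proof (induction arbitrary: f rule: gen_alg.induct)
  case (gen_M lam')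
  have "(LINT x|lborel. exp (\<i> * complex_of_real (lam * x)) * (Mop lam' f x * cauchy z x)) = 0" if "0 \<le> lam" "0 < Im z" for lam z
  proof -
    have "exp (\<i> * complex_of_real (lam * x)) * (Mop lam' f x * cauchy z x) = exp (\<i> * complex_of_real ((lam + lam') * x)) * (f x * cauchy z x)" for x
      by (simp add: Mop_def distrib_right distrib_left exp_add)
    then show ?thesis using hardyD[OF gen_M(2), of "lam + lam'" z] gen_M(1) that by (simp only: add_nonneg_nonneg)
  qed
  then show ?case using gen_M gen_alg_L2[OF gen_alg.gen_M[OF gen_M(1)]] by (intro hardyI) (auto simp: hardy_def)
next
  case (gen_D mu)
  have "(LINT x|lborel. exp (\<i> * complex_of_real (lam * x)) * (Dop mu f x * cauchy z x)) = 0" if "0 \<le> lam" "0 < Im z" for lam z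
  proof -
    let ?F = "\<lambda>x. exp (\<i> * complex_of_real (lam * x)) * (f x * cauchy (z + complex_of_real mu) x)"
    have "exp (\<i> * complex_of_real (lam * x)) * (Dop mu f x * cauchy z x) = exp (\<i> * complex_of_real (lam * mu)) * ?F (x - mu)" for x
      by (simp add: Dop_def cauchy_def algebra_simps flip: exp_add)
    then have "(LINT x|lborel. exp (\<i> * complex_of_real (lam * x)) * (Dop mu f x * cauchy z x)) = exp (\<i> * complex_of_real (lam * mu)) * (LINT x|lborel. ?F (x - mu))"
      by (simp only: integral_mult_right_zero)
    also have "(LINT x|lborel. ?F (x - mu)) = (LINT x|lborel. ?F x)" by (rule integral_shift)
    also have "\<dots> = 0" using that by (intro hardyD[OF gen_D(2)]) auto
    finally show ?thesis by simp
  qed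
  then show ?case using gen_D gen_alg_L2[OF gen_alg.gen_D[OF gen_D(1)]] by (intro hardyI) (auto simp: hardy_def)
next
  case (gen_add T S)
  have L: "T f \<in> hardy" "S f \<in> hardy" using gen_add by auto
  then have L2: "T f \<in> L2" "S f \<in> L2" by (auto simp: hardy_def)
  have "(LINT x|lborel. exp (\<i> * complex_of_real (lam * x)) * (op_add T S f x * cauchy z x)) = 0" if "0 \<le> lam" "0 < Im z" for lam z
  proof -
    have "(LINT x|lborel. exp (\<i> * complex_of_real (lam * x)) * (op_add T S f x * cauchy z x))
       = (LINT x|lborel. exp (\<i> * complex_of_real (lam * x)) * (T f x * cauchy z x) + exp (\<i> * complex_of_real (lam * x)) * (S f x * cauchy z x))"
      by (simp add: op_add_def algebra_simps)
    also have "\<dots> = 0"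
      using L that by (subst Bochner_Integration.integral_add[OF hardy_integrable[OF L2(1) that(2)] hardy_integrable[OF L2(2) that(2)]]) (simp only: hardyD[OF L(1) that] hardyD[OF L(2) that] add_0)
    finally show ?thesis .
  qed
  then show ?case using L2_add[OF L2] by (intro hardyI) (auto simp: op_add_def)
next
  case (gen_scale T c)
  have L: "T f \<in> hardy" using gen_scale by auto
  have "(LINT x|lborel. exp (\<i> * complex_of_real (lam * x)) * (op_scale c T f x * cauchy z x)) = 0" if "0 \<le> lam" "0 < Im z" for lam z
  proof -
    have "exp (\<i> * complex_of_real (lam * x)) * (op_scale c T f x * cauchy z x) = c * (exp (\<i> * complex_of_real (lam * x)) * (T f x * cauchy z x))" for x
      by (simp add: op_scale_def)
    then have "(LINT x|lborel. exp (\<i> * complex_of_real (lam * x)) * (op_scale c T f x * cauchy z x)) = c * (LINT x|lborel. exp (\<i> * complex_of_real (lam * x)) * (T f x * cauchy z x))"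
      by (simp only: integral_mult_right_zero)
    then show ?thesis by (simp only: hardyD[OF L that] mult_zero_right)
  qed
  then show ?case using L L2_scale[of "T f" c] by (intro hardyI) (auto simp: hardy_def op_scale_def)
qed simp

lemma Ap_hardy:
  assumes T: "T \<in> Ap" and f: "f \<in> hardy" and z: "0 < Im z"
  shows "(LINT x|lborel. T f x * cauchy z x) = 0"
proof -
  have fL: "f \<in> L2" using f by (simp add: hardy_def)
  have "l2inner (T f) (\<lambda>x. cnj (cauchy z x)) = 0"
  proof (rule Ap_annihilate[OF T fL L2_cnj[OF cauchy_L2[OF z]]])
    fix A assume "A \<in> gen_alg"
    then have "A f \<in> hardy" using gen_alg_hardy f by blast
    then have "(LINT x|lborel. exp (\<i> * complex_of_real (0 * x)) * (A f x * cauchy z x)) = 0"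
      using z unfolding hardy_def by blast
    then have "cnj (LINT x|lborel. A f x * cauchy z x) = 0" by simp
    then show "l2inner (A f) (\<lambda>x. cnj (cauchy z x)) = 0"
      unfolding l2inner_def Bochner_Integration.integral_cnj[symmetric] by simp
  qed
  then have "cnj (LINT x|lborel. T f x * cauchy z x) = 0"
    unfolding l2inner_def Bochner_Integration.integral_cnj[symmetric] by simp
  then show ?thesis by simp
qed

section \<open>Poisson kernels\<close>

definition poisson :: "real \<Rightarrow> real \<Rightarrow> real \<Rightarrow> real" where
  "poisson s y x = y / ((x - s)\<^sup>2 + y\<^sup>2)"

lemma poisson_measurable [measurable]: "poisson s y \<in> borel_measurable borel"
  unfolding poisson_def[abs_def] by measurable

lemma poisson_nonneg: "0 < y \<Longrightarrow> 0 \<le> poisson s y x"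
  by (simp add: poisson_def)

text \<open>The first form, an imaginary part, lets two Poisson kernels be compared through
  differences of Cauchy kernels; the second, a squared modulus, gives integrability against
  \<open>\<psi>\<close>.\<close>

lemma poisson_cauchy:
  assumes y: "0 < y"
  shows "complex_of_real (poisson s y x) = (cnj (cauchy (Complex (- s) y) x) - cauchy (Complex (- s) y) x) / (2 * \<i>)"
    and "complex_of_real (poisson s y x) = complex_of_real y * (cnj (cauchy (Complex (- s) y) x) * cauchy (Complex (- s) y) x)"
proof -
  define d where "d = complex_of_real x + Complex (- s) y"
  have d: "d \<noteq> 0" unfolding d_def using cauchy_denom[of "Complex (- s) y" x] y by auto
  then have d': "cnj d \<noteq> 0" by simp
  have dd: "d * cnj d = complex_of_real ((x - s)\<^sup>2 + y\<^sup>2)" "d - cnj d = 2 * \<i> * complex_of_real y"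
    by (auto simp: d_def complex_eq_iff power2_eq_square algebra_simps)
  have c: "cauchy (Complex (- s) y) x = 1 / d" "cnj (cauchy (Complex (- s) y) x) = 1 / cnj d"
    by (simp_all add: cauchy_def d_def)
  have p: "complex_of_real (poisson s y x) = complex_of_real y / (d * cnj d)"
    by (simp only: dd poisson_def of_real_divide)
  show "complex_of_real (poisson s y x) = complex_of_real y * (cnj (cauchy (Complex (- s) y) x) * cauchy (Complex (- s) y) x)"
    unfolding c p by (simp add: mult.commute)
  have "(1 / cnj d - 1 / d) = (d - cnj d) / (d * cnj d)" using d d' by (simp add: field_simps)
  then show "complex_of_real (poisson s y x) = (cnj (cauchy (Complex (- s) y) x) - cauchy (Complex (- s) y) x) / (2 * \<i>)"
    unfolding c p dd(2) by simp
qed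

text \<open>For such \<open>x\<close> the distance to \<open>s\<close> is at least |x|/2 and x^2
  exceeds 1, so the kernel is at most 4 / x^2, hence at most 8 / (x^2 + 1), uniformly in
  \<open>s\<close> and \<open>y\<close>.\<close>

lemma poisson_bound:
  assumes s: "a \<le> s" "s \<le> b" and y: "0 < y" "y \<le> 1" and x: "2 * (\<bar>a\<bar> + \<bar>b\<bar>) + 1 < \<bar>x\<bar>"
  shows "poisson s y x \<le> 8 * poisson 0 1 x"
proof -
  have "\<bar>s\<bar> \<le> \<bar>a\<bar> + \<bar>b\<bar>" using s by linarith
  moreover have "\<bar>x\<bar> \<le> \<bar>x - s\<bar> + \<bar>s\<bar>" by linarith
  moreover have "u / 2 \<le> p" if "v \<le> q" "u \<le> p + v" "2 * q + 1 < u" "0 \<le> q" for u v p q :: real using that by linarith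
  ultimately have xs: "\<bar>x\<bar> / 2 \<le> \<bar>x - s\<bar>" using x by (metis abs_ge_zero add_nonneg_nonneg)
  then have "(\<bar>x\<bar> / 2)\<^sup>2 \<le> \<bar>x - s\<bar>\<^sup>2" by (rule power_mono) simp
  then have sq: "x\<^sup>2 / 4 \<le> (x - s)\<^sup>2" by (simp add: power_divide)
  have "0 \<le> 2 * (\<bar>a\<bar> + \<bar>b\<bar>)" by simp
  then have "1 < \<bar>x\<bar>" using le_less_trans[OF _ x, of 1] by simp
  then have x1: "1 < x\<^sup>2" using power_strict_mono[of 1 "\<bar>x\<bar>" 2] by simp
  have "poisson s y x \<le> 1 / (x\<^sup>2 / 4)"
    unfolding poisson_def
  proof (rule frac_le)
    show "x\<^sup>2 / 4 \<le> (x - s)\<^sup>2 + y\<^sup>2" using sq zero_le_power2[of y] by linarith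
  qed (use y x1 in auto)
  also have "\<dots> \<le> 8 * poisson 0 1 x"
  proof -
    have "0 < x\<^sup>2" "0 < x\<^sup>2 + 1" using x1 by linarith+
    then have "4 / x\<^sup>2 \<le> 8 / (x\<^sup>2 + 1)" using x1 by (subst frac_le_eq) (auto simp: divide_nonpos_pos)
    then show ?thesis by (simp add: poisson_def)
  qed
  finally show ?thesis .
qed

text \<open>The angle under which the interval from \<open>a\<close> to \<open>b\<close> is seen
  from x + i y. As \<open>poisson\<close> is not divided by pi, the full angle is pi.\<close>

definition poisson_int :: "real \<Rightarrow> real \<Rightarrow> real \<Rightarrow> real \<Rightarrow> real" where
  "poisson_int a b y x = arctan ((b - x) / y) - arctan ((a - x) / y)"

lemma poisson_int_integral:
  assumes "a \<le> b" "0 < y"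
  shows "has_bochner_integral lborel (\<lambda>s. poisson s y x * indicator {a..b} s) (poisson_int a b y x)"
  unfolding poisson_int_def
proof (rule has_bochner_integral_FTC_Icc_real)
  fix s
  have "((\<lambda>s. arctan ((s - x) / y)) has_real_derivative (1 / y) / (1 + ((s - x) / y)\<^sup>2)) (at s)"
    using assms by (auto intro!: derivative_eq_intros simp: inverse_eq_divide)
  moreover have "(1 / y) / (1 + ((s - x) / y)\<^sup>2) = poisson s y x"
  proof -
    have "0 < (s - x)\<^sup>2 + y\<^sup>2" using assms by (simp add: add_nonneg_pos)
    then show ?thesis using assms by (simp add: poisson_def power_divide divide_simps power2_eq_square) (simp add: algebra_simps)
  qed
  ultimately show "((\<lambda>s. arctan ((s - x) / y)) has_real_derivative poisson s y x) (at s)" by simp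
  have "(x - s)\<^sup>2 + y\<^sup>2 \<noteq> 0" for s using assms by (metis add_nonneg_pos less_irrefl zero_le_power2 zero_less_power)
  then show "isCont (\<lambda>s. poisson s y x) s" unfolding poisson_def by (intro continuous_intros) auto
qed (use assms in auto)

text \<open>A dominating function uniform in \<open>y\<close>. Near the interval the angle is at
  most pi and \<open>poisson 0 1\<close> is bounded below; far away \<open>poisson_bound\<close> is
  integrated over the interval. The constant adds the two cases.\<close>

lemma poisson_int_bound:
  assumes ab: "a \<le> b" and y: "0 < y" "y \<le> 1"
  shows "0 \<le> poisson_int a b y x" "poisson_int a b y x \<le> (pi * (1 + (2 * (\<bar>a\<bar> + \<bar>b\<bar>) + 1)\<^sup>2) + 8 * (b - a)) * poisson 0 1 x"
proof -
  define M where "M = 2 * (\<bar>a\<bar> + \<bar>b\<bar>) + 1"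
  have "(a - x) / y \<le> (b - x) / y" using ab y by (simp add: divide_right_mono)
  then show "0 \<le> poisson_int a b y x" by (simp add: poisson_int_def arctan_le_iff)
  have pkp: "0 < poisson 0 1 x" by (simp add: poisson_def add_nonneg_pos)
  have "poisson_int a b y x \<le> pi * (1 + M\<^sup>2) * poisson 0 1 x \<or> poisson_int a b y x \<le> 8 * (b - a) * poisson 0 1 x"
  proof (cases "\<bar>x\<bar> \<le> M")
    case True
    have "poisson_int a b y x \<le> pi" unfolding poisson_int_def using arctan_ubound[of "(b - x) / y"] arctan_lbound[of "(a - x) / y"] by linarith
    moreover have "x\<^sup>2 \<le> M\<^sup>2" using True by (metis abs_ge_zero power2_abs power_mono)
    then have "1 \<le> (1 + M\<^sup>2) * poisson 0 1 x"
      by (simp add: poisson_def pos_le_divide_eq add_nonneg_pos)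
    then have "pi * 1 \<le> pi * ((1 + M\<^sup>2) * poisson 0 1 x)" by (intro mult_left_mono) auto
    ultimately have "poisson_int a b y x \<le> pi * ((1 + M\<^sup>2) * poisson 0 1 x)" by linarith
    then show ?thesis by (intro disjI1) (simp only: mult.assoc)
  next
    case False
    have "poisson_int a b y x = (LINT s|lborel. poisson s y x * indicator {a..b} s)"
      using poisson_int_integral[OF ab y(1)] by (simp add: has_bochner_integral_iff)
    also have "\<dots> \<le> (LINT s|lborel. (8 * poisson 0 1 x) * indicator {a..b} s)"
    proof (rule integral_mono)
      show "integrable lborel (\<lambda>s. poisson s y x * indicator {a..b} s)"
        using poisson_int_integral[OF ab y(1)] by (simp add: has_bochner_integral_iff)
      show "poisson s y x * indicator {a..b} s \<le> (8 * poisson 0 1 x) * indicator {a..b} s" for s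
        using poisson_bound[of a s b y x] y False by (auto simp: indicator_def M_def)
      show "integrable lborel (\<lambda>s. (8 * poisson 0 1 x) * indicator {a..b} s)"
        using ab by (intro integrable_mult_right integrable_real_indicator) auto
    qed
    also have "\<dots> = 8 * (b - a) * poisson 0 1 x" using ab by simp
    finally show ?thesis by simp
  qed
  moreover have "0 \<le> pi * (1 + M\<^sup>2) * poisson 0 1 x" "0 \<le> 8 * (b - a) * poisson 0 1 x"
    using pkp ab by (auto intro!: mult_nonneg_nonneg add_nonneg_nonneg)
  ultimately have "poisson_int a b y x \<le> pi * (1 + M\<^sup>2) * poisson 0 1 x + 8 * (b - a) * poisson 0 1 x" by linarith
  then show "poisson_int a b y x \<le> (pi * (1 + (2 * (\<bar>a\<bar> + \<bar>b\<bar>) + 1)\<^sup>2) + 8 * (b - a)) * poisson 0 1 x"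
    by (simp only: M_def distrib_right)
qed

lemma arctan_scaled_tendsto:
  "u \<noteq> 0 \<Longrightarrow> (\<lambda>n. arctan (u / (1 / (real n + 1)))) \<longlonglongrightarrow> sgn u * (pi / 2)"
proof (cases "0 < u")
  case True
  then have "(\<lambda>n. arctan (u / (1 / (real n + 1)))) \<longlonglongrightarrow> pi / 2" by real_asymp
  then show ?thesis using True by simp
next
  case False
  assume "u \<noteq> 0"
  then have "u < 0" using False by simp
  then have "(\<lambda>n. arctan (u / (1 / (real n + 1)))) \<longlonglongrightarrow> - (pi / 2)" by real_asymp
  then show ?thesis using \<open>u < 0\<close> by simp
qed

text \<open>At an endpoint of a nondegenerate interval only half the angle survives; the two
  endpoints form a null set for the later integration.\<close>

lemma poisson_int_tendsto:
  assumes "a \<le> b" "x \<noteq> a" "x \<noteq> b"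
  shows "(\<lambda>n. poisson_int a b (1 / (real n + 1)) x) \<longlonglongrightarrow> pi * indicator {a..<b} x"
proof -
  have "(\<lambda>n. poisson_int a b (1 / (real n + 1)) x) \<longlonglongrightarrow> sgn (b - x) * (pi / 2) - sgn (a - x) * (pi / 2)"
    unfolding poisson_int_def using assms by (intro tendsto_diff arctan_scaled_tendsto) auto
  moreover have "sgn (b - x) * (pi / 2) - sgn (a - x) * (pi / 2) = pi * indicator {a..<b} x"
    using assms by (auto simp: indicator_def sgn_if)
  ultimately show ?thesis by simp
qed

text \<open>\<open>c0 / pi\<close> is the constant value of the Poisson integral of \<open>\<psi>\<close>. Averaging the Poisson kernel over \<open>{a..b}\<close> gives \<open>poisson_int\<close>, an approximate indicator as \<open>y \<rightarrow> 0\<close>.\<close>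

lemma poisson_constant:
  fixes \<psi> :: fn
  assumes [measurable]: "\<psi> \<in> borel_measurable borel"
    and int: "integrable lborel (\<lambda>x. \<psi> x * complex_of_real (poisson 0 1 x))"
    and const: "\<And>s y. 0 < y \<Longrightarrow> (LINT x|lborel. \<psi> x * complex_of_real (poisson s y x)) = c0"
    and ab: "a \<le> b"
  shows "integrable lborel (\<lambda>x. indicator {a..<b} x * \<psi> x)"
    and "(LINT x|lborel. indicator {a..<b} x * \<psi> x) = c0 / pi * complex_of_real (b - a)"
proof -
  define C where "C = pi * (1 + (2 * (\<bar>a\<bar> + \<bar>b\<bar>) + 1)\<^sup>2) + 8 * (b - a)"
  define y where "y n = 1 / (real n + 1)" for n :: nat
  have y: "0 < y n" "y n \<le> 1" for n by (auto simp: y_def)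
  have th: "0 \<le> poisson_int a b (y n) x" "poisson_int a b (y n) x \<le> C * poisson 0 1 x" for n x
    unfolding C_def using poisson_int_bound[OF ab y] by auto
  have [measurable]: "poisson_int a b y \<in> borel_measurable borel" for y unfolding poisson_int_def[abs_def] by measurable
  have dom: "integrable lborel (\<lambda>x. cmod (\<psi> x) * (C * poisson 0 1 x))"
    using integrable_mult_right[OF integrable_norm[OF int], of C] poisson_nonneg[of 1 0]
    by (simp add: norm_mult mult.left_commute)
  have domle: "cmod (\<psi> x * complex_of_real (poisson_int a b (y n) x)) \<le> cmod (\<psi> x) * (C * poisson 0 1 x)" for n x
    using th[of n x] by (simp add: norm_mult mult_left_mono)
  have lhs: "(LINT x|lborel. \<psi> x * complex_of_real (poisson_int a b (y n) x)) = c0 * complex_of_real (b - a)" for n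
  proof -
    \<comment> \<open>Fubini: integrating over \<open>x\<close> first gives the constant
      \<open>c0\<close> for every \<open>s\<close>, integrating over \<open>s\<close> first gives
      \<open>poisson_int\<close>.\<close>
    let ?F = "\<lambda>x s. \<psi> x * complex_of_real (poisson s (y n) x * indicator {a..b} s)"
    have mF [measurable]: "(\<lambda>(x, s). ?F x s) \<in> borel_measurable (lborel \<Otimes>\<^sub>M lborel)"
      unfolding poisson_def by measurable
    have "integrable (lborel \<Otimes>\<^sub>M lborel) (case_prod ?F)"
    proof (rule lborel_pair.Fubini_integrable)
      have "(LINT s|lborel. norm (case_prod ?F (x, s))) = cmod (\<psi> x) * poisson_int a b (y n) x" for x
      proof -
        have "norm (case_prod ?F (x, s)) = cmod (\<psi> x) * (poisson s (y n) x * indicator {a..b} s)" for s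
          using poisson_nonneg[OF y(1)[of n], of s x] by (simp add: norm_mult abs_mult)
        then show ?thesis using poisson_int_integral[OF ab y(1)[of n], of x] by (simp add: has_bochner_integral_iff)
      qed
      moreover have "integrable lborel (\<lambda>x. cmod (\<psi> x) * poisson_int a b (y n) x)"
      proof (rule Bochner_Integration.integrable_bound[OF dom])
        show "AE x in lborel. norm (cmod (\<psi> x) * poisson_int a b (y n) x) \<le> norm (cmod (\<psi> x) * (C * poisson 0 1 x))"
        proof (rule AE_I2)
          fix x
          have "0 \<le> cmod (\<psi> x) * poisson_int a b (y n) x" "cmod (\<psi> x) * poisson_int a b (y n) x \<le> cmod (\<psi> x) * (C * poisson 0 1 x)"
            using th[of n x] by (auto intro!: mult_left_mono mult_nonneg_nonneg)
          then show "norm (cmod (\<psi> x) * poisson_int a b (y n) x) \<le> norm (cmod (\<psi> x) * (C * poisson 0 1 x))"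
            unfolding real_norm_def by linarith
        qed
      qed measurable
      ultimately show "integrable lborel (\<lambda>x. LINT s|lborel. norm (case_prod ?F (x, s)))" by simp
      show "AE x in lborel. integrable lborel (\<lambda>s. case_prod ?F (x, s))"
        using poisson_int_integral[OF ab y(1)] by (intro AE_I2) (simp add: has_bochner_integral_iff del: of_real_mult)
    qed (use mF in simp)
    from lborel_pair.Fubini_integral[OF this]
    have "(LINT s|lborel. (LINT x|lborel. ?F x s)) = (LINT x|lborel. (LINT s|lborel. ?F x s))" .
    also have "(\<lambda>x. LINT s|lborel. ?F x s) = (\<lambda>x. \<psi> x * complex_of_real (poisson_int a b (y n) x))"
      using poisson_int_integral[OF ab y(1)] by (simp add: fun_eq_iff has_bochner_integral_iff del: of_real_mult)
    also have "(\<lambda>s. LINT x|lborel. ?F x s) = (\<lambda>s. c0 * complex_of_real (indicator {a..b} s))"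
    proof
      fix s
      have "?F x s = (\<psi> x * complex_of_real (poisson s (y n) x)) * complex_of_real (indicator {a..b} s)" for x by simp
      then have "(LINT x|lborel. ?F x s) = (LINT x|lborel. \<psi> x * complex_of_real (poisson s (y n) x)) * complex_of_real (indicator {a..b} s)"
        by (simp only: integral_mult_left_zero)
      then show "(LINT x|lborel. ?F x s) = c0 * complex_of_real (indicator {a..b} s)" by (simp only: const[OF y(1)])
    qed
    also have "(LINT s|lborel. c0 * complex_of_real (indicator {a..b} s)) = c0 * complex_of_real (b - a)"
      using ab by simp
    finally show ?thesis by simp
  qed
  have "(\<lambda>n. LINT x|lborel. \<psi> x * complex_of_real (poisson_int a b (y n) x)) \<longlonglongrightarrow> (LINT x|lborel. \<psi> x * complex_of_real (pi * indicator {a..<b} x))"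
  proof (rule integral_dominated_convergence[OF _ _ dom])
    have "AE x in lborel. x \<noteq> a \<and> x \<noteq> b" using AE_lborel_singleton[of a] AE_lborel_singleton[of b] by eventually_elim simp
    then show "AE x in lborel. (\<lambda>n. \<psi> x * complex_of_real (poisson_int a b (y n) x)) \<longlonglongrightarrow> \<psi> x * complex_of_real (pi * indicator {a..<b} x)"
    proof eventually_elim
      case (elim x)
      then show ?case unfolding y_def by (intro tendsto_intros poisson_int_tendsto ab) auto
    qed
    show "AE x in lborel. norm (\<psi> x * complex_of_real (poisson_int a b (y n) x)) \<le> cmod (\<psi> x) * (C * poisson 0 1 x)" for n
      using domle by (intro AE_I2) auto
  qed auto
  then have "(LINT x|lborel. \<psi> x * complex_of_real (pi * indicator {a..<b} x)) = c0 * complex_of_real (b - a)"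
    by (simp add: lhs LIMSEQ_const_iff)
  moreover have "\<psi> x * complex_of_real (pi * indicator {a..<b} x) = complex_of_real pi * (indicator {a..<b} x * \<psi> x)" for x
    by (simp add: indicator_def)
  ultimately have "complex_of_real pi * (LINT x|lborel. indicator {a..<b} x * \<psi> x) = c0 * complex_of_real (b - a)"
    by (simp only: integral_mult_right_zero)
  then show "(LINT x|lborel. indicator {a..<b} x * \<psi> x) = c0 / pi * complex_of_real (b - a)"
    by (simp add: field_simps)
  show "integrable lborel (\<lambda>x. indicator {a..<b} x * \<psi> x)"
  proof (rule Bochner_Integration.integrable_bound)
    \<comment> \<open>On the interval 1 + x^2 is at most \<open>D\<close>, so
      \<open>poisson 0 1\<close> is at least 1/D there and local integrability follows from the
      weighted one.\<close>
    define D where "D = 1 + (\<bar>a\<bar> + \<bar>b\<bar>)\<^sup>2"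
    show "integrable lborel (\<lambda>x. D * cmod (\<psi> x * complex_of_real (poisson 0 1 x)))" using int by simp
    show "AE x in lborel. norm (indicator {a..<b} x * \<psi> x) \<le> norm (D * cmod (\<psi> x * complex_of_real (poisson 0 1 x)))"
    proof (rule AE_I2)
      fix x
      have D0: "0 \<le> D" by (simp add: D_def)
      show "norm (indicator {a..<b} x * \<psi> x) \<le> norm (D * cmod (\<psi> x * complex_of_real (poisson 0 1 x)))"
      proof (cases "x \<in> {a..<b}")
        case True
        then have "\<bar>x\<bar> \<le> \<bar>a\<bar> + \<bar>b\<bar>" by auto
        then have "x\<^sup>2 \<le> (\<bar>a\<bar> + \<bar>b\<bar>)\<^sup>2" by (metis abs_ge_zero power2_abs power_mono)
        then have "1 \<le> D * poisson 0 1 x" by (simp add: D_def poisson_def pos_le_divide_eq add_nonneg_pos)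
        then have "cmod (\<psi> x) * 1 \<le> cmod (\<psi> x) * (D * poisson 0 1 x)" by (intro mult_left_mono) auto
        then show ?thesis using True D0 poisson_nonneg[of 1 0 x] by (simp add: norm_mult abs_mult ac_simps)
      qed simp
    qed
  qed measurable
qed

text \<open>\<open>T\<close> is multiplication by some \<open>\<psi>\<close>. Both \<open>\<psi>\<close> and its conjugate preserve the Hardy space, so \<open>\<psi>\<close> annihilates all products of two Cauchy kernels with poles on the same side of the real line. Differences of Poisson kernels are combinations of such products.\<close>

theorem Ap_selfadjoint_scalar:
  assumes T: "T \<in> Ap" and S: "S \<in> Ap" and adj: "is_adjoint T S"
  obtains c where "op_eq T (op_scale c id)"
proof -
  have adj': "\<forall>f\<in>L2. \<forall>g\<in>L2. l2inner (S f) g = l2inner f (T g)"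
    using adj by (simp add: is_adjoint_def)
  \<comment> \<open>A nowhere vanishing square-integrable function in place of the constant 1, which
    is not in \<open>L2\<close>; dividing by it recovers the multiplier.\<close>
  define p where "p = mphi 1"
  have p: "p \<in> L2" "p x \<noteq> 0" for x using mphi_L2[of 1] mphi_denom(1)[of x] by (auto simp: p_def mphi_def)
  have SpL: "S p \<in> L2" using bop_L2[OF Ap_bop[OF S] p(1)] .
  define \<psi> where "\<psi> x = cnj (S p x) / cnj (p x)" for x
  note [measurable] = L2_measurable[OF p(1)] L2_measurable[OF SpL]
  have \<psi>m [measurable]: "\<psi> \<in> borel_measurable borel" unfolding \<psi>_def by measurable
  have T\<psi>: "AE x in lborel. T g x = \<psi> x * g x" if "g \<in> L2" for g
    using commuting_product[OF T S adj' p(1) that] by eventually_elim (simp add: \<psi>_def p field_simps)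
  have S\<psi>: "AE x in lborel. S f x = cnj (\<psi> x) * f x" if "f \<in> L2" for f
    using commuting_product[OF T S adj' that p(1)] T\<psi>[OF p(1)]
  proof eventually_elim
    case (elim x)
    then have "cnj (S f x) * p x = (cnj (f x) * \<psi> x) * p x" by simp
    then have "cnj (S f x) = cnj (f x) * \<psi> x" using p(2)[of x] by simp
    then show ?case by (metis complex_cnj_cnj complex_cnj_mult mult.commute)
  qed
  \<comment> \<open>Boundedness of \<open>\<psi>\<close> has not been established, so membership in
    \<open>L2\<close> is inherited from \<open>T g\<close>.\<close>
  have T\<psi>L: "(\<lambda>x. \<psi> x * g x) \<in> L2" if "g \<in> L2" for g
  proof -
    note [measurable] = L2_measurable[OF that]
    have TgL: "T g \<in> L2" using bop_L2[OF Ap_bop[OF T] that] .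
    note [measurable] = L2_measurable[OF TgL]
    have "integrable lborel (\<lambda>x. (cmod (\<psi> x * g x))\<^sup>2)"
    proof (rule integrable_cong_AE_imp[OF L2_integrable_square[OF TgL]])
      show "AE x in lborel. (cmod (T g x))\<^sup>2 = (cmod (\<psi> x * g x))\<^sup>2" using T\<psi>[OF that] by eventually_elim simp
    qed measurable
    then show ?thesis by (simp add: L2_def)
  qed
  have orth: "(LINT x|lborel. \<psi> x * (cauchy w x * cauchy z x)) = 0" if "0 < Im w" "0 < Im z" for w z
  proof -
    note [measurable] = L2_measurable[OF cauchy_L2[OF that(1)]] L2_measurable[OF cauchy_L2[OF that(2)]]
      L2_measurable[OF bop_L2[OF Ap_bop[OF T] cauchy_L2[OF that(1)]]]
    have "(LINT x|lborel. \<psi> x * (cauchy w x * cauchy z x)) = (LINT x|lborel. T (cauchy w) x * cauchy z x)"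
      using T\<psi>[OF cauchy_L2[OF that(1)]] by (intro integral_cong_AE) (auto elim: eventually_mono)
    then show ?thesis using Ap_hardy[OF T cauchy_hardy[OF that(1)] that(2)] by simp
  qed
  have orth': "(LINT x|lborel. \<psi> x * cnj (cauchy w x * cauchy z x)) = 0" if "0 < Im w" "0 < Im z" for w z
  proof -
    note [measurable] = L2_measurable[OF cauchy_L2[OF that(1)]] L2_measurable[OF cauchy_L2[OF that(2)]]
      L2_measurable[OF bop_L2[OF Ap_bop[OF S] cauchy_L2[OF that(1)]]]
    have "(LINT x|lborel. cnj (\<psi> x) * (cauchy w x * cauchy z x)) = (LINT x|lborel. S (cauchy w) x * cauchy z x)"
      using S\<psi>[OF cauchy_L2[OF that(1)]] by (intro integral_cong_AE) (auto elim: eventually_mono)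
    then have "cnj (LINT x|lborel. cnj (\<psi> x) * (cauchy w x * cauchy z x)) = 0"
      using Ap_hardy[OF S cauchy_hardy[OF that(1)] that(2)] by simp
    then show ?thesis unfolding Bochner_Integration.integral_cnj[symmetric] by simp
  qed
  have i1: "integrable lborel (\<lambda>x. \<psi> x * (cauchy w x * cauchy z x))" "integrable lborel (\<lambda>x. \<psi> x * cnj (cauchy w x * cauchy z x))"
    "integrable lborel (\<lambda>x. \<psi> x * (cnj (cauchy w x) * cauchy z x))"
    if "0 < Im w" "0 < Im z" for w z
    using L2_integrable_mult[OF T\<psi>L[OF cauchy_L2[OF that(1)]] cauchy_L2[OF that(2)]]
      L2_integrable_mult[OF T\<psi>L[OF L2_cnj[OF cauchy_L2[OF that(1)]]] L2_cnj[OF cauchy_L2[OF that(2)]]]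
      L2_integrable_mult[OF T\<psi>L[OF L2_cnj[OF cauchy_L2[OF that(1)]]] cauchy_L2[OF that(2)]]
    by (simp_all add: mult.assoc)
  have ip: "integrable lborel (\<lambda>x. \<psi> x * complex_of_real (poisson s y x))" if "0 < y" for s y
  proof -
    have "integrable lborel (\<lambda>x. complex_of_real y * (\<psi> x * (cnj (cauchy (Complex (- s) y) x) * cauchy (Complex (- s) y) x)))"
      using that by (intro integrable_mult_right i1) auto
    then show ?thesis unfolding poisson_cauchy(2)[OF that] by (simp only: mult.left_commute)
  qed
  define c0 where "c0 = (LINT x|lborel. \<psi> x * complex_of_real (poisson 0 1 x))"
  have const: "(LINT x|lborel. \<psi> x * complex_of_real (poisson s y x)) = c0" if y: "0 < y" for s y
  proof -
    \<comment> \<open>The parameters whose Cauchy kernels belong to the Poisson kernels at s + i y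
      and at i.\<close>
    define z w where "z = Complex (- s) y" and "w = Complex (- 0) 1"
    have zw: "0 < Im z" "0 < Im w" using y by (auto simp: z_def w_def)
    have "\<psi> x * complex_of_real (poisson s y x) - \<psi> x * complex_of_real (poisson 0 1 x)
       = ((cnj w - cnj z) / (2 * \<i>)) * (\<psi> x * cnj (cauchy w x * cauchy z x)) - ((w - z) / (2 * \<i>)) * (\<psi> x * (cauchy w x * cauchy z x))" for x
    proof -
      have d: "cauchy z x - cauchy w x = (w - z) * (cauchy w x * cauchy z x)"
        using cauchy_denom[OF zw(1), of x] cauchy_denom[OF zw(2), of x] by (simp add: cauchy_def field_simps)
      have d': "cnj (cauchy z x) - cnj (cauchy w x) = (cnj w - cnj z) * cnj (cauchy w x * cauchy z x)"
        using arg_cong[OF d, of cnj] by simp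
      have "complex_of_real (poisson s y x) - complex_of_real (poisson 0 1 x) = ((cnj (cauchy z x) - cnj (cauchy w x)) - (cauchy z x - cauchy w x)) / (2 * \<i>)"
        unfolding poisson_cauchy(1)[OF y] poisson_cauchy(1)[OF zero_less_one] z_def w_def by (simp add: diff_divide_distrib add_divide_distrib algebra_simps)
      also have "\<dots> = ((cnj w - cnj z) / (2 * \<i>)) * cnj (cauchy w x * cauchy z x) - ((w - z) / (2 * \<i>)) * (cauchy w x * cauchy z x)"
        unfolding d d' by (subst diff_divide_distrib) (simp only: times_divide_eq_left)
      finally have e: "complex_of_real (poisson s y x) - complex_of_real (poisson 0 1 x) = ((cnj w - cnj z) / (2 * \<i>)) * cnj (cauchy w x * cauchy z x) - ((w - z) / (2 * \<i>)) * (cauchy w x * cauchy z x)" .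
      show ?thesis unfolding right_diff_distrib[symmetric] e by (simp only: right_diff_distrib mult.left_commute)
    qed
    then have "(LINT x|lborel. \<psi> x * complex_of_real (poisson s y x) - \<psi> x * complex_of_real (poisson 0 1 x))
       = (LINT x|lborel. ((cnj w - cnj z) / (2 * \<i>)) * (\<psi> x * cnj (cauchy w x * cauchy z x)) - ((w - z) / (2 * \<i>)) * (\<psi> x * (cauchy w x * cauchy z x)))"
      by (simp only:)
    also have "\<dots> = ((cnj w - cnj z) / (2 * \<i>)) * (LINT x|lborel. \<psi> x * cnj (cauchy w x * cauchy z x)) - ((w - z) / (2 * \<i>)) * (LINT x|lborel. \<psi> x * (cauchy w x * cauchy z x))"
      by (subst Bochner_Integration.integral_diff) (intro integrable_mult_right i1 zw | simp only: integral_mult_right_zero)+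
    also have "\<dots> = 0" by (simp only: orth orth' zw mult_zero_right diff_zero)
    finally show ?thesis
      using Bochner_Integration.integral_diff[OF ip[OF y, of s] ip[OF zero_less_one, of 0]] by (simp add: c0_def)
  qed
  define c where "c = c0 / pi"
  have local: "integrable lborel (\<lambda>x. indicator {a..<b} x * (\<psi> x - c))" "(LINT x|lborel. indicator {a..<b} x * (\<psi> x - c)) = 0" if "a \<le> b" for a b
  proof -
    note pc = poisson_constant[OF \<psi>m ip[OF zero_less_one] const that]
    have eq: "indicator {a..<b} x * (\<psi> x - c) = indicator {a..<b} x * \<psi> x - complex_of_real (indicator {a..<b} x) * c" for x
      by (simp add: indicator_def)
    have ii: "integrable lborel (\<lambda>x. complex_of_real (indicator {a..<b} x) * c)"
      using that by (intro integrable_mult_left integrable_of_real integrable_real_indicator) auto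
    show "integrable lborel (\<lambda>x. indicator {a..<b} x * (\<psi> x - c))"
      unfolding eq by (rule Bochner_Integration.integrable_diff[OF pc(1) ii])
    have "(LINT x|lborel. indicator {a..<b} x * (\<psi> x - c)) = c0 / pi * complex_of_real (b - a) - (LINT x|lborel. complex_of_real (indicator {a..<b} x) * c)"
      unfolding eq by (simp only: Bochner_Integration.integral_diff[OF pc(1) ii] pc(2))
    also have "(LINT x|lborel. complex_of_real (indicator {a..<b} x) * c) = complex_of_real (b - a) * c"
      using that by (simp only: integral_mult_left_zero integral_complex_of_real) simp
    finally show "(LINT x|lborel. indicator {a..<b} x * (\<psi> x - c)) = 0" by (simp add: c_def)
  qed
  have "AE x in lborel. \<forall>n::nat. indicator {- real n..<real n} x * (\<psi> x - c) = 0"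
    unfolding AE_all_countable
  proof
    fix n :: nat
    show "AE x in lborel. indicator {- real n..<real n} x * (\<psi> x - c) = 0"
    proof (rule set_integral_zero_of_tails[OF local(1)])
      fix s :: real
      \<comment> \<open>The tail point clamped to the interval, so that a tail of the truncated
        function is again an integral over an interval, possibly empty.\<close>
      define s' where "s' = min (real n) (max s (- real n))"
      have "(LINT x:{s..}|lborel. indicator {- real n..<real n} x * (\<psi> x - c)) = (LINT x|lborel. indicator {s'..<real n} x * (\<psi> x - c))"
        unfolding set_lebesgue_integral_def by (intro Bochner_Integration.integral_cong) (auto simp: indicator_def s'_def)
      also have "\<dots> = 0" by (rule local(2)) (simp add: s'_def)
      finally show "(LINT x:{s..}|lborel. indicator {- real n..<real n} x * (\<psi> x - c)) = 0" .
    qed simp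
  qed
  then have \<psi>c: "AE x in lborel. \<psi> x = c"
  proof eventually_elim
    case (elim x)
    obtain n where n: "\<bar>x\<bar> < real n" using reals_Archimedean2 by blast
    then have "x \<in> {- real n..<real n}" by auto
    then show ?case using elim[rule_format, of n] by simp
  qed
  show ?thesis
  proof (rule that)
    show "op_eq T (op_scale c id)"
      unfolding op_eq_def ae_eq_def
    proof
      fix g assume "g \<in> L2"
      from T\<psi>[OF this] \<psi>c show "AE x in lborel. T g x = op_scale c id g x"
        by eventually_elim (simp add: op_scale_def)
    qed
  qed
qed

section \<open>Scalars modulo the compacts and the conclusion\<close>

lemma bop_scalar: "bop (op_scale c id)"
proof -
  have "bm (\<lambda>_. c)" by (rule bmI[of _ "cmod c"]) auto
  from bop_mult[OF this] show ?thesis by (simp add: op_scale_def)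
qed

lemma scalar_Ap: "op_scale c id \<in> Ap"
  unfolding Ap_def wot_closure_def
proof (intro CollectI conjI bop_scalar allI impI)
  fix F :: "(fn \<times> fn) set" and e :: real assume "0 < e"
  have "op_scale c (Mop 0) \<in> gen_alg" by (intro gen_scale gen_M) simp
  moreover have "op_scale c (Mop 0) = op_scale c id" by (simp add: op_scale_def Mop_def fun_eq_iff)
  ultimately show "\<exists>A\<in>gen_alg. \<forall>(f, g)\<in>F. cmod (l2inner (op_scale c id f) g - l2inner (A f) g) < e"
    using \<open>0 < e\<close> by (intro bexI[of _ "op_scale c id"]) auto
qed

lemma scalar_Ap_star: "op_scale c id \<in> Ap_star"
  unfolding Ap_star_def
proof (intro CollectI bexI[OF _ scalar_Ap[of "cnj c"]])
  show "is_adjoint (op_scale c id) (op_scale (cnj c) id)"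
    unfolding is_adjoint_def
    by (intro conjI bop_scalar ballI) (simp add: l2inner_def op_scale_def mult.assoc mult.left_commute)
qed

lemma op_eq_trans: "op_eq A B \<Longrightarrow> op_eq B C \<Longrightarrow> op_eq A C"
  unfolding op_eq_def ae_eq_def
proof
  fix f assume a: "\<forall>f\<in>L2. AE x in lborel. A f x = B f x" "\<forall>f\<in>L2. AE x in lborel. B f x = C f x" "f \<in> L2"
  from a(1)[rule_format, OF a(3)] a(2)[rule_format, OF a(3)] show "AE x in lborel. A f x = C f x"
    by eventually_elim simp
qed

lemma plus_K_selfadjoint: "plus_K (Ap \<inter> Ap_star) = plus_K scalar_ops"
proof
  show "plus_K scalar_ops \<subseteq> plus_K (Ap \<inter> Ap_star)"
    unfolding plus_K_def scalar_ops_def using scalar_Ap scalar_Ap_star by blast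
  show "plus_K (Ap \<inter> Ap_star) \<subseteq> plus_K scalar_ops"
  proof
    fix T assume "T \<in> plus_K (Ap \<inter> Ap_star)"
    then obtain A K where A: "A \<in> Ap" "A \<in> Ap_star" and K: "compact_op K" "op_eq T (op_add A K)"
      by (auto simp: plus_K_def)
    from A(2) obtain S where "S \<in> Ap" "is_adjoint A S" by (auto simp: Ap_star_def)
    then obtain c where c: "op_eq A (op_scale c id)" using Ap_selfadjoint_scalar[OF A(1)] by blast
    have "op_eq (op_add A K) (op_add (op_scale c id) K)"
      using c unfolding op_eq_def ae_eq_def op_add_def by (auto elim!: eventually_mono)
    then have "op_eq T (op_add (op_scale c id) K)" by (rule op_eq_trans[OF K(2)])
    then show "T \<in> plus_K scalar_ops" unfolding plus_K_def scalar_ops_def using K(1) by blast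
  qed
qed

lemma op_eq_op_of:
  assumes "\<And>x. blinfun_apply A x = blinfun_apply B x + blinfun_apply C x"
  shows "op_eq (op_of A) (op_add (op_of B) (op_of C))"
  unfolding op_eq_def
proof
  fix f assume "f \<in> L2"
  have "cls (op_of A f) = cls (op_add (op_of B) (op_of C) f)"
    unfolding op_add_def by (simp add: op_of_L2 assms flip: cls_add)
  then show "ae_eq (op_of A f) (op_add (op_of B) (op_of C) f)"
    by (subst (asm) cls_eq_iff) (auto simp: op_of_L2 op_add_def L2_add)
qed

theorem theorem6p3:
  shows "plus_K (Ap \<inter> Ap_star) \<subset> QAp \<and> plus_K (Ap \<inter> Ap_star) = plus_K scalar_ops"
proof (intro conjI psubsetI plus_K_selfadjoint)
  show "plus_K (Ap \<inter> Ap_star) \<subseteq> QAp" by (auto simp: QAp_def plus_K_def)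
  obtain X X' where X: "adjoint_pair X X'" "bipolar X" "compact_bl (X - X')"
    "\<And>c K. compact_bl K \<Longrightarrow> \<not> (\<forall>x. blinfun_apply X x = c *\<^sub>C x + blinfun_apply K x)"
    by (rule quasicompact_witness) blast
  have lin: "clinear_op X" "clinear_op X'" "clinear_op (X - X')" "clinear_op 0"
    using adjoint_pair_clinear[OF X(1)] adjoint_pair_clinear[OF adjoint_pair_sym[OF X(1)]]
      adjoint_pair_clinear[OF adjoint_pair_diff[OF X(1) adjoint_pair_sym[OF X(1)]]]
      adjoint_pair_clinear[OF adjoint_pair_zero] by auto
  have XAp: "op_of X \<in> Ap" by (rule bipolar_imp_Ap[OF X(2) lin(1)])
  have "is_adjoint (op_of X') (op_of X)"
    unfolding is_adjoint_def using lin
    by (auto simp: bop_op_of op_of_L2 adjoint_pairD[OF X(1)] simp flip: cinner_cls)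
  then have XApS: "op_of X' \<in> Ap_star" using XAp unfolding Ap_star_def by blast
  have "op_eq (op_of X) (op_add (op_of X) (op_of 0))" by (rule op_eq_op_of) simp
  then have 1: "op_of X \<in> plus_K Ap"
    unfolding plus_K_def using XAp compact_op_op_of[OF lin(4) compact_bl_zero] by blast
  \<comment> \<open>\<open>X\<close> is its adjoint plus the compact difference, which places it in
    the second summand space.\<close>
  have "op_eq (op_of X) (op_add (op_of X') (op_of (X - X')))" by (rule op_eq_op_of) (simp add: blinfun.diff_left)
  then have 2: "op_of X \<in> plus_K Ap_star"
    unfolding plus_K_def using XApS compact_op_op_of[OF lin(3) X(3)] by blast
  have "op_of X \<notin> plus_K scalar_ops"
  proof
    assume "op_of X \<in> plus_K scalar_ops"
    then obtain c K where K: "compact_op K" "op_eq (op_of X) (op_add (op_scale c id) K)"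
      by (auto simp: plus_K_def scalar_ops_def)
    have bK: "bop K" using K(1) by (simp add: compact_op_def)
    \<comment> \<open>The decomposition is carried to the quotient space, where it contradicts the
      choice of \<open>X\<close> with the compact operator \<open>hat K\<close>.\<close>
    have "X x = c *\<^sub>C x + hat K x" for x
    proof -
      obtain f where f: "f \<in> L2" "x = cls f" by (rule l2_cases)
      have "ae_eq (op_of X f) (\<lambda>x. c * f x + K f x)"
        using K(2) f unfolding op_eq_def op_add_def op_scale_def by simp
      then have "cls (op_of X f) = cls (\<lambda>x. c * f x + K f x)"
        using f by (subst cls_eq_iff) (auto intro!: op_of_L2 L2_add L2_scale bop_L2[OF bK])
      then show ?thesis
        using f by (simp add: hat_cls bK cls_cscale cls_add L2_scale bop_L2[OF bK])
    qed
    then show False using X(4)[OF compact_bl_hat[OF K(1)]] by blast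
  qed
  then show "plus_K (Ap \<inter> Ap_star) \<noteq> QAp" using 1 2 plus_K_selfadjoint by (auto simp: QAp_def)
qed

end
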